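(* There exist $\varepsilon>0$ and a holomorphic family $(X_{\mathbf t})_{\mathbf t\in\Delta}$ of compact complex manifolds of complex dimension $3$, where $\Delta=\{\mathbf t\in\mathbb C : |\mathbf t|<\varepsilon\}$, such that $X_{\mathbf t}$ has holomorphically trivial canonical bundle for every $\mathbf t\in\Delta$, and (i) $X_0$ admits a solution to the Strominger system with $\alpha'>0$, but (ii) $X_{\mathbf t}$ does not admit any balanced metric for any $\mathbf t\in\Delta$ with $\operatorname{Im}\mathbf t\neq 0$. In particular, the Strominger property is not stable under small deformations of the complex structure.
   Context: **Strominger system.** Let $X$ be a compact complex manifold of complex dimension $3$ with holomorphically trivial canonical bundle, and let $\Psi$ be a nowhere vanishing holomorphic $(3,0)$-form on $X$. A Hermitian metric $g$ is identified with its fundamental $(1,1)$-form $F$, normalized so that $F=\frac{i}{2}\sum_{k=1}^3\theta^k\wedge\overline{\theta^k}$ for a local unitary $(1,0)$-coframe $\theta^k=e^{2k-1}+i\,e^{2k}$, with $\{e^1,\dots,e^6\}$ $g$-orthonormal. Let $\|\Psi\|_F$ denote the norm of $\Psi$ with respect to $F$. Let $T=JdF$ be the torsion $3$-form of the Strominger-Bismut connection. With the sign conventions of the paper, $T=i(\partial-\bar\partial)F$, so $dT=d(JdF)=-2i\,\partial\bar\partial F$. A solution to the Strominger system on $X$ with slope parameter $\alpha'$ (a non-zero real constant) consists of a Hermitian metric $F$ on $X$, a metric connection $\nabla$ on the tangent bundle $TX$ (that is, $\nabla g=0$) with curvature $\Omega$, and a holomorphic Hermitian vector bundle $(E,h)$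 over $X$ with a connection $A$ compatible with $h$ and with curvature $\Omega^A$, such that $$d(\|\Psi\|_F\,F^2)=0,$$ $$\Omega^A\wedge F^2=0,\qquad (\Omega^A)^{0,2}=(\Omega^A)^{2,0}=0,$$ $$dT=\frac{\alpha'}{4}\left(\operatorname{tr}\Omega\wedge\Omega-\operatorname{tr}\Omega^A\wedge\Omega^A\right).$$ No further restriction is placed on $\nabla$ or on $A$. In particular a flat (trivial) $A$ is allowed. Trace convention: $\operatorname{tr}\Omega\wedge\Omega=\sum_{i<j}\Omega^i_j\wedge\Omega^i_j$, where $(\Omega^i_j)$ are the curvature $2$-forms in a local real orthonormal frame. The same convention is used for $\Omega^A$ on the underlying real bundle of $E$. **Strominger property.** A compact complex manifold $X$ of complex dimension $3$ has the Strominger property if it has holomorphically trivial canonical bundle and admits a solution to the Strominger system for some non-zero $\alpha'$. **Balanced metric.** A Hermitian metric $F$ on a complex manifold of complex dimension $3$ is balanced if $d(F^2)=0$. **Stability.** A holomorphic family $(X_{\mathbf t})_{\mathbf t\in\Delta}$ over an open disc $\Delta\subset\mathbb C$ is the family of fibres of a proper holomorphic submersion onto $\Delta$. A property $\mathcal P$ of compact complex manifolds is open (or stable) under holomorphic deformations if, for every holomorphic family $(X_{\mathbf t})_{\mathbf t\in\Delta}$ of compact complex manifolds and every $\mathbf t_0\in\Delta$, whenever $X_{\mathbf t_0}$ has $\mathcal P$, then $X_{\mathbf t}$ has $\mathcal P$ for all $\mathbf t\in\Delta$ sufficiently close to $\mathbf t_0$. *)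

theory Defs
  imports "HOL-Analysis.Analysis"
begin

section \<open>Complex manifolds\<close>

text \<open>A chart is a pair of a domain and a coordinate map; the map is irrelevant off the domain.\<close>

type_synonym ('a, 'n) chart = "'a set \<times> ('a \<Rightarrow> complex ^ 'n)"

record ('a, 'n::finite) cman =
  mtop :: "'a topology"
  atlas :: "('a, 'n) chart set"

text \<open>The coordinate image of the part of \<open>W\<close> covered by \<open>c\<close>, and the inverse of \<open>c\<close>.\<close>

definition img :: "('a, 'n::finite) chart \<Rightarrow> 'a set \<Rightarrow> (complex ^ 'n) set" where
  "img c W = snd c ` (fst c \<inter> W)"

definition cinv :: "('a, 'n::finite) chart \<Rightarrow> complex ^ 'n \<Rightarrow> 'a" where
  "cinv c = inv_into (fst c) (snd c)"

definition trans_map :: "('a, 'n::finite) chart \<Rightarrow> ('a, 'n) chart \<Rightarrow> complex ^ 'n \<Rightarrow> complex ^ 'n" where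
  "trans_map c c' = snd c' \<circ> cinv c"

definition hol_fun :: "(complex ^ 'n::finite) set \<Rightarrow> (complex ^ 'n \<Rightarrow> complex) \<Rightarrow> bool" where
  "hol_fun S f \<longleftrightarrow> open S \<and>
     (\<forall>x\<in>S. \<exists>f'. (f has_derivative f') (at x) \<and> (\<forall>a v. f' (a *s v) = a * f' v))"

definition chart_on :: "'a topology \<Rightarrow> ('a, 'n::finite) chart \<Rightarrow> bool" where
  "chart_on X c \<longleftrightarrow> openin X (fst c) \<and> open (snd c ` fst c) \<and>
     homeomorphic_map (subtopology X (fst c)) (top_of_set (snd c ` fst c)) (snd c)"

definition hol_compatible :: "('a, 'n::finite) chart \<Rightarrow> ('a, 'n) chart \<Rightarrow> bool" where
  "hol_compatible c c' \<longleftrightarrow>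
     (\<forall>i. hol_fun (img c (fst c')) (\<lambda>x. trans_map c c' x $ i)) \<and>
     (\<forall>i. hol_fun (img c' (fst c)) (\<lambda>x. trans_map c' c x $ i))"

definition complex_manifold :: "('a, 'n::finite) cman \<Rightarrow> bool" where
  "complex_manifold M \<longleftrightarrow>
     Hausdorff_space (mtop M) \<and> second_countable (mtop M) \<and>
     (\<forall>c\<in>atlas M. chart_on (mtop M) c) \<and>
     (\<Union>c\<in>atlas M. fst c) = topspace (mtop M) \<and>
     (\<forall>c\<in>atlas M. \<forall>c'\<in>atlas M. hol_compatible c c')"

definition compact_complex_manifold :: "('a, 'n::finite) cman \<Rightarrow> bool" where
  "compact_complex_manifold M \<longleftrightarrow> complex_manifold M \<and> compact_space (mtop M)"

definition max_atlas :: "('a, 'n::finite) cman \<Rightarrow> ('a, 'n) chart set" where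
  "max_atlas M = {c. chart_on (mtop M) c \<and> (\<forall>c'\<in>atlas M. hol_compatible c c')}"


section \<open>Holomorphic families\<close>

definition holomorphic_submersion :: "('a, 'n::finite) cman \<Rightarrow> ('a \<Rightarrow> complex) \<Rightarrow> bool" where
  "holomorphic_submersion M f \<longleftrightarrow>
     (\<forall>c\<in>atlas M. hol_fun (snd c ` fst c) (f \<circ> cinv c) \<and>
        (\<forall>x \<in> snd c ` fst c. surj (frechet_derivative (f \<circ> cinv c) (at x))))"

definition holomorphic_family :: "('a, 4) cman \<Rightarrow> ('a \<Rightarrow> complex) \<Rightarrow> complex set \<Rightarrow> bool" where
  "holomorphic_family Y f D \<longleftrightarrow> complex_manifold Y \<and> holomorphic_submersion Y f \<and>
     f ` topspace (mtop Y) = D \<and> proper_map (mtop Y) (top_of_set D) f"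

text \<open>
  The complex structure of a fibre is the submanifold structure: its charts are the slices of those
  holomorphic charts of the total space whose last coordinate is the projection.
  Such charts cover the total space because the projection is a submersion.
\<close>

definition drop_last :: "complex ^ 4 \<Rightarrow> complex ^ 3" where
  "drop_last z = vector [z $ 1, z $ 2, z $ 3]"

definition family_fibre :: "('a, 4) cman \<Rightarrow> ('a \<Rightarrow> complex) \<Rightarrow> complex \<Rightarrow> ('a, 3) cman" where
  "family_fibre Y f t =
     (let S = {p \<in> topspace (mtop Y). f p = t} in
      \<lparr> mtop = subtopology (mtop Y) S,
        atlas = {(fst c \<inter> S, drop_last \<circ> snd c) | c.
                   c \<in> max_atlas Y \<and> (\<forall>p\<in>fst c. snd c p $ 4 = f p)} \<rparr>)"

definition stable_under_deformations :: "(('a, 3) cman \<Rightarrow> bool) \<Rightarrow> bool" where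
  "stable_under_deformations P \<longleftrightarrow>
     (\<forall>Y f z r. 0 < r \<longrightarrow> holomorphic_family Y f (ball z r) \<longrightarrow>
        (\<forall>t\<^sub>0\<in>ball z r. P (family_fibre Y f t\<^sub>0) \<longrightarrow>
           (\<exists>\<delta>>0. \<forall>t\<in>ball z r. dist t t\<^sub>0 < \<delta> \<longrightarrow> P (family_fibre Y f t))))"

text \<open>
  A type of points for total spaces. It has more than continuum many elements, so every second
  countable manifold is isomorphic to one whose points are of this type; quotients of subsets of
  \<open>complex ^ 4\<close> live on it directly.
\<close>

type_synonym point = "(complex ^ 4) set"


section \<open>Differential forms\<close>

primrec Ck_on :: "nat \<Rightarrow> 'a::euclidean_space set \<Rightarrow> ('a \<Rightarrow> 'b::real_normed_vector) \<Rightarrow> bool" where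
  "Ck_on 0 S f \<longleftrightarrow> continuous_on S f"
| "Ck_on (Suc k) S f \<longleftrightarrow> (\<forall>x\<in>S. f differentiable (at x)) \<and>
     (\<forall>v. Ck_on k S (\<lambda>x. frechet_derivative f (at x) v))"

definition smooth_on :: "'a::euclidean_space set \<Rightarrow> ('a \<Rightarrow> 'b::real_normed_vector) \<Rightarrow> bool" where
  "smooth_on S f \<longleftrightarrow> open S \<and> (\<forall>k. Ck_on k S f)"

text \<open>
  A complex-valued \<open>k\<close>-covector takes its arguments as a sequence \<open>v\<close>, of which only
  \<open>v 0, \<dots>, v (k - 1)\<close> matter. The wedge product has the normalisation
  \<open>(\<alpha> \<and> \<beta>) (u, v) = \<alpha> u * \<beta> v - \<alpha> v * \<beta> u\<close> for covectors of degree one.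
\<close>

type_synonym 'v covec = "(nat \<Rightarrow> 'v) \<Rightarrow> complex"

definition alternating_form :: "nat \<Rightarrow> 'v::real_vector covec \<Rightarrow> bool" where
  "alternating_form k \<omega> \<longleftrightarrow>
     (\<forall>v w. (\<forall>i<k. v i = w i) \<longrightarrow> \<omega> v = \<omega> w) \<and>
     (\<forall>v. \<forall>i<k. linear (\<lambda>u. \<omega> (v(i := u)))) \<and>
     (\<forall>v. \<forall>i<k. \<forall>j<k. i \<noteq> j \<and> v i = v j \<longrightarrow> \<omega> v = 0)"

definition wedge :: "nat \<Rightarrow> nat \<Rightarrow> 'v covec \<Rightarrow> 'v covec \<Rightarrow> 'v covec" where
  "wedge k l \<alpha> \<beta> v =
     (\<Sum>\<sigma> | \<sigma> permutes {..<k + l}.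
        of_int (sign \<sigma>) * \<alpha> (\<lambda>i. v (\<sigma> i)) * \<beta> (\<lambda>i. v (\<sigma> (k + i)))) / (fact k * fact l)"

text \<open>Exterior derivative of a form of degree \<open>k\<close> on an open set of coordinate space.\<close>

definition ext_deriv :: "nat \<Rightarrow> ('v::real_normed_vector \<Rightarrow> 'v covec) \<Rightarrow> 'v \<Rightarrow> 'v covec" where
  "ext_deriv k \<omega> x v =
     (\<Sum>i\<le>k. (- 1) ^ i *
        frechet_derivative (\<lambda>y. \<omega> y (\<lambda>j. if j < i then v j else v (Suc j))) (at x) (v i))"

text \<open>The differential of the change of coordinates from \<open>c\<close> to \<open>c'\<close> at the point \<open>p\<close>.\<close>

definition jac :: "('a, 'n::finite) chart \<Rightarrow> ('a, 'n) chart \<Rightarrow> 'a \<Rightarrow> complex ^ 'n \<Rightarrow> complex ^ 'n" where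
  "jac c c' p = frechet_derivative (trans_map c c') (at (snd c p))"

text \<open>
  Tensor fields on a manifold are families of coordinate expressions, one for each chart of the
  atlas, that transform correctly. All pointwise and differential operations below are carried out
  in charts.
\<close>

type_synonym ('a, 'n) field_form = "('a, 'n) chart \<Rightarrow> complex ^ 'n \<Rightarrow> (complex ^ 'n) covec"

definition form_on :: "('a, 'n::finite) cman \<Rightarrow> 'a set \<Rightarrow> nat \<Rightarrow> ('a, 'n) field_form \<Rightarrow> bool" where
  "form_on M W k \<omega> \<longleftrightarrow>
     (\<forall>c\<in>atlas M.
        (\<forall>x\<in>img c W. alternating_form k (\<omega> c x)) \<and>
        (\<forall>v. smooth_on (img c W) (\<lambda>x. \<omega> c x v))) \<and>
     (\<forall>c\<in>atlas M. \<forall>c'\<in>atlas M. \<forall>p \<in> fst c \<inter> fst c' \<inter> W. \<forall>v.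
        \<omega> c (snd c p) v = \<omega> c' (snd c' p) (\<lambda>i. jac c c' p (v i)))"

text \<open>A nowhere vanishing holomorphic section of the canonical bundle of a threefold.\<close>

definition hol_volume_form :: "('a, 3) cman \<Rightarrow> ('a, 3) field_form \<Rightarrow> bool" where
  "hol_volume_form M \<Psi> \<longleftrightarrow> form_on M (topspace (mtop M)) 3 \<Psi> \<and>
     (\<forall>c\<in>atlas M.
        (\<forall>x\<in>snd c ` fst c. \<forall>v. \<forall>i<3. \<forall>a. \<Psi> c x (v(i := a *s v i)) = a * \<Psi> c x v) \<and>
        (\<forall>v. hol_fun (snd c ` fst c) (\<lambda>x. \<Psi> c x v)) \<and>
        (\<forall>x\<in>snd c ` fst c. \<exists>v. \<Psi> c x v \<noteq> 0))"

definition hol_trivial_canonical :: "('a, 3) cman \<Rightarrow> bool" where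
  "hol_trivial_canonical M \<longleftrightarrow> (\<exists>\<Psi>. hol_volume_form M \<Psi>)"


section \<open>Hermitian metrics\<close>

abbreviation J :: "complex ^ 'n \<Rightarrow> complex ^ 'n::finite" where
  "J v \<equiv> \<i> *s v"

type_synonym ('a, 'n) metric =
  "('a, 'n) chart \<Rightarrow> complex ^ 'n \<Rightarrow> complex ^ 'n \<Rightarrow> complex ^ 'n \<Rightarrow> real"

definition hermitian_metric :: "('a, 'n::finite) cman \<Rightarrow> ('a, 'n) metric \<Rightarrow> bool" where
  "hermitian_metric M g \<longleftrightarrow>
     (\<forall>c\<in>atlas M.
        (\<forall>x\<in>snd c ` fst c. bilinear (g c x) \<and>
           (\<forall>v w. g c x v w = g c x w v) \<and>
           (\<forall>v. v \<noteq> 0 \<longrightarrow> 0 < g c x v v) \<and>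
           (\<forall>v w. g c x (J v) (J w) = g c x v w)) \<and>
        (\<forall>v w. smooth_on (snd c ` fst c) (\<lambda>x. g c x v w))) \<and>
     (\<forall>c\<in>atlas M. \<forall>c'\<in>atlas M. \<forall>p \<in> fst c \<inter> fst c'. \<forall>v w.
        g c (snd c p) v w = g c' (snd c' p) (jac c c' p v) (jac c c' p w))"

text \<open>
  \<open>F (v, w) = g (J v, w)\<close>, which is \<open>\<i>/2 \<Sum> \<theta>\<^sup>k \<and> cnj \<theta>\<^sup>k\<close> for a unitary coframe
  \<open>\<theta>\<^sup>k = e\<^sup>2\<^sup>k\<^sup>-\<^sup>1 + \<i> e\<^sup>2\<^sup>k\<close>.
\<close>

definition fund_form :: "('a, 'n::finite) metric \<Rightarrow> ('a, 'n) field_form" where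
  "fund_form g c x v = of_real (g c x (J (v 0)) (v 1))"

definition fund_sq :: "('a, 'n::finite) metric \<Rightarrow> ('a, 'n) field_form" where
  "fund_sq g c x = wedge 2 2 (fund_form g c x) (fund_form g c x)"

definition balanced_metric :: "('a, 3) cman \<Rightarrow> ('a, 3) metric \<Rightarrow> bool" where
  "balanced_metric M g \<longleftrightarrow> hermitian_metric M g \<and>
     (\<forall>c\<in>atlas M. \<forall>x\<in>snd c ` fst c. \<forall>v. ext_deriv 4 (fund_sq g c) x v = 0)"

text \<open>
  The pointwise norm of a \<open>(3,0)\<close>-form, scaled so that \<open>\<theta>\<^sup>1 \<and> \<theta>\<^sup>2 \<and> \<theta>\<^sup>3\<close> has norm one for a
  unitary coframe; another convention changes it by a constant factor, which does not affect the
  Strominger system. The Gram matrix is that of the coordinate frame with respect to the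
  sesquilinear extension \<open>g (v, w) + \<i> g (v, J w)\<close> of the metric, complex linear in \<open>v\<close>.
\<close>

definition form_norm :: "('a, 3) metric \<Rightarrow> ('a, 3) field_form \<Rightarrow> ('a, 3) chart \<Rightarrow> complex ^ 3 \<Rightarrow> real" where
  "form_norm g \<Psi> c x =
     (let b = (\<lambda>k::3. axis k 1 :: complex ^ 3);
          G = (\<chi> j k. Complex (g c x (b j) (b k)) (g c x (b j) (J (b k))))
      in cmod (\<Psi> c x (\<lambda>i. b (of_nat (Suc i)))) / sqrt (Re (det G)))"

text \<open>
  The torsion \<open>T = J dF\<close> of the Strominger-Bismut connection, with \<open>J\<close> acting by
  \<open>(J \<omega>) (v\<^sub>1, \<dots>) = \<omega> (J v\<^sub>1, \<dots>)\<close>. On forms of type \<open>(p, q)\<close> this is multiplication by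
  \<open>\<i>\<^sup>p (- \<i>)\<^sup>q\<close>, so \<open>T = \<i> (\<partial>F - cnj \<partial>F)\<close>.
\<close>

definition torsion_form :: "('a, 'n::finite) metric \<Rightarrow> ('a, 'n) field_form" where
  "torsion_form g c x v = ext_deriv 2 (fund_form g c) x (\<lambda>i. J (v i))"


section \<open>Connections on the tangent bundle\<close>

text \<open>
  In a chart, \<open>\<nabla>\<^sub>u Y = D Y (u) + \<Gamma> (u, Y)\<close>. The second derivative of the change of coordinates
  appears in the transformation law.
\<close>

type_synonym ('a, 'n) tconn =
  "('a, 'n) chart \<Rightarrow> complex ^ 'n \<Rightarrow> complex ^ 'n \<Rightarrow> complex ^ 'n \<Rightarrow> complex ^ 'n"

definition tangent_connection :: "('a, 'n::finite) cman \<Rightarrow> ('a, 'n) tconn \<Rightarrow> bool" where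
  "tangent_connection M \<Gamma> \<longleftrightarrow>
     (\<forall>c\<in>atlas M.
        (\<forall>x\<in>snd c ` fst c. bilinear (\<Gamma> c x)) \<and>
        (\<forall>u w. smooth_on (snd c ` fst c) (\<lambda>x. \<Gamma> c x u w))) \<and>
     (\<forall>c\<in>atlas M. \<forall>c'\<in>atlas M. \<forall>p \<in> fst c \<inter> fst c'. \<forall>u w.
        jac c c' p (\<Gamma> c (snd c p) u w) =
          frechet_derivative (\<lambda>y. frechet_derivative (trans_map c c') (at y) w) (at (snd c p)) u
          + \<Gamma> c' (snd c' p) (jac c c' p u) (jac c c' p w))"

definition metric_connection :: "('a, 'n::finite) cman \<Rightarrow> ('a, 'n) metric \<Rightarrow> ('a, 'n) tconn \<Rightarrow> bool" where
  "metric_connection M g \<Gamma> \<longleftrightarrow> tangent_connection M \<Gamma> \<and>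
     (\<forall>c\<in>atlas M. \<forall>x\<in>snd c ` fst c. \<forall>u v w.
        frechet_derivative (\<lambda>y. g c y v w) (at x) u = g c x (\<Gamma> c x u v) w + g c x v (\<Gamma> c x u w))"

text \<open>The curvature endomorphism \<open>R (u, v) w\<close>.\<close>

definition tcurv :: "('a, 'n::finite) tconn \<Rightarrow> ('a, 'n) chart \<Rightarrow> complex ^ 'n \<Rightarrow>
    complex ^ 'n \<Rightarrow> complex ^ 'n \<Rightarrow> complex ^ 'n \<Rightarrow> complex ^ 'n" where
  "tcurv \<Gamma> c x u v w =
     frechet_derivative (\<lambda>y. \<Gamma> c y v w) (at x) u - frechet_derivative (\<lambda>y. \<Gamma> c y u w) (at x) v
     + \<Gamma> c x u (\<Gamma> c x v w) - \<Gamma> c x v (\<Gamma> c x u w)"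

definition tangent_frame :: "('a, 3) metric \<Rightarrow> ('a, 3) chart \<Rightarrow> complex ^ 3 \<Rightarrow> (nat \<Rightarrow> complex ^ 3) \<Rightarrow> bool" where
  "tangent_frame g c x e \<longleftrightarrow> (\<forall>i<6. \<forall>j<6. g c x (e i) (e j) = (if i = j then 1 else 0))"

text \<open>
  The matrix entries \<open>\<Omega>\<^sup>i\<^sub>j\<close>, given by \<open>R (u, v) e\<^sub>j = \<Sum>\<^sub>i \<Omega>\<^sup>i\<^sub>j (u, v) e\<^sub>i\<close>. Curvature being a tensor,
  an orthonormal frame at the point suffices.
\<close>

definition tcurv_entry :: "('a, 3) metric \<Rightarrow> ('a, 3) tconn \<Rightarrow> ('a, 3) chart \<Rightarrow> complex ^ 3 \<Rightarrow>
    (nat \<Rightarrow> complex ^ 3) \<Rightarrow> nat \<Rightarrow> nat \<Rightarrow> (complex ^ 3) covec" where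
  "tcurv_entry g \<Gamma> c x e i j v = of_real (g c x (tcurv \<Gamma> c x (v 0) (v 1) (e j)) (e i))"

text \<open>The trace convention \<open>\<Sum>\<^sub>i\<^sub><\<^sub>j \<Omega>\<^sup>i\<^sub>j \<and> \<Omega>\<^sup>i\<^sub>j\<close> for curvature matrices of size \<open>m\<close>.\<close>

definition trace_sq :: "nat \<Rightarrow> (nat \<Rightarrow> nat \<Rightarrow> 'v covec) \<Rightarrow> 'v covec" where
  "trace_sq m \<Theta> v = (\<Sum>j<m. \<Sum>i<j. wedge 2 2 (\<Theta> i j) (\<Theta> i j) v)"


section \<open>Holomorphic Hermitian vector bundles\<close>

text \<open>
  A bundle of rank \<open>r\<close> is given by an open cover \<open>\<U>\<close> of trivialising sets and transition matrices,
  \<open>s\<^sub>U = \<tau>\<^sub>U\<^sub>V s\<^sub>V\<close>. Matrices and fibre vectors are functions of indices below \<open>r\<close>.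
\<close>

type_synonym 'a cocycle = "'a set \<Rightarrow> 'a set \<Rightarrow> 'a \<Rightarrow> nat \<Rightarrow> nat \<Rightarrow> complex"

definition hol_bundle :: "('a, 'n::finite) cman \<Rightarrow> nat \<Rightarrow> 'a set set \<Rightarrow> 'a cocycle \<Rightarrow> bool" where
  "hol_bundle M r \<U> \<tau> \<longleftrightarrow> 0 < r \<and>
     (\<forall>U\<in>\<U>. openin (mtop M) U) \<and> \<Union>\<U> = topspace (mtop M) \<and>
     (\<forall>U\<in>\<U>. \<forall>V\<in>\<U>. \<forall>c\<in>atlas M. \<forall>i<r. \<forall>j<r.
        hol_fun (img c (U \<inter> V)) (\<lambda>x. \<tau> U V (cinv c x) i j)) \<and>
     (\<forall>U\<in>\<U>. \<forall>p\<in>U. \<forall>i<r. \<forall>j<r. \<tau> U U p i j = (if i = j then 1 else 0)) \<and>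
     (\<forall>U\<in>\<U>. \<forall>V\<in>\<U>. \<forall>W\<in>\<U>. \<forall>p \<in> U \<inter> V \<inter> W. \<forall>i<r. \<forall>j<r.
        (\<Sum>k<r. \<tau> U V p i k * \<tau> V W p k j) = \<tau> U W p i j)"

text \<open>The Hermitian product \<open>\<langle>\<xi>, \<eta>\<rangle>\<close> with matrix \<open>H\<close>, complex linear in \<open>\<xi>\<close>.\<close>

definition sesq :: "nat \<Rightarrow> (nat \<Rightarrow> nat \<Rightarrow> complex) \<Rightarrow> (nat \<Rightarrow> complex) \<Rightarrow> (nat \<Rightarrow> complex) \<Rightarrow> complex" where
  "sesq r H \<xi> \<eta> = (\<Sum>i<r. \<Sum>j<r. H i j * \<xi> i * cnj (\<eta> j))"

type_synonym 'a bmetric = "'a set \<Rightarrow> 'a \<Rightarrow> nat \<Rightarrow> nat \<Rightarrow> complex"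

definition bundle_metric ::
  "('a, 'n::finite) cman \<Rightarrow> nat \<Rightarrow> 'a set set \<Rightarrow> 'a cocycle \<Rightarrow> 'a bmetric \<Rightarrow> bool" where
  "bundle_metric M r \<U> \<tau> h \<longleftrightarrow>
     (\<forall>U\<in>\<U>. \<forall>p\<in>U.
        (\<forall>i<r. \<forall>j<r. h U p j i = cnj (h U p i j)) \<and>
        (\<forall>\<xi>. (\<exists>i<r. \<xi> i \<noteq> 0) \<longrightarrow> 0 < Re (sesq r (h U p) \<xi> \<xi>))) \<and>
     (\<forall>U\<in>\<U>. \<forall>c\<in>atlas M. \<forall>i<r. \<forall>j<r. smooth_on (img c U) (\<lambda>x. h U (cinv c x) i j)) \<and>
     (\<forall>U\<in>\<U>. \<forall>V\<in>\<U>. \<forall>p \<in> U \<inter> V. \<forall>i<r. \<forall>j<r.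
        h V p i j = sesq r (h U p) (\<lambda>k. \<tau> U V p k i) (\<lambda>k. \<tau> U V p k j))"

text \<open>
  A connection is a matrix of one-forms \<open>A\<^sub>U\<close> over each \<open>U\<close>, with \<open>\<nabla> s\<^sub>U = d s\<^sub>U + A\<^sub>U s\<^sub>U\<close> and
  hence \<open>d\<tau>\<^sub>U\<^sub>V + A\<^sub>U \<tau>\<^sub>U\<^sub>V = \<tau>\<^sub>U\<^sub>V A\<^sub>V\<close>.
\<close>

type_synonym ('a, 'n) bconn = "'a set \<Rightarrow> nat \<Rightarrow> nat \<Rightarrow> ('a, 'n) field_form"

definition bundle_connection ::
  "('a, 'n::finite) cman \<Rightarrow> nat \<Rightarrow> 'a set set \<Rightarrow> 'a cocycle \<Rightarrow> ('a, 'n) bconn \<Rightarrow> bool" where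
  "bundle_connection M r \<U> \<tau> A \<longleftrightarrow>
     (\<forall>U\<in>\<U>. \<forall>i<r. \<forall>j<r. form_on M U 1 (A U i j)) \<and>
     (\<forall>U\<in>\<U>. \<forall>V\<in>\<U>. \<forall>c\<in>atlas M. \<forall>x\<in>img c (U \<inter> V). \<forall>i<r. \<forall>j<r. \<forall>v.
        frechet_derivative (\<lambda>y. \<tau> U V (cinv c y) i j) (at x) (v 0)
          + (\<Sum>k<r. A U i k c x v * \<tau> U V (cinv c x) k j)
        = (\<Sum>k<r. \<tau> U V (cinv c x) i k * A V k j c x v))"

definition unitary_connection ::
  "('a, 'n::finite) cman \<Rightarrow> nat \<Rightarrow> 'a set set \<Rightarrow> 'a bmetric \<Rightarrow> ('a, 'n) bconn \<Rightarrow> bool" where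
  "unitary_connection M r \<U> h A \<longleftrightarrow>
     (\<forall>U\<in>\<U>. \<forall>c\<in>atlas M. \<forall>x\<in>img c U. \<forall>i<r. \<forall>j<r. \<forall>v.
        frechet_derivative (\<lambda>y. h U (cinv c y) i j) (at x) (v 0) =
          (\<Sum>k<r. A U k i c x v * h U (cinv c x) k j)
          + (\<Sum>k<r. h U (cinv c x) i k * cnj (A U k j c x v)))"

definition bcurv :: "nat \<Rightarrow> ('a, 'n::finite) bconn \<Rightarrow> 'a set \<Rightarrow> nat \<Rightarrow> nat \<Rightarrow> ('a, 'n) field_form" where
  "bcurv r A U i j c x v =
     ext_deriv 1 (A U i j c) x v + (\<Sum>k<r. wedge 1 1 (A U i k c x) (A U k j c x) v)"

text \<open>
  The parts of type \<open>(2,0)\<close> and \<open>(0,2)\<close> of a two-form: its complex bilinear extension evaluated on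
  the projections \<open>(v - \<i> J v) / 2\<close>, respectively \<open>(v + \<i> J v) / 2\<close>, of both arguments.
\<close>

definition part_20 :: "(complex ^ 'n::finite) covec \<Rightarrow> complex ^ 'n \<Rightarrow> complex ^ 'n \<Rightarrow> complex" where
  "part_20 \<omega> u v =
     (let b = (\<lambda>x y. \<omega> (\<lambda>k. if k = 0 then x else y))
      in (b u v - \<i> * b (J u) v - \<i> * b u (J v) - b (J u) (J v)) / 4)"

definition part_02 :: "(complex ^ 'n::finite) covec \<Rightarrow> complex ^ 'n \<Rightarrow> complex ^ 'n \<Rightarrow> complex" where
  "part_02 \<omega> u v =
     (let b = (\<lambda>x y. \<omega> (\<lambda>k. if k = 0 then x else y))
      in (b u v + \<i> * b (J u) v + \<i> * b u (J v) - b (J u) (J v)) / 4)"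

text \<open>
  Orthonormal frames and curvature matrix of the underlying real bundle, of rank \<open>2 * r\<close>, with the
  real part of the Hermitian metric.
\<close>

definition bundle_frame :: "nat \<Rightarrow> (nat \<Rightarrow> nat \<Rightarrow> complex) \<Rightarrow> (nat \<Rightarrow> nat \<Rightarrow> complex) \<Rightarrow> bool" where
  "bundle_frame r H f \<longleftrightarrow>
     (\<forall>a<2*r. \<forall>b<2*r. Re (sesq r H (f a) (f b)) = (if a = b then 1 else 0))"

definition bcurv_entry :: "nat \<Rightarrow> (nat \<Rightarrow> nat \<Rightarrow> complex) \<Rightarrow> (nat \<Rightarrow> nat \<Rightarrow> 'v covec) \<Rightarrow>
    (nat \<Rightarrow> nat \<Rightarrow> complex) \<Rightarrow> nat \<Rightarrow> nat \<Rightarrow> 'v covec" where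
  "bcurv_entry r H \<Omega> f a b v =
     of_real (Re (sesq r H (\<lambda>i. \<Sum>j<r. \<Omega> i j v * f b j) (f a)))"


section \<open>The Strominger system\<close>

definition strominger_solution ::
  "('a, 3) cman \<Rightarrow> ('a, 3) field_form \<Rightarrow> real \<Rightarrow> ('a, 3) metric \<Rightarrow> ('a, 3) tconn \<Rightarrow>
   nat \<Rightarrow> 'a set set \<Rightarrow> 'a cocycle \<Rightarrow> 'a bmetric \<Rightarrow> ('a, 3) bconn \<Rightarrow> bool" where
  "strominger_solution M \<Psi> \<alpha> g \<Gamma> r \<U> \<tau> h A \<longleftrightarrow>
     \<alpha> \<noteq> 0 \<and>
     hermitian_metric M g \<and> metric_connection M g \<Gamma> \<and>
     hol_bundle M r \<U> \<tau> \<and> bundle_metric M r \<U> \<tau> h \<and>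
     bundle_connection M r \<U> \<tau> A \<and> unitary_connection M r \<U> h A \<and>
     (\<forall>c\<in>atlas M. \<forall>x\<in>snd c ` fst c. \<forall>v.
        ext_deriv 4 (\<lambda>y w. of_real (form_norm g \<Psi> c y) * fund_sq g c y w) x v = 0) \<and>
     (\<forall>U\<in>\<U>. \<forall>c\<in>atlas M. \<forall>x\<in>img c U. \<forall>i<r. \<forall>j<r.
        (\<forall>v. wedge 2 4 (bcurv r A U i j c x) (fund_sq g c x) v = 0) \<and>
        (\<forall>u v. part_02 (bcurv r A U i j c x) u v = 0) \<and>
        (\<forall>u v. part_20 (bcurv r A U i j c x) u v = 0)) \<and>
     (\<forall>U\<in>\<U>. \<forall>c\<in>atlas M. \<forall>x\<in>img c U. \<forall>e f.
        tangent_frame g c x e \<and> bundle_frame r (h U (cinv c x)) f \<longrightarrow>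
        (\<forall>v. ext_deriv 3 (torsion_form g c) x v =
           of_real (\<alpha> / 4) *
             (trace_sq 6 (tcurv_entry g \<Gamma> c x e) v
              - trace_sq (2 * r)
                  (bcurv_entry r (h U (cinv c x)) (\<lambda>i j. bcurv r A U i j c x) f) v)))"

definition admits_strominger :: "('a, 3) cman \<Rightarrow> real \<Rightarrow> bool" where
  "admits_strominger M \<alpha> \<longleftrightarrow>
     (\<exists>\<Psi> g \<Gamma> r \<U> \<tau> h A. hol_volume_form M \<Psi> \<and> strominger_solution M \<Psi> \<alpha> g \<Gamma> r \<U> \<tau> h A)"

definition strominger_property :: "('a, 3) cman \<Rightarrow> bool" where
  "strominger_property M \<longleftrightarrow> compact_complex_manifold M \<and> hol_trivial_canonical M \<and>
     (\<exists>\<alpha>. \<alpha> \<noteq> 0 \<and> admits_strominger M \<alpha>)"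

end

theory Submission
  imports Defs "HOL-Complex_Analysis.Cauchy_Integral_Formula"
begin

text \<open>
  The family is a deformation of the Iwasawa manifold. Let Gaussian integers \<open>(a, b, c)\<close>, with the
  multiplication of the complex Heisenberg group, act on \<open>\<complex>\<^sup>3\<close> by
  \<open>(w\<^sub>1, w\<^sub>2, w\<^sub>3) \<mapsto> (w\<^sub>1 + a + t b\<^sup>*, w\<^sub>2 + b, w\<^sub>3 + a w\<^sub>2 + c)\<close>. In the coordinates
  \<open>(w\<^sub>1 - t w\<^sub>2\<^sup>*, w\<^sub>2, w\<^sub>3)\<close> this is left multiplication, for every \<open>t\<close>; only the complex structure
  depends on \<open>t\<close>. The action is free, properly discontinuous and holomorphic in \<open>(w, t)\<close>, and a product
  of three unit squares meets every orbit, so the quotients form a family of compact manifolds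
  (\<open>family_total\<close>). The \<open>(1,0)\<close>-forms \<open>\<omega>\<^sub>1 = dw\<^sub>1\<close>, \<open>\<omega>\<^sub>2 = dw\<^sub>2\<close> and \<open>\<omega>\<^sub>3 = dw\<^sub>3 - (w\<^sub>1 - t w\<^sub>2\<^sup>*) dw\<^sub>2\<close>
  are invariant, with \<open>d\<omega>\<^sub>3 = - \<omega>\<^sub>1 \<and> \<omega>\<^sub>2 - t \<omega>\<^sub>2 \<and> \<omega>\<^sub>2\<^sup>*\<close> and product \<open>dw\<^sub>1 \<and> dw\<^sub>2 \<and> dw\<^sub>3\<close>, which trivialises
  the canonical bundle (\<open>hol_volume_form_vol_form\<close>).

  For \<open>t = 0\<close>, take the metric with unitary coframe \<open>\<omega>\<^sub>k\<close>. The volume form has constant norm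
  (\<open>iwa_norm\<close>), and \<open>dF \<and> F = 0\<close> because every term of \<open>dF\<close>, the imaginary part of
  \<open>\<omega>\<^sub>1 \<and> \<omega>\<^sub>2 \<and> \<omega>\<^sub>3\<^sup>*\<close>, shares a factor with every term of \<open>F\<close> (\<open>dfundV_wedge_fundV\<close>). Moreover
  \<open>dT = - \<omega>\<^sub>1 \<and> \<omega>\<^sub>2 \<and> \<omega>\<^sub>1\<^sup>* \<and> \<omega>\<^sub>2\<^sup>* = - 4 e\<^sup>1\<^sup>2\<^sup>3\<^sup>4\<close>. With a flat line bundle the tangent connection has to
  produce this negative multiple alone. The connection used is \<open>d\<close> plus a form with values in the
  rotation algebra, acting by the cross product with the vector
  \<open>(Re \<omega>\<^sub>3, e\<^sup>1, 2 e\<^sup>3)\<close> on \<open>\<complex>\<^sup>3\<close>. The first component of its curvature is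
  \<open>Re d\<omega>\<^sub>3 + 2 e\<^sup>1 \<and> e\<^sup>3 = e\<^sup>1 \<and> e\<^sup>3 + e\<^sup>2 \<and> e\<^sup>4\<close>; the quadratic term has outweighed the derivative and
  changed the sign of the square. The other two components are decomposable two-forms, of square
  zero. The trace is thus \<open>- 4 e\<^sup>1\<^sup>2\<^sup>3\<^sup>4\<close>, and \<open>\<alpha>' = 4\<close> solves the system (\<open>dtorsV_eq_trace\<close>,
  \<open>trace_crossV\<close>, \<open>gam_curvature\<close>, \<open>strominger_iwa\<close>).

  For the other fibres, suppose that \<open>\<rho> F\<^sup>2\<close> is closed, with a positive function \<open>\<rho>\<close>. Then
  \<open>d (\<rho> F\<^sup>2 \<and> \<omega>\<^sub>3) = \<rho> F\<^sup>2 \<and> d\<omega>\<^sub>3 = - t \<rho> F\<^sup>2 \<and> \<omega>\<^sub>2 \<and> \<omega>\<^sub>2\<^sup>*\<close>, as the product of a \<open>(2,2)\<close>-form with the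
  \<open>(2,0)\<close>-form \<open>\<omega>\<^sub>1 \<and> \<omega>\<^sub>2\<close> vanishes. The real part of the right side is \<open>- 2 Im t\<close> times a positive volume form,
  so its integral is not zero if \<open>Im t \<noteq> 0\<close>, against Stokes' theorem. On the cover the integral over
  the compact quotient is replaced by iterated averages along six lattice directions
  (\<open>no_invariant_closed_form\<close>). Taking \<open>\<rho> = 1\<close> excludes balanced metrics (\<open>no_balanced_metric\<close>);
  taking the norm of a holomorphic volume form for \<open>\<rho>\<close> excludes solutions of the Strominger system
  (\<open>no_strominger\<close>) on fibres arbitrarily close to the Iwasawa manifold.
\<close>


section \<open>Holomorphic functions of several variables\<close>

abbreviation fder :: "('a::real_normed_vector \<Rightarrow> 'b::real_normed_vector) \<Rightarrow> 'a \<Rightarrow> 'a \<Rightarrow> 'b" where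
  "fder f x \<equiv> frechet_derivative f (at x)"

lemma fder_eq: "(f has_derivative f') (at x) \<Longrightarrow> fder f x = f'"
  using frechet_derivative_at by metis

lemma norm_smult_vec: "norm (a *s (v :: complex ^ 'n::finite)) = cmod a * norm v"
proof -
  have "norm (a *s v) = L2_set (\<lambda>i. cmod a * cmod (v $ i)) UNIV"
    by (simp add: norm_vec_def norm_mult)
  also have "\<dots> = cmod a * norm v"
    by (simp add: L2_set_right_distrib norm_vec_def)
  finally show ?thesis .
qed

lemma bounded_bilinear_smult: "bounded_bilinear (\<lambda>(a::complex) (v :: complex ^ 'n::finite). a *s v)"
proof
  fix a a' :: complex and b b' :: "complex ^ 'n" and r :: real
  show "(a + a') *s b = a *s b + a' *s b" "a *s (b + b') = a *s b + a *s b'"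
    by (simp_all add: vec_eq_iff algebra_simps)
  show "(r *\<^sub>R a) *s b = r *\<^sub>R (a *s b)" "a *s (r *\<^sub>R b) = r *\<^sub>R (a *s b)"
    by (simp_all add: vec_eq_iff)
  show "\<exists>K. \<forall>(a::complex) (b :: complex ^ 'n). norm (a *s b) \<le> norm a * norm b * K"
    by (rule exI[of _ 1]) (simp add: norm_smult_vec)
qed

lemmas has_derivative_smult [derivative_intros] = bounded_bilinear.FDERIV[OF bounded_bilinear_smult]
lemmas continuous_on_smult [continuous_intros] = bounded_bilinear.continuous_on[OF bounded_bilinear_smult]
lemmas has_derivative_vec_nth [derivative_intros] = bounded_linear.has_derivative[OF bounded_linear_vec_nth]

lemma hol_fun_open: "hol_fun S f \<Longrightarrow> open S"
  by (simp add: hol_fun_def)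

lemma hol_fun_fder:
  assumes "hol_fun S f" "x \<in> S"
  shows "(f has_derivative fder f x) (at x)" "fder f x (a *s v) = a * fder f x v"
  using assms unfolding hol_fun_def by (metis frechet_derivative_at)+

lemma hol_funI:
  assumes "open S" "\<And>x. x \<in> S \<Longrightarrow> (f has_derivative f' x) (at x)"
    "\<And>x a v. x \<in> S \<Longrightarrow> f' x (a *s v) = a * f' x v"
  shows "hol_fun S f"
  using assms unfolding hol_fun_def by blast

lemma hol_fun_continuous: "hol_fun S f \<Longrightarrow> continuous_on S f"
  by (meson continuous_at_imp_continuous_on has_derivative_continuous hol_fun_fder(1))

lemma hol_fun_cong:
  assumes "hol_fun S f" "\<And>x. x \<in> S \<Longrightarrow> f x = g x"
  shows "hol_fun S g"
proof (rule hol_funI[where f' = "fder f"])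
  show "open S" using assms(1) by (rule hol_fun_open)
  fix x assume x: "x \<in> S"
  show "(g has_derivative fder f x) (at x)"
    by (rule has_derivative_transform_within_open[OF hol_fun_fder(1)[OF assms(1) x] hol_fun_open[OF assms(1)] x])
       (rule assms(2))
qed (use hol_fun_fder(2)[OF assms(1)] in auto)

lemma hol_fun_subset: "hol_fun S f \<Longrightarrow> open T \<Longrightarrow> T \<subseteq> S \<Longrightarrow> hol_fun T f"
  unfolding hol_fun_def by blast

lemma hol_fun_local:
  assumes "\<And>x. x \<in> S \<Longrightarrow> \<exists>T. x \<in> T \<and> T \<subseteq> S \<and> hol_fun T f"
  shows "hol_fun S f"
proof -
  have "open S"
    using assms hol_fun_open by (subst open_subopen) blast
  then show ?thesis using assms unfolding hol_fun_def by blast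
qed

lemma hol_fun_const [intro]: "open S \<Longrightarrow> hol_fun S (\<lambda>x. c)"
  by (rule hol_funI[where f' = "\<lambda>x v. 0"]) auto

lemma hol_fun_nth [intro]: "open S \<Longrightarrow> hol_fun S (\<lambda>x. x $ i)"
  by (rule hol_funI[where f' = "\<lambda>x v. v $ i"]) (auto intro!: derivative_eq_intros)

lemma hol_fun_add [intro]: "hol_fun S f \<Longrightarrow> hol_fun S g \<Longrightarrow> hol_fun S (\<lambda>x. f x + g x)"
  by (rule hol_funI[where f' = "\<lambda>x v. fder f x v + fder g x v"])
     (auto intro!: derivative_eq_intros hol_fun_fder(1) simp: hol_fun_fder(2) hol_fun_open algebra_simps)

lemma hol_fun_diff [intro]: "hol_fun S f \<Longrightarrow> hol_fun S g \<Longrightarrow> hol_fun S (\<lambda>x. f x - g x)"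
  by (rule hol_funI[where f' = "\<lambda>x v. fder f x v - fder g x v"])
     (auto intro!: derivative_eq_intros hol_fun_fder(1) simp: hol_fun_fder(2) hol_fun_open algebra_simps)

lemma hol_fun_mult [intro]: "hol_fun S f \<Longrightarrow> hol_fun S g \<Longrightarrow> hol_fun S (\<lambda>x. f x * g x)"
  by (rule hol_funI[where f' = "\<lambda>x v. f x * fder g x v + fder f x v * g x"])
     (auto intro!: derivative_eq_intros hol_fun_fder(1) simp: hol_fun_fder(2) hol_fun_open algebra_simps)

lemma hol_fun_inverse:
  assumes "hol_fun S f" "\<And>x. x \<in> S \<Longrightarrow> f x \<noteq> 0"
  shows "hol_fun S (\<lambda>x. inverse (f x))"
proof (rule hol_funI[where f' = "\<lambda>x v. - (inverse (f x) * fder f x v * inverse (f x))"])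
  fix x assume x: "x \<in> S"
  show "((\<lambda>x. inverse (f x)) has_derivative (\<lambda>v. - (inverse (f x) * fder f x v * inverse (f x)))) (at x)"
    by (rule Deriv.has_derivative_inverse[OF assms(2)[OF x] hol_fun_fder(1)[OF assms(1) x]])
qed (auto simp: hol_fun_fder(2)[OF assms(1)] hol_fun_open[OF assms(1)])

lemma hol_fun_divide:
  "hol_fun S f \<Longrightarrow> hol_fun S g \<Longrightarrow> (\<And>x. x \<in> S \<Longrightarrow> g x \<noteq> 0) \<Longrightarrow> hol_fun S (\<lambda>x. f x / g x)"
  unfolding divide_inverse by (intro hol_fun_mult hol_fun_inverse)

definition hol_map :: "(complex ^ 'n::finite) set \<Rightarrow> (complex ^ 'n \<Rightarrow> complex ^ 'm::finite) \<Rightarrow> bool" where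
  "hol_map S F \<longleftrightarrow> (\<forall>i. hol_fun S (\<lambda>x. F x $ i))"

lemma has_derivative_vec_componentwise:
  fixes F :: "'a::real_normed_vector \<Rightarrow> complex ^ 'm::finite"
  assumes "\<And>i. ((\<lambda>x. F x $ i) has_derivative (\<lambda>v. F' v $ i)) (at x)"
  shows "(F has_derivative F') (at x)"
proof -
  have "((\<lambda>x. F x \<bullet> b) has_derivative (\<lambda>v. F' v \<bullet> b)) (at x)" if "b \<in> Basis" for b
  proof -
    from that obtain i c where b: "b = axis i c" by (auto simp: Basis_vec_def)
    show ?thesis unfolding b inner_axis
      using has_derivative_inner_left[OF assms] .
  qed
  then show ?thesis by (subst has_derivative_componentwise_within) blast
qed

lemma hol_map_fder:
  assumes "hol_map S F" "x \<in> S"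
  shows "(F has_derivative fder F x) (at x)" "fder F x (a *s v) = a *s fder F x v"
    "fder F x v $ i = fder (\<lambda>x. F x $ i) x v"
proof -
  have h: "hol_fun S (\<lambda>x. F x $ i)" for i using assms(1) by (simp add: hol_map_def)
  have *: "(F has_derivative (\<lambda>v. \<chi> i. fder (\<lambda>x. F x $ i) x v)) (at x)"
    by (rule has_derivative_vec_componentwise) (simp add: hol_fun_fder(1)[OF h assms(2)])
  then show "(F has_derivative fder F x) (at x)" using fder_eq by metis
  show "fder F x (a *s v) = a *s fder F x v"
    unfolding fder_eq[OF *] by (simp add: vec_eq_iff hol_fun_fder(2)[OF h assms(2)])
  show "fder F x v $ i = fder (\<lambda>x. F x $ i) x v"
    unfolding fder_eq[OF *] by simp
qed

lemma hol_map_open: "hol_map S F \<Longrightarrow> open S"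
  by (meson hol_fun_open hol_map_def)

lemma hol_map_linear: "hol_map S F \<Longrightarrow> x \<in> S \<Longrightarrow> linear (fder F x)"
  using hol_map_fder(1) has_derivative_linear by blast

lemma hol_map_continuous: "hol_map S F \<Longrightarrow> continuous_on S F"
  by (meson continuous_at_imp_continuous_on has_derivative_continuous hol_map_fder(1))

lemma hol_mapI:
  assumes "open S" "\<And>x. x \<in> S \<Longrightarrow> (f has_derivative f' x) (at x)"
    "\<And>x a v. x \<in> S \<Longrightarrow> f' x (a *s v) = a *s f' x v"
  shows "hol_map S f"
  unfolding hol_map_def
proof
  fix i show "hol_fun S (\<lambda>x. f x $ i)"
    by (rule hol_funI[where f' = "\<lambda>x v. f' x v $ i"]) (use assms in \<open>auto intro!: derivative_eq_intros\<close>)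
qed

lemma hol_map_cong: "hol_map S F \<Longrightarrow> (\<And>x. x \<in> S \<Longrightarrow> F x = G x) \<Longrightarrow> hol_map S G"
  unfolding hol_map_def by (metis (no_types, lifting) hol_fun_cong)

lemma hol_map_subset: "hol_map S f \<Longrightarrow> open T \<Longrightarrow> T \<subseteq> S \<Longrightarrow> hol_map T f"
  unfolding hol_map_def by (auto intro: hol_fun_subset)

lemma hol_map_local:
  assumes "\<And>x. x \<in> S \<Longrightarrow> \<exists>T. x \<in> T \<and> T \<subseteq> S \<and> hol_map T f"
  shows "hol_map S f"
  unfolding hol_map_def
proof
  fix i show "hol_fun S (\<lambda>x. f x $ i)"
  proof (rule hol_fun_local)
    fix x assume "x \<in> S"
    from assms[OF this] obtain T where "x \<in> T" "T \<subseteq> S" "hol_map T f" by auto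
    then show "\<exists>T. x \<in> T \<and> T \<subseteq> S \<and> hol_fun T (\<lambda>x. f x $ i)"
      by (auto simp: hol_map_def)
  qed
qed

lemma hol_map_comp:
  assumes F: "hol_map S F" and G: "hol_map T G" and sub: "\<And>x. x \<in> S \<Longrightarrow> F x \<in> T"
  shows "hol_map S (\<lambda>x. G (F x))" "x \<in> S \<Longrightarrow> fder (\<lambda>x. G (F x)) x v = fder G (F x) (fder F x v)"
proof -
  have *: "((\<lambda>x. G (F x)) has_derivative (\<lambda>v. fder G (F x) (fder F x v))) (at x)" if "x \<in> S" for x
    using has_derivative_compose[OF hol_map_fder(1)[OF F that] hol_map_fder(1)[OF G sub[OF that]]] .
  show "hol_map S (\<lambda>x. G (F x))"
    by (rule hol_mapI[OF hol_map_open[OF F] *])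
       (use hol_map_fder(2)[OF F] hol_map_fder(2)[OF G sub] in auto)
  show "x \<in> S \<Longrightarrow> fder (\<lambda>x. G (F x)) x v = fder G (F x) (fder F x v)"
    using fder_eq[OF *] by simp
qed

text \<open>
  Cauchy's formula on the complex line through \<open>x\<close> in direction \<open>v\<close>. It expresses a derivative by
  values of \<open>f\<close>, which makes derivatives of holomorphic functions holomorphic and, as the formula
  commutes with differentiation in the parameter \<open>x\<close>, mixed derivatives symmetric.
\<close>

definition circ :: "real \<Rightarrow> real \<Rightarrow> complex" where
  "circ r t = of_real r * exp (2 * of_real pi * \<i> * of_real t)"

lemma norm_circ: "0 < r \<Longrightarrow> cmod (circ r t) = r"
  by (simp add: circ_def norm_mult norm_exp_eq_Re)

lemma cauchy_directional:
  fixes f :: "complex ^ 'n::finite \<Rightarrow> complex"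
  assumes f: "hol_fun S f" and r: "0 < r" and sub: "\<And>\<zeta>. cmod \<zeta> \<le> r \<Longrightarrow> x + \<zeta> *s v \<in> S"
  shows "((\<lambda>t. f (x + circ r t *s v) / circ r t) has_integral fder f x v) {0..1}"
proof -
  define e where "e = circ r"
  define g where "g = (\<lambda>\<zeta>. f (x + \<zeta> *s v))"
  have der: "(g has_field_derivative fder f (x + \<zeta> *s v) v) (at \<zeta>)" if "cmod \<zeta> \<le> r" for \<zeta>
  proof -
    have "((\<lambda>\<zeta>. x + \<zeta> *s v) has_derivative (\<lambda>h. h *s v)) (at \<zeta>)"
      by (auto intro!: derivative_eq_intros)
    from has_derivative_compose[OF this hol_fun_fder(1)[OF f sub[OF that]]]
    have "(g has_derivative (\<lambda>h. fder f (x + \<zeta> *s v) (h *s v))) (at \<zeta>)" by (simp add: g_def)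
    then show ?thesis
      unfolding has_field_derivative_def hol_fun_fder(2)[OF f sub[OF that]]
      by (rule has_derivative_eq_rhs) (simp add: fun_eq_iff)
  qed
  have cont: "continuous_on (cball 0 r) g"
    by (intro continuous_at_imp_continuous_on ballI DERIV_continuous[OF der]) simp
  have hol: "g holomorphic_on ball 0 r"
    unfolding holomorphic_on_def field_differentiable_def
    using der has_field_derivative_at_within by (metis mem_ball_0 less_imp_le)
  have "((\<lambda>u. g u / (u - 0) ^ Suc 1) has_contour_integral ((2 * pi * \<i>) / (fact 1) * (deriv ^^ 1) g 0)) (circlepath 0 r)"
    by (rule Cauchy_has_contour_integral_higher_derivative_circlepath[OF cont hol]) (use r in auto)
  moreover have "deriv g 0 = fder f x v"
    using der[of 0] r by (simp add: DERIV_imp_deriv)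
  ultimately have "((\<lambda>u. g u / u\<^sup>2) has_contour_integral (2 * pi * \<i>) * fder f x v) (circlepath 0 r)"
    by (simp add: numeral_2_eq_2)
  then have "((\<lambda>t. g (circlepath 0 r t) / (circlepath 0 r t)\<^sup>2 *
        vector_derivative (circlepath 0 r) (at t within {0..1})) has_integral (2 * pi * \<i>) * fder f x v) {0..1}"
    by (simp add: has_contour_integral_def)
  then have "((\<lambda>t. (2 * pi * \<i>) * (f (x + e t *s v) / e t)) has_integral (2 * pi * \<i>) * fder f x v) {0..1}"
  proof (rule has_integral_eq[rotated])
    fix t :: real assume t: "t \<in> {0..1}"
    show "g (circlepath 0 r t) / (circlepath 0 r t)\<^sup>2 *
        vector_derivative (circlepath 0 r) (at t within {0..1}) = (2 * pi * \<i>) * (f (x + e t *s v) / e t)"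
    proof -
      have c: "circlepath 0 r t = e t"
        by (simp add: circlepath e_def circ_def)
      have d: "vector_derivative (circlepath 0 r) (at t within {0..1}) = (2 * pi * \<i>) * e t"
        using t by (simp add: vector_derivative_circlepath01 e_def circ_def)
      have "e t \<noteq> 0" using r norm_circ[of r t] by (auto simp: e_def)
      then have "g (e t) / (e t)\<^sup>2 * ((2 * pi * \<i>) * e t) = (2 * pi * \<i>) * (g (e t) / e t)"
        by (simp add: power2_eq_square)
      then show ?thesis unfolding c d by (simp add: g_def)
    qed
  qed
  from has_integral_mult_right[OF this, of "1 / (2 * pi * \<i>)"] show ?thesis by (simp add: e_def)
qed

lemma hol_fun_line_radius:
  fixes v :: "complex ^ 'n::finite"
  assumes "open S" "x0 \<in> S"
  obtains e r where "0 < e" "0 < r" "\<And>x \<zeta>. x \<in> ball x0 e \<Longrightarrow> cmod \<zeta> \<le> r \<Longrightarrow> x + \<zeta> *s v \<in> S"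
proof -
  obtain d where d: "0 < d" "ball x0 d \<subseteq> S" using assms openE by blast
  define r where "r = d / 2 / (1 + norm v)"
  have r: "0 < r" using d by (simp add: r_def add_pos_nonneg)
  have "r * norm v \<le> d / 2"
    using d by (simp add: r_def divide_simps add_pos_nonneg add_nonneg_eq_0_iff)
  have "x + \<zeta> *s v \<in> S" if "x \<in> ball x0 (d/2)" "cmod \<zeta> \<le> r" for x \<zeta>
  proof -
    have "norm (\<zeta> *s v) \<le> d / 2"
      unfolding norm_smult_vec using mult_right_mono[OF that(2) norm_ge_zero[of v]] \<open>r * norm v \<le> d / 2\<close> by linarith
    moreover have "norm (x0 - (x + \<zeta> *s v)) \<le> norm (x0 - x) + norm (\<zeta> *s v)"
      by (metis diff_diff_add norm_triangle_ineq4)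
    ultimately have "dist x0 (x + \<zeta> *s v) < d" using that(1) by (simp add: dist_norm)
    then show ?thesis using d(2) by auto
  qed
  with that[of "d/2" r] d r show thesis by auto
qed

text \<open>
  Continuity of the derivative comes first, because differentiation under the integral sign in
  the next lemma requires it.
\<close>

lemma hol_fun_fder_continuous:
  fixes f :: "complex ^ 'n::finite \<Rightarrow> complex"
  assumes f: "hol_fun S f"
  shows "continuous_on S (\<lambda>x. fder f x v)"
proof -
  have "\<exists>e>0. continuous_on (ball x0 e) (\<lambda>x. fder f x v)" if x0: "x0 \<in> S" for x0
  proof -
    obtain e r where er: "0 < e" "0 < r" "\<And>x \<zeta>. x \<in> ball x0 e \<Longrightarrow> cmod \<zeta> \<le> r \<Longrightarrow> x + \<zeta> *s v \<in> S"
      using hol_fun_line_radius[OF hol_fun_open[OF f] x0] by blast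
    define E where "E = circ r"
    have E: "cmod (E t) = r" for t
    using er by (simp add: E_def norm_circ)
    have E0: "E t \<noteq> 0" for t using E[of t] er(2) by auto
    have Ec [continuous_intros]: "continuous_on A (\<lambda>z. E (h z))" if "continuous_on A h" for A :: "((complex^'n) \<times> real) set" and h
      unfolding E_def circ_def by (intro continuous_intros that)
    have "continuous_on (ball x0 e) (\<lambda>x. integral (cbox 0 1) (\<lambda>t. f (x + E t *s v) / E t))"
    proof (rule integral_continuous_on_param)
      show "continuous_on (ball x0 e \<times> cbox 0 1) (\<lambda>(x, t). f (x + E t *s v) / E t)"
        unfolding split_beta
      proof (intro continuous_intros ballI)
        show "continuous_on (ball x0 e \<times> cbox 0 1) (\<lambda>z. f (fst z + E (snd z) *s v))"
          by (rule continuous_on_compose2[OF hol_fun_continuous[OF f]])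
             (use er(3) E in \<open>auto intro!: continuous_intros\<close>)
      qed (use E0 in auto)
    qed
    moreover have "fder f x v = integral (cbox 0 1) (\<lambda>t. f (x + E t *s v) / E t)" if "x \<in> ball x0 e" for x
      using cauchy_directional[OF f er(2) er(3)[OF that]]
      by (simp add: E_def integral_unique)
    ultimately show ?thesis using er(1) by (metis (no_types, lifting) continuous_on_cong)
  qed
  then show ?thesis
    by (metis (no_types, lifting) centre_in_ball continuous_at_imp_continuous_on continuous_on_eq_continuous_at open_ball)
qed

text \<open>
  Differentiating Cauchy's formula under the integral sign gives the second derivative as an
  integral of first derivatives. The radius is part of the conclusion so that the same circle
  can be used to read this integral again as Cauchy's formula, now for a derivative.
\<close>

lemma hol_fun_fder_deriv:
  fixes f :: "complex ^ 'n::finite \<Rightarrow> complex"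
  assumes f: "hol_fun S f" and x0: "x0 \<in> S"
  shows "\<exists>r>0. (\<forall>\<zeta>. cmod \<zeta> \<le> r \<longrightarrow> x0 + \<zeta> *s v \<in> S) \<and>
    ((\<lambda>x. fder f x v) has_derivative
       (\<lambda>h. integral {0..1} (\<lambda>t. fder f (x0 + circ r t *s v) h / circ r t))) (at x0)"
proof -
  obtain e r where er: "0 < e" "0 < r" "\<And>x \<zeta>. x \<in> ball x0 e \<Longrightarrow> cmod \<zeta> \<le> r \<Longrightarrow> x + \<zeta> *s v \<in> S"
    using hol_fun_line_radius[OF hol_fun_open[OF f] x0] by blast
  define E where "E = circ r"
  have E: "cmod (E t) = r" for t
    using er by (simp add: E_def norm_circ)
  have E0: "E t \<noteq> 0" for t using E[of t] er(2) by auto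
  have Ec [continuous_intros]: "continuous_on A (\<lambda>z. E (h z))" if "continuous_on A h" for A :: "((complex^'n) \<times> real) set" and h
    unfolding E_def circ_def by (intro continuous_intros that)
  have Ec' [continuous_intros]: "continuous_on A E" for A
    unfolding E_def circ_def by (intro continuous_intros)
  define B where "B = (\<lambda>x t. Blinfun (\<lambda>h. fder f (x + E t *s v) h / E t))"
  have inS: "x + E t *s v \<in> S" if "x \<in> ball x0 e" for x t using er(3)[OF that] E by simp
  have B: "blinfun_apply (B x t) h = fder f (x + E t *s v) h / E t" if "x \<in> ball x0 e" for x t h
    unfolding B_def
    by (subst bounded_linear_Blinfun_apply)
       (simp_all add: bounded_linear_compose[OF bounded_linear_divide
          has_derivative_bounded_linear[OF hol_fun_fder(1)[OF f inS[OF that]]]])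
  have contB: "continuous_on (ball x0 e \<times> cbox 0 1) (\<lambda>(x, t). B x t)"
  proof (rule continuous_on_blinfun_componentwise)
    fix i :: "complex ^ 'n"
    have "continuous_on (ball x0 e \<times> cbox 0 1) (\<lambda>z. fder f (fst z + E (snd z) *s v) i / E (snd z))"
    proof (intro continuous_intros ballI)
      show "continuous_on (ball x0 e \<times> cbox 0 1) (\<lambda>z. fder f (fst z + E (snd z) *s v) i)"
        by (rule continuous_on_compose2[OF hol_fun_fder_continuous[OF f]])
           (use inS in \<open>auto intro!: continuous_intros\<close>)
    qed (use E0 in auto)
    then show "continuous_on (ball x0 e \<times> cbox 0 1) (\<lambda>x. blinfun_apply (case x of (x, t) \<Rightarrow> B x t) i)"
      by (rule continuous_on_eq) (use B in auto)
  qed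
  have "((\<lambda>x. integral (cbox 0 1) (\<lambda>t. f (x + E t *s v) / E t)) has_derivative integral (cbox 0 1) (B x0)) (at x0 within ball x0 e)"
  proof (rule leibniz_rule[OF _ _ contB])
    fix x t assume x: "x \<in> ball x0 e" and t: "t \<in> cbox (0::real) 1"
    have "((\<lambda>x. x + E t *s v) has_derivative (\<lambda>h. h)) (at x)"
      by (auto intro!: derivative_eq_intros)
    from has_derivative_compose[OF this hol_fun_fder(1)[OF f inS[OF x]]]
    have "((\<lambda>x. f (x + E t *s v)) has_derivative fder f (x + E t *s v)) (at x)" .
    then have "((\<lambda>x. f (x + E t *s v) / E t) has_derivative (\<lambda>h. fder f (x + E t *s v) h / E t)) (at x)"
      by (rule bounded_linear.has_derivative[OF bounded_linear_divide])
    then show "((\<lambda>x. f (x + E t *s v) / E t) has_derivative blinfun_apply (B x t)) (at x within ball x0 e)"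
      using B[OF x] has_derivative_at_withinI by (metis (no_types, lifting) ext)
  next
    fix x assume x: "x \<in> ball x0 e"
    show "(\<lambda>t. f (x + E t *s v) / E t) integrable_on cbox 0 1"
      using cauchy_directional[OF f er(2) er(3)[OF x]] by (auto simp: E_def integrable_on_def)
  qed (use er in auto)
  then have 1: "((\<lambda>x. integral (cbox 0 1) (\<lambda>t. f (x + E t *s v) / E t)) has_derivative integral (cbox 0 1) (B x0)) (at x0)"
    using er(1) by (simp add: at_within_open[OF _ open_ball])
  have intB: "B x0 integrable_on cbox 0 1"
  proof (rule integrable_continuous)
    show "continuous_on (cbox 0 1) (B x0)"
    proof -
      have "continuous_on (cbox 0 1) (\<lambda>t::real. (x0, t))" by (intro continuous_intros)
      from continuous_on_compose2[OF contB this] show ?thesis using er(1) by (simp add: image_subset_iff)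
    qed
  qed
  have 2: "integral (cbox 0 1) (B x0) h = integral (cbox 0 1) (\<lambda>t. fder f (x0 + E t *s v) h / E t)" for h
    using blinfun_apply_integral[OF intB, of h] B[of x0] er(1) by simp
  have "((\<lambda>x. fder f x v) has_derivative (\<lambda>h. integral (cbox 0 1) (\<lambda>t. fder f (x0 + E t *s v) h / E t))) (at x0)"
  proof (rule has_derivative_transform_within_open[of _ _ _ _ "ball x0 e"])
    show "((\<lambda>x. integral (cbox 0 1) (\<lambda>t. f (x + E t *s v) / E t)) has_derivative (\<lambda>h. integral (cbox 0 1) (\<lambda>t. fder f (x0 + E t *s v) h / E t))) (at x0)"
      using 1 2 by (metis (no_types, lifting) ext)
    show "integral (cbox 0 1) (\<lambda>t. f (x + E t *s v) / E t) = fder f x v" if "x \<in> ball x0 e" for x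
      using cauchy_directional[OF f er(2) er(3)[OF that]]
      by (simp add: E_def integral_unique)
  qed (use er in auto)
  moreover have "x0 + \<zeta> *s v \<in> S" if "cmod \<zeta> \<le> r" for \<zeta>
    using er(3)[of x0] er(1) that by simp
  ultimately show ?thesis
    using er(2) by (auto simp: E_def)
qed

lemma hol_fun_fder_hol:
  fixes f :: "complex ^ 'n::finite \<Rightarrow> complex"
  assumes f: "hol_fun S f"
  shows "hol_fun S (\<lambda>x. fder f x v)"
  unfolding hol_fun_def
proof (intro conjI ballI hol_fun_open[OF f])
  fix x assume x: "x \<in> S"
  obtain r where r: "0 < r" "\<And>\<zeta>. cmod \<zeta> \<le> r \<Longrightarrow> x + \<zeta> *s v \<in> S"
    and d: "((\<lambda>x. fder f x v) has_derivative
       (\<lambda>h. integral {0..1} (\<lambda>t. fder f (x + circ r t *s v) h / circ r t))) (at x)"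
    using hol_fun_fder_deriv[OF f x, of v] by blast
  have "fder f (x + circ r t *s v) (a *s h) =
      a * fder f (x + circ r t *s v) h" for t a h
    by (rule hol_fun_fder(2)[OF f r(2)]) (use r(1) in \<open>simp add: norm_circ\<close>)
  with d show "\<exists>f'. ((\<lambda>x. fder f x v) has_derivative f') (at x) \<and> (\<forall>a v. f' (a *s v) = a * f' v)"
    by (auto simp flip: times_divide_eq_right)
qed

text \<open>
  By the previous formula the left side is the integral over the circle in direction \<open>v\<close> of the
  derivative in direction \<open>u\<close>, which is Cauchy's formula for that derivative.
\<close>

lemma hol_fun_fder_sym:
  fixes f :: "complex ^ 'n::finite \<Rightarrow> complex"
  assumes f: "hol_fun S f" and x: "x \<in> S"
  shows "fder (\<lambda>y. fder f y v) x u = fder (\<lambda>y. fder f y u) x v"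
proof -
  obtain r where r: "0 < r" "\<And>\<zeta>. cmod \<zeta> \<le> r \<Longrightarrow> x + \<zeta> *s v \<in> S"
    and d: "((\<lambda>x. fder f x v) has_derivative
       (\<lambda>h. integral {0..1} (\<lambda>t. fder f (x + circ r t *s v) h / circ r t))) (at x)"
    using hol_fun_fder_deriv[OF f x, of v] by blast
  show ?thesis
    unfolding fder_eq[OF d]
    using cauchy_directional[OF hol_fun_fder_hol[OF f] r] by (simp add: integral_unique)
qed

section \<open>Smooth functions\<close>

lemma Ck_on_cong:
  assumes "open S" "Ck_on k S f" "\<And>x. x \<in> S \<Longrightarrow> f x = g x"
  shows "Ck_on k S g"
  using assms(2,3)
proof (induction k arbitrary: f g)
  case 0
  then show ?case by (metis Ck_on.simps(1) continuous_on_cong)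
next
  case (Suc k)
  have d: "f differentiable at x" if "x \<in> S" for x using Suc.prems(1) that by simp
  have e: "fder f x = fder g x" if "x \<in> S" for x
    using frechet_derivative_transform_within_open[OF d[OF that] assms(1) that Suc.prems(2)] by simp
  have "g differentiable at x" if "x \<in> S" for x
    using d[OF that] assms(1) Suc.prems(2) that unfolding differentiable_def
    by (meson has_derivative_transform_within_open)
  moreover have "Ck_on k S (\<lambda>x. fder g x v)" for v
    by (rule Suc.IH[of "\<lambda>x. fder f x v"]) (use Suc.prems(1) e in auto)
  ultimately show ?case by simp
qed

lemma Ck_on_Suc_imp: "Ck_on (Suc k) S f \<Longrightarrow> Ck_on k S f"
proof (induction k arbitrary: f)
  case 0
  then show ?case
    by (auto intro!: continuous_at_imp_continuous_on dest!: differentiable_imp_continuous_within)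
next
  case (Suc k)
  then show ?case by (metis Ck_on.simps(2))
qed

lemma Ck_on_const: "Ck_on k S (\<lambda>x. c)"
  by (induction k arbitrary: c) simp_all

lemma Ck_on_linear:
  assumes L: "bounded_linear L" and "open S" and f: "Ck_on k S f"
  shows "Ck_on k S (\<lambda>x. L (f x))"
  using f
proof (induction k arbitrary: f)
  case 0
  then show ?case using bounded_linear.continuous_on[OF L] by simp
next
  case (Suc k)
  have d: "(f has_derivative fder f x) (at x)" if "x \<in> S" for x
    using Suc.prems that frechet_derivative_works by auto
  have e: "((\<lambda>x. L (f x)) has_derivative (\<lambda>v. L (fder f x v))) (at x)" if "x \<in> S" for x
    by (rule bounded_linear.has_derivative[OF L d[OF that]])
  have "Ck_on k S (\<lambda>x. fder (\<lambda>x. L (f x)) x v)" for v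
    by (rule Ck_on_cong[OF \<open>open S\<close> Suc.IH[of "\<lambda>x. fder f x v"]]) (use Suc.prems fder_eq[OF e] in auto)
  then show ?case using e by (auto simp: differentiable_def)
qed

lemma Ck_on_add:
  assumes "open S" and f: "Ck_on k S f" and g: "Ck_on k S g"
  shows "Ck_on k S (\<lambda>x. f x + g x)"
  using f g
proof (induction k arbitrary: f g)
  case 0
  then show ?case by (simp add: continuous_on_add)
next
  case (Suc k)
  have d: "(f has_derivative fder f x) (at x)" "(g has_derivative fder g x) (at x)" if "x \<in> S" for x
    using Suc.prems that by (auto simp flip: frechet_derivative_works)
  have e: "((\<lambda>x. f x + g x) has_derivative (\<lambda>v. fder f x v + fder g x v)) (at x)" if "x \<in> S" for x
    by (rule has_derivative_add[OF d[OF that]])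
  have "Ck_on k S (\<lambda>x. fder (\<lambda>x. f x + g x) x v)" for v
    by (rule Ck_on_cong[OF \<open>open S\<close> Suc.IH[of "\<lambda>x. fder f x v" "\<lambda>x. fder g x v"]])
       (use Suc.prems fder_eq[OF e] in auto)
  then show ?case using e by (auto simp: differentiable_def)
qed

lemma Ck_on_bilinear:
  assumes P: "bounded_bilinear prd" and "open S" and f: "Ck_on k S f" and g: "Ck_on k S g"
  shows "Ck_on k S (\<lambda>x. prd (f x) (g x))"
  using f g
proof (induction k arbitrary: f g)
  case 0
  then show ?case using bounded_bilinear.continuous_on[OF P] by simp
next
  case (Suc k)
  have d: "(f has_derivative fder f x) (at x)" "(g has_derivative fder g x) (at x)" if "x \<in> S" for x
    using Suc.prems that by (auto simp flip: frechet_derivative_works)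
  have e: "((\<lambda>x. prd (f x) (g x)) has_derivative (\<lambda>v. prd (f x) (fder g x v) + prd (fder f x v) (g x))) (at x)"
    if "x \<in> S" for x
    by (rule bounded_bilinear.FDERIV[OF P d[OF that]])
  have fg: "Ck_on k S f" "Ck_on k S g" using Suc.prems Ck_on_Suc_imp by blast+
  have "Ck_on k S (\<lambda>x. fder (\<lambda>x. prd (f x) (g x)) x v)" for v
    by (rule Ck_on_cong[OF \<open>open S\<close> Ck_on_add[OF \<open>open S\<close>
          Suc.IH[of f "\<lambda>x. fder g x v"] Suc.IH[of "\<lambda>x. fder f x v" g]]])
       (use Suc.prems fg fder_eq[OF e] in auto)
  then show ?case using e by (auto simp: differentiable_def)
qed

lemma smooth_on_cong: "smooth_on S f \<Longrightarrow> (\<And>x. x \<in> S \<Longrightarrow> f x = g x) \<Longrightarrow> smooth_on S g"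
  unfolding smooth_on_def using Ck_on_cong by blast

lemma smooth_on_const: "open S \<Longrightarrow> smooth_on S (\<lambda>x. c)"
  by (simp add: smooth_on_def Ck_on_const)

lemma smooth_on_linear: "bounded_linear L \<Longrightarrow> smooth_on S f \<Longrightarrow> smooth_on S (\<lambda>x. L (f x))"
  by (simp add: smooth_on_def Ck_on_linear)

lemma smooth_on_add: "smooth_on S f \<Longrightarrow> smooth_on S g \<Longrightarrow> smooth_on S (\<lambda>x. f x + g x)"
  by (simp add: smooth_on_def Ck_on_add)

lemma smooth_on_bilinear:
  "bounded_bilinear prd \<Longrightarrow> smooth_on S f \<Longrightarrow> smooth_on S g \<Longrightarrow> smooth_on S (\<lambda>x. prd (f x) (g x))"
  by (simp add: smooth_on_def Ck_on_bilinear)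

lemma smooth_on_sum:
  "open S \<Longrightarrow> (\<And>i. i \<in> I \<Longrightarrow> smooth_on S (f i)) \<Longrightarrow> smooth_on S (\<lambda>x. \<Sum>i\<in>I. f i x)"
  by (induction I rule: infinite_finite_induct) (auto intro: smooth_on_const smooth_on_add)

lemma smooth_on_differentiable: "smooth_on S f \<Longrightarrow> x \<in> S \<Longrightarrow> (f has_derivative fder f x) (at x)"
  unfolding smooth_on_def using frechet_derivative_works by (metis Ck_on.simps(2))

text \<open>
  Induction on the order, as derivatives of holomorphic functions are holomorphic.
\<close>

lemma hol_fun_smooth:
  fixes f :: "complex ^ 'n::finite \<Rightarrow> complex"
  assumes "hol_fun S f"
  shows "smooth_on S f"
proof -
  have "Ck_on k S f" for k
    using assms
  proof (induction k arbitrary: f)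
    case 0
    then show ?case by (simp add: hol_fun_continuous)
  next
    case (Suc k)
    then show ?case
      using hol_fun_fder(1)[OF Suc.prems] Suc.IH[OF hol_fun_fder_hol[OF Suc.prems]]
      by (auto simp: differentiable_def)
  qed
  then show ?thesis using assms by (simp add: smooth_on_def hol_fun_open)
qed

lemma smooth_on_vec:
  fixes F :: "'a::euclidean_space \<Rightarrow> complex ^ 'm::finite"
  assumes "open S" "\<And>i. smooth_on S (\<lambda>x. F x $ i)"
  shows "smooth_on S F"
proof -
  have "smooth_on S (\<lambda>x. \<Sum>i\<in>UNIV. F x $ i *s axis i 1)"
    by (intro smooth_on_sum assms(1)
        smooth_on_linear[OF bounded_bilinear.bounded_linear_left[OF bounded_bilinear_smult]] assms(2))
  then show ?thesis by (simp add: basis_expansion)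
qed

section \<open>Charts, transition maps and the fibres of a family\<close>

lemma chart_on_simps:
  assumes "chart_on X c"
  shows "inj_on (snd c) (fst c)" "p \<in> fst c \<Longrightarrow> cinv c (snd c p) = p"
    "x \<in> snd c ` fst c \<Longrightarrow> snd c (cinv c x) = x" "x \<in> snd c ` fst c \<Longrightarrow> cinv c x \<in> fst c"
    "fst c \<subseteq> topspace X"
proof -
  have sub: "fst c \<subseteq> topspace X"
    using assms openin_subset unfolding chart_on_def by blast
  then show "fst c \<subseteq> topspace X" .
  show i: "inj_on (snd c) (fst c)"
    using assms homeomorphic_imp_injective_map sub unfolding chart_on_def
    by (metis inf.absorb2 topspace_subtopology)
  show "p \<in> fst c \<Longrightarrow> cinv c (snd c p) = p" using i by (simp add: cinv_def)
  show "x \<in> snd c ` fst c \<Longrightarrow> snd c (cinv c x) = x" by (simp add: cinv_def f_inv_into_f)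
  show "x \<in> snd c ` fst c \<Longrightarrow> cinv c x \<in> fst c" unfolding cinv_def by (rule inv_into_into)
qed

lemma chart_on_homeo: "chart_on X c \<Longrightarrow> homeomorphic_map (subtopology X (fst c)) (top_of_set (snd c ` fst c)) (snd c)"
  by (simp add: chart_on_def)

lemma img_iff:
  assumes "chart_on X c"
  shows "x \<in> img c W \<longleftrightarrow> x \<in> snd c ` fst c \<and> cinv c x \<in> W"
  using chart_on_simps[OF assms] unfolding img_def by (auto simp: image_iff)

lemma img_open:
  assumes c: "chart_on X c" and W: "openin X W"
  shows "open (img c W)"
proof -
  have "openin (subtopology X (fst c)) (fst c \<inter> W)"
    using W by (rule openin_subtopology_Int2)
  then have "openin (top_of_set (snd c ` fst c)) (img c W)"
    using homeomorphic_imp_open_map[OF chart_on_homeo[OF c]] unfolding img_def open_map_def by blast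
  then show ?thesis using c unfolding chart_on_def by (meson openin_open_eq)
qed

lemma cinv_continuous:
  assumes c: "chart_on X c"
  shows "continuous_map (top_of_set (snd c ` fst c)) X (cinv c)"
proof -
  obtain g where g: "homeomorphic_maps (subtopology X (fst c)) (top_of_set (snd c ` fst c)) (snd c) g"
    using chart_on_homeo[OF c] homeomorphic_map_maps by blast
  have eq: "g x = cinv c x" if "x \<in> snd c ` fst c" for x
  proof -
    from that obtain p where p: "p \<in> fst c" "x = snd c p" by blast
    then have "p \<in> topspace (subtopology X (fst c))" using chart_on_simps(5)[OF c] by auto
    then have "g (snd c p) = p" using g unfolding homeomorphic_maps_def by blast
    then show ?thesis using p chart_on_simps(2)[OF c] by simp
  qed
  have "continuous_map (top_of_set (snd c ` fst c)) (subtopology X (fst c)) (cinv c)"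
  proof (rule continuous_map_eq)
    show "continuous_map (top_of_set (snd c ` fst c)) (subtopology X (fst c)) g"
      using g unfolding homeomorphic_maps_def by blast
  qed (simp add: eq)
  then show ?thesis by (rule continuous_map_into_fulltopology)
qed

lemma hol_compatible_iff:
  "hol_compatible c c' \<longleftrightarrow> hol_map (img c (fst c')) (trans_map c c') \<and> hol_map (img c' (fst c)) (trans_map c' c)"
  by (simp add: hol_compatible_def hol_map_def)

lemma trans_map_snd: "chart_on X c \<Longrightarrow> p \<in> fst c \<Longrightarrow> trans_map c c' (snd c p) = snd c' p"
  by (simp add: trans_map_def chart_on_simps(2))

lemma snd_in_img: "p \<in> fst c \<Longrightarrow> p \<in> W \<Longrightarrow> snd c p \<in> img c W"
  by (simp add: img_def)

text \<open>
  The cocycle rule for transition maps with its differential. It makes two charts compatible near a point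
  covered by a third chart compatible with both, and yields the chain rule for Jacobians.
\<close>

lemma hol_transition_via:
  assumes c: "chart_on X c" and c': "chart_on X c'" and e: "chart_on X e"
    and x: "x \<in> img c (fst c' \<inter> fst e)"
    and ce: "hol_map (img c (fst e)) (trans_map c e)" and ec': "hol_map (img e (fst c')) (trans_map e c')"
  shows "hol_map (img c (fst c' \<inter> fst e)) (trans_map c c')"
    "fder (trans_map c c') x v = fder (trans_map e c') (trans_map c e x) (fder (trans_map c e) x v)"
proof -
  let ?T = "img c (fst c' \<inter> fst e)"
  have o: "open ?T" by (rule img_open[OF c]) (use c' e in \<open>auto simp: chart_on_def\<close>)
  have F: "hol_map ?T (trans_map c e)"
    by (rule hol_map_subset[OF ce o]) (auto simp: img_def)
  have sub: "trans_map c e y \<in> img e (fst c')" if "y \<in> ?T" for y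
    using that chart_on_simps[OF c] by (auto simp: trans_map_def img_def)
  have eq: "trans_map e c' (trans_map c e y) = trans_map c c' y" if "y \<in> ?T" for y
    using that chart_on_simps[OF c] chart_on_simps[OF e] by (auto simp: trans_map_def img_def)
  have comp: "hol_map ?T (\<lambda>y. trans_map e c' (trans_map c e y))"
    by (rule hol_map_comp(1)[OF F ec' sub])
  show h: "hol_map ?T (trans_map c c')"
    by (rule hol_map_cong[OF comp eq])
  show "fder (trans_map c c') x v = fder (trans_map e c') (trans_map c e x) (fder (trans_map c e) x v)"
  proof -
    have "(trans_map c c' has_derivative fder (\<lambda>y. trans_map e c' (trans_map c e y)) x) (at x)"
      by (rule has_derivative_transform_within_open[OF hol_map_fder(1)[OF comp x] o x eq])
    then show ?thesis using hol_map_comp(2)[OF F ec' sub x, of v] fder_eq by metis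
  qed
qed

text \<open>
  Compatibility with the atlas does not pass through a single intermediate chart, since none need
  cover the whole overlap; near each point of the overlap one of them does, and holomorphy is local.
\<close>

lemma max_atlas_compatible:
  assumes M: "complex_manifold M" and c: "c \<in> max_atlas M" and c': "c' \<in> max_atlas M"
  shows "hol_compatible c c'"
proof -
  have *: "hol_map (img c (fst c')) (trans_map c c')" if "c \<in> max_atlas M" "c' \<in> max_atlas M" for c c'
  proof (rule hol_map_local)
    fix x assume x: "x \<in> img c (fst c')"
    have ch: "chart_on (mtop M) c" "chart_on (mtop M) c'" using that by (auto simp: max_atlas_def)
    have "cinv c x \<in> topspace (mtop M)"
      using x chart_on_simps(4,5)[OF ch(1)] img_iff[OF ch(1), of x "fst c'"] by auto
    then obtain e where e: "e \<in> atlas M" "cinv c x \<in> fst e"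
      using M unfolding complex_manifold_def by (metis UN_E)
    have che: "chart_on (mtop M) e" using M e by (auto simp: complex_manifold_def)
    have x': "x \<in> img c (fst c' \<inter> fst e)" using x e img_iff[OF ch(1)] by auto
    have "hol_map (img c (fst e)) (trans_map c e)" "hol_map (img e (fst c')) (trans_map e c')"
      using that e by (auto simp: max_atlas_def hol_compatible_iff)
    from hol_transition_via(1)[OF ch che x' this] x'
    show "\<exists>T. x \<in> T \<and> T \<subseteq> img c (fst c') \<and> hol_map T (trans_map c c')"
      by (intro exI[of _ "img c (fst c' \<inter> fst e)"]) (auto simp: img_def)
  qed
  show ?thesis unfolding hol_compatible_iff using * c c' by blast
qed

lemma jac_comp:
  assumes c: "chart_on X c" and c': "chart_on X c'" and e: "chart_on X e"
    and p: "p \<in> fst c" "p \<in> fst c'" "p \<in> fst e"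
    and comp: "hol_compatible c e" "hol_compatible e c'"
  shows "jac c c' p v = jac e c' p (jac c e p v)"
  using hol_transition_via(2)[OF c c' e snd_in_img, of p v] p comp
  by (simp add: jac_def hol_compatible_iff trans_map_snd[OF c])

lemma jac_same:
  assumes c: "chart_on X c" and p: "p \<in> fst c"
  shows "jac c c p v = v"
proof -
  have "((\<lambda>x. x) has_derivative (\<lambda>v. v)) (at (snd c p))" by simp
  then have "(trans_map c c has_derivative (\<lambda>v. v)) (at (snd c p))"
    by (rule has_derivative_transform_within_open[of _ _ _ _ "snd c ` fst c"])
       (use c p chart_on_simps[OF c] in \<open>auto simp: trans_map_def chart_on_def\<close>)
  then show ?thesis unfolding jac_def using fder_eq by metis
qed

lemma atlas_sub_max_atlas: "complex_manifold M \<Longrightarrow> c \<in> atlas M \<Longrightarrow> c \<in> max_atlas M"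
  by (auto simp: max_atlas_def complex_manifold_def)

lemma vector_4 [simp]:
  "(vector [a, b, c, d] :: ('a::zero) ^ 4) $ 1 = a" "(vector [a, b, c, d] :: ('a::zero) ^ 4) $ 2 = b"
  "(vector [a, b, c, d] :: ('a::zero) ^ 4) $ 3 = c" "(vector [a, b, c, d] :: ('a::zero) ^ 4) $ 4 = d"
  unfolding vector_def by simp_all

definition put_last :: "complex \<Rightarrow> complex ^ 3 \<Rightarrow> complex ^ 4" where
  "put_last t x = vector [x $ 1, x $ 2, x $ 3, t]"

lemma put_last_simps [simp]:
  "put_last t x $ 1 = x $ 1" "put_last t x $ 2 = x $ 2" "put_last t x $ 3 = x $ 3" "put_last t x $ 4 = t"
  by (simp_all add: put_last_def)

lemma drop_last_simps [simp]:
  "drop_last z $ 1 = z $ 1" "drop_last z $ 2 = z $ 2" "drop_last z $ 3 = z $ 3"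
  by (simp_all add: drop_last_def)

lemma drop_put [simp]: "drop_last (put_last t x) = x"
  by (simp add: vec_eq_iff forall_3)

lemma put_drop: "z $ 4 = t \<Longrightarrow> put_last t (drop_last z) = z"
  by (simp add: vec_eq_iff forall_4)

lemma hol_map_put_last: "open S \<Longrightarrow> hol_map S (put_last t)"
  unfolding hol_map_def by (auto simp: forall_4)

lemma hol_map_drop_last: "open S \<Longrightarrow> hol_map S drop_last"
  unfolding hol_map_def by (auto simp: forall_3)

text \<open>
  The charts of a fibre. They are studied for a set \<open>S\<close> of points at which the projection has a
  fixed value, and for charts whose last coordinate is the projection, called adapted.
\<close>

definition slice_chart :: "'a set \<Rightarrow> ('a, 4) chart \<Rightarrow> ('a, 3) chart" where
  "slice_chart S c = (fst c \<inter> S, drop_last \<circ> snd c)"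

locale fibre_slice =
  fixes X :: "'a topology" and f :: "'a \<Rightarrow> complex" and t :: complex and S :: "'a set"
  assumes S: "S = {p \<in> topspace X. f p = t}"
begin

definition adapted :: "('a, 4) chart \<Rightarrow> bool" where
  "adapted c \<longleftrightarrow> chart_on X c \<and> (\<forall>p\<in>fst c. snd c p $ 4 = f p)"

lemma adapted_chart: "adapted c \<Longrightarrow> chart_on X c"
  by (simp add: adapted_def)

lemma slice_put: "adapted c \<Longrightarrow> p \<in> fst c \<inter> S \<Longrightarrow> put_last t (drop_last (snd c p)) = snd c p"
  by (rule put_drop) (auto simp: adapted_def S)

lemma slice_image:
  assumes c: "adapted c"
  shows "snd (slice_chart S c) ` fst (slice_chart S c) = {x. put_last t x \<in> snd c ` fst c}"
proof (intro set_eqI iffI)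
  fix x assume "x \<in> snd (slice_chart S c) ` fst (slice_chart S c)"
  then show "x \<in> {x. put_last t x \<in> snd c ` fst c}"
    using slice_put[OF c] by (auto simp: slice_chart_def)
next
  fix x assume "x \<in> {x. put_last t x \<in> snd c ` fst c}"
  then obtain p where p: "p \<in> fst c" "snd c p = put_last t x" by (auto simp: image_iff)
  then have "f p = t" using c by (auto simp: adapted_def)
  then have "p \<in> fst c \<inter> S" using p chart_on_simps(5)[OF adapted_chart[OF c]] S by auto
  moreover have "drop_last (snd c p) = x" using p by simp
  ultimately show "x \<in> snd (slice_chart S c) ` fst (slice_chart S c)"
    unfolding slice_chart_def by force
qed

lemma slice_cinv:
  assumes c: "adapted c" and x: "put_last t x \<in> snd c ` fst c"
  shows "cinv (slice_chart S c) x = cinv c (put_last t x)"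
    "cinv c (put_last t x) \<in> fst (slice_chart S c)"
proof -
  note cs = chart_on_simps[OF adapted_chart[OF c]]
  have inj: "inj_on (drop_last \<circ> snd c) (fst c \<inter> S)"
    unfolding inj_on_def comp_def using slice_put[OF c] cs(1) by (metis IntD1 inj_onD)
  let ?p = "cinv c (put_last t x)"
  have p: "?p \<in> fst c" "snd c ?p = put_last t x" using cs x by auto
  then have "f ?p = t" using c by (auto simp: adapted_def)
  then have pS: "?p \<in> fst c \<inter> S" using p cs(5) S by auto
  then show "?p \<in> fst (slice_chart S c)" by (simp add: slice_chart_def)
  have "inv_into (fst c \<inter> S) (drop_last \<circ> snd c) ((drop_last \<circ> snd c) ?p) = ?p"
    by (rule inv_into_f_f[OF inj pS])
  then show "cinv (slice_chart S c) x = ?p"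
    using p by (simp add: cinv_def slice_chart_def)
qed

lemma slice_chart_on:
  assumes c: "adapted c"
  shows "chart_on (subtopology X S) (slice_chart S c)"
proof -
  note ch = adapted_chart[OF c]
  let ?d = "slice_chart S c"
  let ?V = "snd ?d ` fst ?d"
  have f: "fst ?d = fst c \<inter> S" "snd ?d = drop_last \<circ> snd c" by (simp_all add: slice_chart_def)
  have put: "continuous_on A (put_last t)" for A
    using hol_map_continuous[OF hol_map_put_last[OF open_UNIV]] continuous_on_subset by blast
  have drop: "continuous_on A drop_last" for A
    using hol_map_continuous[OF hol_map_drop_last[OF open_UNIV]] continuous_on_subset by blast
  have o: "open ?V"
    unfolding slice_image[OF c]
    using open_vimage[OF _ put[of UNIV]] ch by (auto simp: chart_on_def vimage_def)
  have sub: "subtopology (subtopology X S) (fst ?d) = subtopology X (fst c \<inter> S)"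
    by (simp add: f subtopology_subtopology inf.absorb2 inf.commute)
  have c1: "continuous_map (subtopology X (fst c \<inter> S)) euclidean (snd ?d)"
  proof -
    have "continuous_map (subtopology X (fst c)) euclidean (snd c)"
      using homeomorphic_imp_continuous_map[OF chart_on_homeo[OF ch]] continuous_map_into_fulltopology by blast
    then have "continuous_map (subtopology X (fst c \<inter> S)) euclidean (snd c)"
      by (rule continuous_map_from_subtopology_mono) auto
    then show ?thesis unfolding f
      by (rule continuous_map_compose) (simp add: drop)
  qed
  have c2: "continuous_map (top_of_set ?V) X (cinv ?d)"
  proof (rule continuous_map_eq)
    show "continuous_map (top_of_set ?V) X (cinv c \<circ> put_last t)"
    proof (rule continuous_map_compose[OF _ cinv_continuous[OF ch]])
      show "continuous_map (top_of_set ?V) (top_of_set (snd c ` fst c)) (put_last t)"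
        using put by (auto simp: slice_image[OF c] continuous_map_in_subtopology)
    qed
    show "\<And>x. x \<in> topspace (top_of_set ?V) \<Longrightarrow> (cinv c \<circ> put_last t) x = cinv ?d x"
      using slice_cinv[OF c] unfolding slice_image[OF c] by simp
  qed
  have "homeomorphic_maps (subtopology X (fst c \<inter> S)) (top_of_set ?V) (snd ?d) (cinv ?d)"
    unfolding homeomorphic_maps_def continuous_map_in_subtopology
  proof (intro conjI c1 c2 ballI)
    show "snd ?d \<in> topspace (subtopology X (fst c \<inter> S)) \<rightarrow> ?V" using f by auto
    show "cinv ?d \<in> topspace (top_of_set ?V) \<rightarrow> fst c \<inter> S"
      using slice_cinv[OF c] f unfolding slice_image[OF c] by auto
    fix p assume "p \<in> topspace (subtopology X (fst c \<inter> S))"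
    then have p: "p \<in> fst c \<inter> S" by simp
    then have "put_last t (snd ?d p) = snd c p" using slice_put[OF c p] by (simp add: f)
    then show "cinv ?d (snd ?d p) = p"
      using slice_cinv(1)[OF c, of "snd ?d p"] p chart_on_simps[OF ch] by simp
  next
    fix x assume "x \<in> topspace (top_of_set ?V)"
    then have x: "put_last t x \<in> snd c ` fst c" unfolding slice_image[OF c] by simp
    show "snd ?d (cinv ?d x) = x"
      using slice_cinv(1)[OF c x] chart_on_simps(3)[OF ch x] by (simp add: f)
  qed
  then have h: "homeomorphic_map (subtopology X (fst c \<inter> S)) (top_of_set ?V) (snd ?d)"
    by (rule homeomorphic_maps_imp_map)
  have "openin (subtopology X S) (fst ?d)"
    using ch unfolding f chart_on_def by (simp add: openin_subtopology_Int)
  then show ?thesis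
    unfolding chart_on_def sub using o h by blast
qed

lemma slice_trans:
  assumes c: "adapted c" and c': "adapted c'"
  shows "img (slice_chart S c) (fst (slice_chart S c')) = {x. put_last t x \<in> img c (fst c')}"
    "x \<in> img (slice_chart S c) (fst (slice_chart S c')) \<Longrightarrow>
      trans_map (slice_chart S c) (slice_chart S c') x = drop_last (trans_map c c' (put_last t x))"
proof -
  show i: "img (slice_chart S c) (fst (slice_chart S c')) = {x. put_last t x \<in> img c (fst c')}"
  proof (rule set_eqI)
    fix x
    have "put_last t x \<in> snd c ` fst c \<Longrightarrow> cinv c (put_last t x) \<in> S"
      using slice_cinv(2)[OF c] by (simp add: slice_chart_def)
    then show "x \<in> img (slice_chart S c) (fst (slice_chart S c')) \<longleftrightarrow> x \<in> {x. put_last t x \<in> img c (fst c')}"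
      unfolding img_iff[OF slice_chart_on[OF c]] slice_image[OF c]
      using slice_cinv(1)[OF c, of x] by (auto simp: img_iff[OF adapted_chart[OF c]] slice_chart_def)
  qed
  assume "x \<in> img (slice_chart S c) (fst (slice_chart S c'))"
  then have "put_last t x \<in> snd c ` fst c"
    unfolding i by (auto simp: img_def)
  then show "trans_map (slice_chart S c) (slice_chart S c') x = drop_last (trans_map c c' (put_last t x))"
    using slice_cinv(1)[OF c] by (simp add: trans_map_def slice_chart_def)
qed

lemma slice_compatible:
  assumes c: "adapted c" and c': "adapted c'" and h: "hol_compatible c c'"
  shows "hol_compatible (slice_chart S c) (slice_chart S c')"
proof -
  have *: "hol_map (img (slice_chart S c) (fst (slice_chart S c'))) (trans_map (slice_chart S c) (slice_chart S c'))"
    if c: "adapted c" and c': "adapted c'" and h: "hol_map (img c (fst c')) (trans_map c c')" for c c'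
  proof -
    let ?T = "img (slice_chart S c) (fst (slice_chart S c'))"
    have o: "open ?T"
      using img_open[OF slice_chart_on[OF c]] slice_chart_on[OF c'] by (auto simp: chart_on_def)
    have 1: "hol_map ?T (\<lambda>x. trans_map c c' (put_last t x))"
      by (rule hol_map_comp(1)[OF hol_map_put_last[OF o] h]) (simp add: slice_trans[OF c c'])
    have "hol_map ?T (\<lambda>x. drop_last (trans_map c c' (put_last t x)))"
      by (rule hol_map_comp(1)[OF 1 hol_map_drop_last[OF open_UNIV]]) simp
    then show ?thesis
      by (rule hol_map_cong) (simp add: slice_trans(2)[OF c c'])
  qed
  show ?thesis unfolding hol_compatible_iff
    using *[OF c c'] *[OF c' c] h by (simp add: hol_compatible_iff)
qed

end

text \<open>
  Two holomorphic charts whose last coordinate is the projection differ by a change of coordinates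
  that preserves the slices, so the fibres of a family are complex manifolds as soon as such charts
  cover the total space.
\<close>

lemma family_fibre_manifold:
  assumes Y: "complex_manifold Y"
    and cov: "\<And>p. p \<in> topspace (mtop Y) \<Longrightarrow> \<exists>c\<in>max_atlas Y. p \<in> fst c \<and> (\<forall>p\<in>fst c. snd c p $ 4 = f p)"
  shows "complex_manifold (family_fibre Y f t)"
proof -
  define S where "S = {p \<in> topspace (mtop Y). f p = t}"
  interpret fibre_slice "mtop Y" f t S by unfold_locales (rule S_def)
  define A where "A = {c \<in> max_atlas Y. \<forall>p\<in>fst c. snd c p $ 4 = f p}"
  have M: "mtop (family_fibre Y f t) = subtopology (mtop Y) S" "atlas (family_fibre Y f t) = slice_chart S ` A"
    unfolding family_fibre_def Let_def S_def[symmetric] slice_chart_def[abs_def] setcompr_eq_image A_def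
    by simp_all
  have ad: "adapted c" "c \<in> max_atlas Y" if "c \<in> A" for c
    using that by (simp_all add: A_def adapted_def max_atlas_def)
  have "Hausdorff_space (subtopology (mtop Y) S)" "second_countable (subtopology (mtop Y) S)"
    using Y by (simp_all add: complex_manifold_def Hausdorff_space_subtopology second_countable_subtopology)
  moreover have "\<forall>d\<in>slice_chart S ` A. chart_on (subtopology (mtop Y) S) d"
    using slice_chart_on[OF ad(1)] by blast
  moreover have "(\<Union>d\<in>slice_chart S ` A. fst d) = topspace (subtopology (mtop Y) S)"
  proof -
    have "\<exists>c\<in>A. p \<in> fst c" if "p \<in> S" for p
      using cov[of p] that unfolding A_def S_def by blast
    then show ?thesis by (force simp: slice_chart_def S_def)
  qed
  moreover have "\<forall>d\<in>slice_chart S ` A. \<forall>d'\<in>slice_chart S ` A. hol_compatible d d'"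
    using slice_compatible[OF ad(1) ad(1)] max_atlas_compatible[OF Y ad(2) ad(2)] by blast
  ultimately show ?thesis
    unfolding complex_manifold_def M by blast
qed

section \<open>The deformation of the Iwasawa manifold\<close>

definition gauss :: "complex set" where
  "gauss = {z. Re z \<in> \<int> \<and> Im z \<in> \<int>}"

lemma gauss_closed_ops [simp]:
  "0 \<in> gauss" "1 \<in> gauss" "\<i> \<in> gauss"
  "a \<in> gauss \<Longrightarrow> b \<in> gauss \<Longrightarrow> a + b \<in> gauss"
  "a \<in> gauss \<Longrightarrow> b \<in> gauss \<Longrightarrow> a - b \<in> gauss"
  "a \<in> gauss \<Longrightarrow> b \<in> gauss \<Longrightarrow> a * b \<in> gauss"
  "a \<in> gauss \<Longrightarrow> - a \<in> gauss"
  by (auto simp: gauss_def)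

lemma gauss_small: "z \<in> gauss \<Longrightarrow> cmod z < 1 \<Longrightarrow> z = 0"
proof -
  assume z: "z \<in> gauss" "cmod z < 1"
  then have "\<bar>Re z\<bar> < 1" "\<bar>Im z\<bar> < 1" using abs_Re_le_cmod abs_Im_le_cmod by (metis le_less_trans)+
  then show "z = 0" using z Ints_nonzero_abs_less1 by (auto simp: gauss_def complex_eq_iff)
qed

lemma closed_gauss: "closed gauss"
proof -
  have "gauss = Re -` \<int> \<inter> Im -` \<int>" by (auto simp: gauss_def)
  moreover have "closed (Re -` \<int>)" "closed (Im -` \<int>)"
    by (intro closed_vimage closed_Ints continuous_intros)+
  ultimately show ?thesis by (metis closed_Int)
qed

lemma gauss_reduce: "\<exists>g\<in>gauss. z + g \<in> cbox 0 (Complex 1 1)"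
proof (intro bexI)
  let ?g = "Complex (- of_int \<lfloor>Re z\<rfloor>) (- of_int \<lfloor>Im z\<rfloor>)"
  show "?g \<in> gauss" by (simp add: gauss_def)
  show "z + ?g \<in> cbox 0 (Complex 1 1)"
    by (auto simp: in_cbox_complex_iff) linarith+
qed

text \<open>
  Left multiplication by \<open>(a, b, c)\<close> in the Heisenberg group, written in the coordinate
  \<open>w\<^sub>1 = x\<^sub>1 + t x\<^sub>2\<^sup>*\<close> in place of \<open>x\<^sub>1\<close>. The fourth coordinate is the parameter \<open>t\<close>, in which the
  action is holomorphic too, so a single quotient carries the whole family.
\<close>

definition deck :: "complex \<Rightarrow> complex \<Rightarrow> complex \<Rightarrow> complex ^ 4 \<Rightarrow> complex ^ 4" where
  "deck a b c p = vector [p $ 1 + a + p $ 4 * cnj b, p $ 2 + b, p $ 3 + a * p $ 2 + c, p $ 4]"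

lemma deck_simps [simp]:
  "deck a b c p $ 1 = p $ 1 + a + p $ 4 * cnj b" "deck a b c p $ 2 = p $ 2 + b"
  "deck a b c p $ 3 = p $ 3 + a * p $ 2 + c" "deck a b c p $ 4 = p $ 4"
  by (simp_all add: deck_def)

lemma deck_deck: "deck a b c (deck a' b' c' p) = deck (a + a') (b + b') (c + c' + a * b') p"
  by (simp add: vec_eq_iff forall_4 algebra_simps)

lemma deck_0: "deck 0 0 0 p = p"
  by (simp add: vec_eq_iff forall_4)

lemma deck_inverse: "deck (- a) (- b) (a * b - c) (deck a b c p) = p" "deck a b c (deck (- a) (- b) (a * b - c) p) = p"
  by (simp_all add: deck_deck deck_0)

lemma hol_map_deck: "open S \<Longrightarrow> hol_map S (deck a b c)"
  unfolding hol_map_def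
  by (simp add: forall_4) (intro conjI hol_fun_add hol_fun_mult hol_fun_nth hol_fun_const; assumption)

lemma continuous_deck: "continuous_on S (deck a b c)"
  using hol_map_continuous[OF hol_map_deck[OF open_UNIV]] continuous_on_subset by blast

definition same_orbit :: "complex ^ 4 \<Rightarrow> complex ^ 4 \<Rightarrow> bool" where
  "same_orbit p q \<longleftrightarrow> (\<exists>a\<in>gauss. \<exists>b\<in>gauss. \<exists>c\<in>gauss. q = deck a b c p)"

lemma same_orbit_refl: "same_orbit p p"
  unfolding same_orbit_def by (intro bexI[of _ 0]) (simp_all add: deck_0)

lemma same_orbit_sym: "same_orbit p q \<Longrightarrow> same_orbit q p"
  unfolding same_orbit_def
  by (metis deck_inverse(1) gauss_closed_ops(5,6,7))

lemma same_orbit_trans: "same_orbit p q \<Longrightarrow> same_orbit q r \<Longrightarrow> same_orbit p r"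
  unfolding same_orbit_def
  by (metis deck_deck gauss_closed_ops(4,6))

definition orbit_cls :: "complex ^ 4 \<Rightarrow> point" where
  "orbit_cls p = {q. same_orbit p q}"

lemma orbit_cls_eq_iff: "orbit_cls p = orbit_cls q \<longleftrightarrow> same_orbit p q"
  unfolding orbit_cls_def using same_orbit_refl same_orbit_sym same_orbit_trans by blast

lemma orbit_cls_deck: "a \<in> gauss \<Longrightarrow> b \<in> gauss \<Longrightarrow> c \<in> gauss \<Longrightarrow> orbit_cls (deck a b c p) = orbit_cls p"
  unfolding orbit_cls_eq_iff by (rule same_orbit_sym) (auto simp: same_orbit_def)

lemma same_orbit_last: "same_orbit p q \<Longrightarrow> q $ 4 = p $ 4"
  by (auto simp: same_orbit_def)

text \<open>
  The group element is determined by the two points: the second coordinates give \<open>b\<close>, then the first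
  give \<open>a\<close> and the third give \<open>c\<close>.
\<close>

lemma same_orbit_iff:
  "same_orbit p q \<longleftrightarrow> q $ 4 = p $ 4 \<and> q $ 2 - p $ 2 \<in> gauss \<and>
     q $ 1 - p $ 1 - p $ 4 * cnj (q $ 2 - p $ 2) \<in> gauss \<and>
     q $ 3 - p $ 3 - (q $ 1 - p $ 1 - p $ 4 * cnj (q $ 2 - p $ 2)) * p $ 2 \<in> gauss"
  (is "_ \<longleftrightarrow> ?R")
proof
  assume "same_orbit p q" then show ?R by (auto simp: same_orbit_def)
next
  assume R: ?R
  let ?b = "q $ 2 - p $ 2"
  let ?a = "q $ 1 - p $ 1 - p $ 4 * cnj ?b"
  let ?c = "q $ 3 - p $ 3 - ?a * p $ 2"
  have "q = deck ?a ?b ?c p"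
    unfolding vec_eq_iff forall_4 deck_simps using R by (simp add: algebra_simps)
  with R show "same_orbit p q" unfolding same_orbit_def by blast
qed

text \<open>
  A Gaussian integer of modulus less than one is zero. Two points in a ball of radius one half have
  distance less than one, which forces \<open>b\<close>, then \<open>a\<close>, then \<open>c\<close> to vanish. Hence the action is free
  and such a ball is a sheet of the covering.
\<close>

lemma same_orbit_near:
  assumes "same_orbit q r" "dist p q < 1/2" "dist p r < 1/2"
  shows "q = r"
proof -
  obtain a b c where abc: "a \<in> gauss" "b \<in> gauss" "c \<in> gauss" "r = deck a b c q"
    using assms(1) by (auto simp: same_orbit_def)
  have "dist q r < 1" using dist_triangle_half_l[of q p 1 r] assms(2,3) by (simp add: dist_commute)
  then have small: "cmod ((r - q) $ i) < 1" for i
    using Finite_Cartesian_Product.norm_nth_le[of "r - q" i] by (simp add: dist_norm norm_minus_commute del: vector_minus_component)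
  have "b = 0" using small[of 2] abc by (intro gauss_small) auto
  then have "a = 0" using small[of 1] abc by (intro gauss_small) auto
  then have "c = 0" using small[of 3] abc \<open>b = 0\<close> by (intro gauss_small) auto
  show ?thesis using abc \<open>a = 0\<close> \<open>b = 0\<close> \<open>c = 0\<close> by (simp add: deck_0)
qed

definition base :: "(complex ^ 4) set" where
  "base = {p. cmod (p $ 4) < 1}"

lemma open_base: "open base"
  unfolding base_def by (intro open_Collect_less continuous_intros)

lemma deck_base [simp]: "deck a b c p \<in> base \<longleftrightarrow> p \<in> base"
  by (simp add: base_def)

definition total_top :: "point topology" where
  "total_top = topology (\<lambda>U. U \<subseteq> orbit_cls ` base \<and> open (base \<inter> orbit_cls -` U))"

lemma openin_total_top: "openin total_top U \<longleftrightarrow> U \<subseteq> orbit_cls ` base \<and> open (base \<inter> orbit_cls -` U)"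
proof -
  have "istopology (\<lambda>U. U \<subseteq> orbit_cls ` base \<and> open (base \<inter> orbit_cls -` U))"
    unfolding istopology_def
  proof (intro conjI allI impI; (elim conjE)?)
    fix S T :: "point set" assume "open (base \<inter> orbit_cls -` S)" "open (base \<inter> orbit_cls -` T)"
    moreover have "base \<inter> orbit_cls -` (S \<inter> T) = (base \<inter> orbit_cls -` S) \<inter> (base \<inter> orbit_cls -` T)"
      by blast
    ultimately show "open (base \<inter> orbit_cls -` (S \<inter> T))"
      by (simp only: open_Int)
  next
    fix \<K> assume K: "\<forall>U\<in>\<K>. U \<subseteq> orbit_cls ` base \<and> open (base \<inter> orbit_cls -` U)"
    have "base \<inter> orbit_cls -` (\<Union> \<K>) = (\<Union>U\<in>\<K>. base \<inter> orbit_cls -` U)" by blast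
    moreover have "open (\<Union>U\<in>\<K>. base \<inter> orbit_cls -` U)" using K by blast
    ultimately show "open (base \<inter> orbit_cls -` (\<Union> \<K>))" by (simp only:)
  qed auto
  then show ?thesis unfolding total_top_def by simp
qed

lemma topspace_total_top: "topspace total_top = orbit_cls ` base"
proof -
  have "base \<inter> orbit_cls -` (orbit_cls ` base) = base" by blast
  then have "openin total_top (orbit_cls ` base)" by (simp add: openin_total_top open_base)
  then show ?thesis by (metis openin_subset openin_topspace openin_total_top subset_antisym)
qed

text \<open>
  The preimage of the image of an open set is a union of translates, so the quotient map is open.
\<close>

lemma saturation:
  assumes "B \<subseteq> base"
  shows "base \<inter> orbit_cls -` (orbit_cls ` B) = (\<Union>a\<in>gauss. \<Union>b\<in>gauss. \<Union>c\<in>gauss. deck a b c -` B)"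
proof (intro set_eqI iffI)
  fix p assume "p \<in> base \<inter> orbit_cls -` (orbit_cls ` B)"
  then show "p \<in> (\<Union>a\<in>gauss. \<Union>b\<in>gauss. \<Union>c\<in>gauss. deck a b c -` B)"
    unfolding Int_iff vimage_eq image_iff orbit_cls_eq_iff same_orbit_def by blast
next
  fix p assume "p \<in> (\<Union>a\<in>gauss. \<Union>b\<in>gauss. \<Union>c\<in>gauss. deck a b c -` B)"
  then obtain a b c where h: "a \<in> gauss" "b \<in> gauss" "c \<in> gauss" "deck a b c p \<in> B" by blast
  then have "p \<in> base" using assms deck_base by blast
  moreover have "orbit_cls p \<in> orbit_cls ` B" using h orbit_cls_deck by (metis image_eqI)
  ultimately show "p \<in> base \<inter> orbit_cls -` (orbit_cls ` B)" by blast
qed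

lemma openin_orbit_image:
  assumes "open B" "B \<subseteq> base"
  shows "openin total_top (orbit_cls ` B)"
  unfolding openin_total_top saturation[OF assms(2)]
  using assms by (auto intro!: open_UN open_vimage continuous_deck)

lemma continuous_map_orbit_cls: "continuous_map (top_of_set base) total_top orbit_cls"
  unfolding continuous_map_def
proof (intro conjI allI impI)
  show "orbit_cls \<in> topspace (top_of_set base) \<rightarrow> topspace total_top"
    by (auto simp: topspace_total_top)
  fix U assume "openin total_top U"
  then have "open (base \<inter> orbit_cls -` U)" by (simp add: openin_total_top)
  moreover have "{x \<in> topspace (top_of_set base). orbit_cls x \<in> U} = base \<inter> orbit_cls -` U" by auto
  ultimately show "openin (top_of_set base) {x \<in> topspace (top_of_set base). orbit_cls x \<in> U}"
    by (simp add: openin_open_eq[OF open_base])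
qed

lemma open_map_orbit_cls: "open_map (top_of_set base) total_top orbit_cls"
  unfolding open_map_def
  by (auto simp: openin_open_eq[OF open_base] intro: openin_orbit_image)

text \<open>
  The orbit relation is closed because it says that certain continuous functions of the two points
  take Gaussian integer values; the quotient map being open, this makes the quotient Hausdorff.
\<close>

lemma closed_same_orbit: "closed {(p, q). same_orbit p q}"
proof -
  have "{(p, q). same_orbit p q} =
     {z. snd z $ 4 = fst z $ 4} \<inter> (\<lambda>z. snd z $ 2 - fst z $ 2) -` gauss \<inter>
     (\<lambda>z. snd z $ 1 - fst z $ 1 - fst z $ 4 * cnj (snd z $ 2 - fst z $ 2)) -` gauss \<inter>
     (\<lambda>z. snd z $ 3 - fst z $ 3 - (snd z $ 1 - fst z $ 1 - fst z $ 4 * cnj (snd z $ 2 - fst z $ 2)) * fst z $ 2) -` gauss"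
    by (auto simp: same_orbit_iff)
  also have "closed \<dots>"
    by (intro closed_Int closed_vimage closed_gauss closed_Collect_eq continuous_intros)
  finally show ?thesis .
qed

lemma Hausdorff_total_top: "Hausdorff_space total_top"
  unfolding Hausdorff_space_def
proof (intro allI impI)
  fix x y assume "x \<in> topspace total_top \<and> y \<in> topspace total_top \<and> x \<noteq> y"
  then obtain p q where pq: "p \<in> base" "q \<in> base" "x = orbit_cls p" "y = orbit_cls q" "\<not> same_orbit p q"
    unfolding topspace_total_top by (metis imageE orbit_cls_eq_iff)
  have "open (- {(p, q). same_orbit p q})" using closed_same_orbit by (simp add: open_closed)
  moreover have "(p, q) \<in> - {(p, q). same_orbit p q}" using pq by simp
  ultimately obtain U V where UV: "open U" "open V" "p \<in> U" "q \<in> V" "U \<times> V \<subseteq> - {(p, q). same_orbit p q}"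
    by (rule open_prod_elim) auto
  let ?U = "orbit_cls ` (U \<inter> base)" and ?V = "orbit_cls ` (V \<inter> base)"
  have "openin total_top ?U" "openin total_top ?V"
    using UV by (auto intro!: openin_orbit_image open_base)
  moreover have "disjnt ?U ?V"
    using UV(5) by (auto simp: disjnt_iff orbit_cls_eq_iff)
  ultimately show "\<exists>U V. openin total_top U \<and> openin total_top V \<and> x \<in> U \<and> y \<in> V \<and> disjnt U V"
    using pq UV by (intro exI[of _ ?U] exI[of _ ?V]) auto
qed

lemma second_countable_top_of_set: "second_countable (top_of_set (S :: 'a::euclidean_space set))"
proof (rule second_countable_subtopology)
  obtain \<B> :: "'a set set" where "countable \<B>" "\<And>C. C \<in> \<B> \<Longrightarrow> open C"
    "\<And>S. open S \<Longrightarrow> \<exists>U. U \<subseteq> \<B> \<and> S = \<Union>U"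
    using univ_second_countable by blast
  then show "second_countable (euclidean :: 'a topology)"
    unfolding second_countable_def by (intro exI[of _ \<B>]) (metis UnionE Union_upper open_openin subsetD)
qed

lemma second_countable_total_top: "second_countable total_top"
proof (rule second_countable_open_map_image[OF continuous_map_orbit_cls open_map_orbit_cls])
  show "second_countable (top_of_set base)"
    by (rule second_countable_top_of_set)
qed (simp add: topspace_total_top)

definition evenly_covering :: "(complex ^ 4) set \<Rightarrow> bool" where
  "evenly_covering B \<longleftrightarrow> open B \<and> B \<subseteq> base \<and> inj_on orbit_cls B"

definition std_chart :: "(complex ^ 4) set \<Rightarrow> (point, 4) chart" where
  "std_chart B = (orbit_cls ` B, inv_into B orbit_cls)"

definition total_space :: "(point, 4) cman" where
  "total_space = \<lparr>mtop = total_top, atlas = std_chart ` {B. evenly_covering B}\<rparr>"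

text \<open>
  All members of an orbit have the same last coordinate, so the choice of representative is harmless.
\<close>

definition total_proj :: "point \<Rightarrow> complex" where
  "total_proj X = (SOME q. q \<in> X) $ 4"

lemma total_proj_cls [simp]: "total_proj (orbit_cls p) = p $ 4"
proof -
  have "same_orbit p (SOME q. q \<in> orbit_cls p)"
    using someI[of "\<lambda>q. q \<in> orbit_cls p" p] same_orbit_refl by (simp add: orbit_cls_def)
  then show ?thesis unfolding total_proj_def by (rule same_orbit_last)
qed

lemma std_chart_simps:
  assumes "evenly_covering B"
  shows "fst (std_chart B) = orbit_cls ` B" "p \<in> B \<Longrightarrow> snd (std_chart B) (orbit_cls p) = p"
    "snd (std_chart B) ` fst (std_chart B) = B" "p \<in> B \<Longrightarrow> cinv (std_chart B) p = orbit_cls p"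
proof -
  have inj: "inj_on orbit_cls B" using assms by (simp add: evenly_covering_def)
  show 1: "fst (std_chart B) = orbit_cls ` B" by (simp add: std_chart_def)
  show 2: "snd (std_chart B) (orbit_cls p) = p" if "p \<in> B" for p
    using inj that by (simp add: std_chart_def)
  then show 3: "snd (std_chart B) ` fst (std_chart B) = B" unfolding 1 by force
  show "p \<in> B \<Longrightarrow> cinv (std_chart B) p = orbit_cls p"
    by (simp add: cinv_def std_chart_def inv_into_inv_into_eq[OF inj_on_imp_bij_betw[OF inj]])
qed

lemma evenly_covering_ball: "p \<in> base \<Longrightarrow> evenly_covering (ball p (1/2) \<inter> base)"
  unfolding evenly_covering_def
proof (intro conjI inj_onI)
  fix q r assume "q \<in> ball p (1/2) \<inter> base" "r \<in> ball p (1/2) \<inter> base" "orbit_cls q = orbit_cls r"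
  then show "q = r" using same_orbit_near[of q r p] by (simp add: orbit_cls_eq_iff)
qed (auto intro: open_base)

lemma std_chart_on:
  assumes B: "evenly_covering B"
  shows "chart_on total_top (std_chart B)"
proof -
  have op: "open B" "B \<subseteq> base" "inj_on orbit_cls B" using B by (auto simp: evenly_covering_def)
  have o: "openin total_top (orbit_cls ` B)" using op by (intro openin_orbit_image)
  have h: "homeomorphic_map (top_of_set B) (subtopology total_top (orbit_cls ` B)) orbit_cls"
  proof (rule bijective_open_imp_homeomorphic_map)
    show "continuous_map (top_of_set B) (subtopology total_top (orbit_cls ` B)) orbit_cls"
      unfolding continuous_map_in_subtopology
      using continuous_map_from_subtopology_mono[OF continuous_map_orbit_cls op(2)] by auto
    show "open_map (top_of_set B) (subtopology total_top (orbit_cls ` B)) orbit_cls"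
      unfolding open_map_def
    proof (intro allI impI)
      fix U assume "openin (top_of_set B) U"
      then have "open U" "U \<subseteq> B" using op by (auto simp: openin_open_eq)
      then have "openin total_top (orbit_cls ` U)" "orbit_cls ` U \<subseteq> orbit_cls ` B"
        using op openin_orbit_image by auto
      then show "openin (subtopology total_top (orbit_cls ` B)) (orbit_cls ` U)"
        by (simp add: openin_open_subtopology[OF o])
    qed
    show "orbit_cls ` topspace (top_of_set B) = topspace (subtopology total_top (orbit_cls ` B))"
      using op(2) by (auto simp: topspace_total_top)
  qed (use op in auto)
  then obtain g where g: "homeomorphic_maps (top_of_set B) (subtopology total_top (orbit_cls ` B)) orbit_cls g"
    using homeomorphic_map_maps by blast
  then have gh: "homeomorphic_map (subtopology total_top (orbit_cls ` B)) (top_of_set B) g"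
    by (simp add: homeomorphic_maps_map)
  have "homeomorphic_map (subtopology total_top (orbit_cls ` B)) (top_of_set B) (snd (std_chart B))"
  proof (rule homeomorphic_map_eq[OF gh])
    fix x assume "x \<in> topspace (subtopology total_top (orbit_cls ` B))"
    then obtain p where p: "p \<in> B" "x = orbit_cls p" by auto
    then show "g x = snd (std_chart B) x"
      using g std_chart_simps(2)[OF B] by (simp add: homeomorphic_maps_def)
  qed
  then show ?thesis
    unfolding chart_on_def std_chart_simps(1,3)[OF B] using o op by (simp add: std_chart_simps(3)[OF B, unfolded std_chart_simps(1)[OF B]])
qed

text \<open>
  The group element depends on the chosen pair of points: on an overlap with several components
  the transition map may be a different deck transformation on each of them.
\<close>

lemma std_transition:
  assumes B: "evenly_covering B" and B': "evenly_covering B'"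
    and x: "x \<in> B" "x' \<in> B'" "orbit_cls x = orbit_cls x'"
  obtains a b c where "a \<in> gauss" "b \<in> gauss" "c \<in> gauss" "x' = deck a b c x"
    "\<And>y. y \<in> B \<Longrightarrow> deck a b c y \<in> B' \<Longrightarrow> trans_map (std_chart B) (std_chart B') y = deck a b c y"
proof -
  obtain a b c where abc: "a \<in> gauss" "b \<in> gauss" "c \<in> gauss" "x' = deck a b c x"
    using x by (auto simp: orbit_cls_eq_iff same_orbit_def)
  have "trans_map (std_chart B) (std_chart B') y = deck a b c y" if "y \<in> B" "deck a b c y \<in> B'" for y
  proof -
    have "trans_map (std_chart B) (std_chart B') y = snd (std_chart B') (orbit_cls y)"
      using that by (simp add: trans_map_def std_chart_simps(4)[OF B])
    also have "orbit_cls y = orbit_cls (deck a b c y)" using abc orbit_cls_deck by simp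
    finally show ?thesis using that std_chart_simps(2)[OF B'] by simp
  qed
  then show thesis using that abc by blast
qed

lemma std_compatible:
  assumes B: "evenly_covering B" and B': "evenly_covering B'"
  shows "hol_map (img (std_chart B) (fst (std_chart B'))) (trans_map (std_chart B) (std_chart B'))"
proof (rule hol_map_local)
  let ?I = "img (std_chart B) (fst (std_chart B'))"
  fix x assume x: "x \<in> ?I"
  have o: "open ?I" using img_open[OF std_chart_on[OF B]] std_chart_on[OF B'] by (auto simp: chart_on_def)
  have IB: "?I \<subseteq> B" using std_chart_simps(3)[OF B] by (auto simp: img_def)
  then have xB: "x \<in> B" using x by blast
  have "orbit_cls x \<in> orbit_cls ` B'"
    using x by (simp add: img_iff[OF std_chart_on[OF B]] std_chart_simps(1)[OF B'] std_chart_simps(4)[OF B xB])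
  then obtain x' where x': "x' \<in> B'" "orbit_cls x = orbit_cls x'" by blast
  obtain a b c where abc: "a \<in> gauss" "b \<in> gauss" "c \<in> gauss" "x' = deck a b c x"
    "\<And>y. y \<in> B \<Longrightarrow> deck a b c y \<in> B' \<Longrightarrow> trans_map (std_chart B) (std_chart B') y = deck a b c y"
    using std_transition[OF B B' xB x'] by blast
  let ?T = "?I \<inter> deck a b c -` B'"
  have oT: "open ?T" using o B' by (auto intro!: open_vimage continuous_deck simp: evenly_covering_def)
  have "hol_map ?T (trans_map (std_chart B) (std_chart B'))"
    by (rule hol_map_cong[OF hol_map_deck[OF oT]]) (use IB abc(5) in auto)
  then show "\<exists>T. x \<in> T \<and> T \<subseteq> ?I \<and> hol_map T (trans_map (std_chart B) (std_chart B'))"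
    using x x' abc(4) by (intro exI[of _ ?T]) auto
qed

lemma total_space_simps [simp]:
  "mtop total_space = total_top" "atlas total_space = std_chart ` {B. evenly_covering B}"
  by (simp_all add: total_space_def)

lemma base_covered:
  assumes "x \<in> orbit_cls ` base"
  obtains p B where "p \<in> B" "evenly_covering B" "x = orbit_cls p"
proof -
  obtain p where p: "p \<in> base" "x = orbit_cls p" using assms by blast
  then show thesis using that[of p "ball p (1/2) \<inter> base"] evenly_covering_ball by simp
qed

lemma complex_manifold_total_space: "complex_manifold total_space"
  unfolding complex_manifold_def
proof (intro conjI)
  show "(\<Union>c\<in>atlas total_space. fst c) = topspace (mtop total_space)"
  proof
    show "(\<Union>c\<in>atlas total_space. fst c) \<subseteq> topspace (mtop total_space)"
      by (auto simp: topspace_total_top std_chart_def evenly_covering_def)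
    show "topspace (mtop total_space) \<subseteq> (\<Union>c\<in>atlas total_space. fst c)"
    proof
      fix x assume "x \<in> topspace (mtop total_space)"
      then obtain p B where "p \<in> B" "evenly_covering B" "x = orbit_cls p"
        unfolding total_space_simps topspace_total_top by (metis base_covered)
      then show "x \<in> (\<Union>c\<in>atlas total_space. fst c)" by (auto simp: std_chart_def)
    qed
  qed
qed (use std_compatible in \<open>auto simp: Hausdorff_total_top second_countable_total_top std_chart_on hol_compatible_iff\<close>)

lemma std_chart_last:
  assumes B: "evenly_covering B" and p: "p \<in> fst (std_chart B)"
  shows "snd (std_chart B) p $ 4 = total_proj p"
  using p std_chart_simps(2)[OF B] by (auto simp: std_chart_simps(1)[OF B])

lemma holomorphic_submersion_total: "holomorphic_submersion total_space total_proj"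
  unfolding holomorphic_submersion_def
proof (intro ballI conjI)
  fix c assume "c \<in> atlas total_space"
  then obtain B where B: "evenly_covering B" "c = std_chart B" by auto
  have im: "snd c ` fst c = B" by (simp add: B std_chart_simps(3)[OF B(1)])
  have oB: "open B" using B by (simp add: evenly_covering_def)
  have eq: "x $ 4 = (total_proj \<circ> cinv c) x" if "x \<in> B" for x
    using that by (simp add: B(2) std_chart_simps(4)[OF B(1)])
  show "hol_fun (snd c ` fst c) (total_proj \<circ> cinv c)"
    unfolding im by (rule hol_fun_cong[OF hol_fun_nth[OF oB] eq])
  fix x assume "x \<in> snd c ` fst c"
  then have x: "x \<in> B" by (simp add: im)
  have "((\<lambda>x. x $ 4) has_derivative (\<lambda>v. v $ 4)) (at x)" by (auto intro!: derivative_eq_intros)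
  then have "((total_proj \<circ> cinv c) has_derivative (\<lambda>v. v $ 4)) (at x)"
    by (rule has_derivative_transform_within_open[OF _ oB x eq])
  then have "fder (total_proj \<circ> cinv c) x = (\<lambda>v. v $ 4)" by (rule fder_eq)
  moreover have "surj (\<lambda>v :: complex ^ 4. v $ 4)"
    by (rule surjI[of _ "\<lambda>a. vector [0, 0, 0, a]"]) simp
  ultimately show "surj (fder (total_proj \<circ> cinv c) x)" by simp
qed

lemma norm_le_components: "norm (x :: complex ^ 'n::finite) \<le> (\<Sum>i\<in>UNIV. cmod (x $ i))"
  unfolding norm_vec_def by (rule L2_set_le_sum) simp

text \<open>
  The translations by \<open>b\<close>, \<open>a\<close> and \<open>c\<close>, chosen in this order, bring the second, first and third
  coordinate of a point into the unit square. So the preimage of \<open>K\<close> is the image of a product of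
  three squares with \<open>K\<close>. For general \<open>K\<close> this makes the projection proper; for a point it makes the fibre compact.
\<close>

lemma compactin_preimage:
  assumes K: "compact K" "K \<subseteq> ball 0 1"
  shows "compactin total_top {x \<in> topspace total_top. total_proj x \<in> K}"
proof -
  let ?Q = "cbox 0 (Complex 1 1)"
  define C where "C = {p :: complex ^ 4. p $ 1 \<in> ?Q \<and> p $ 2 \<in> ?Q \<and> p $ 3 \<in> ?Q \<and> p $ 4 \<in> K}"
  have "closed C"
  proof -
    have "C = (\<lambda>p. p $ 1) -` ?Q \<inter> (\<lambda>p. p $ 2) -` ?Q \<inter> (\<lambda>p. p $ 3) -` ?Q \<inter> (\<lambda>p. p $ 4) -` K"
      by (auto simp: C_def)
    moreover have "closed K" using K(1) by (rule compact_imp_closed)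
    ultimately show ?thesis
      by (simp only:) (intro closed_Int closed_vimage continuous_intros closed_cbox)
  qed
  moreover have "bounded C"
  proof -
    have "bounded ?Q" by (rule bounded_cbox)
    then obtain R where R: "\<forall>z\<in>?Q. cmod z \<le> R" unfolding bounded_iff ..
    have "bounded K" using K(1) by (rule compact_imp_bounded)
    then obtain R' where R': "\<forall>z\<in>K. cmod z \<le> R'" unfolding bounded_iff ..
    have "norm p \<le> R + R + R + R'" if "p \<in> C" for p
    proof -
      have "norm p \<le> cmod (p $ 1) + cmod (p $ 2) + cmod (p $ 3) + cmod (p $ 4)"
        using norm_le_components[of p] by (simp add: sum_4)
      moreover have "p $ 1 \<in> ?Q" "p $ 2 \<in> ?Q" "p $ 3 \<in> ?Q" "p $ 4 \<in> K"
        using that unfolding C_def by blast+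
      then have "cmod (p $ 1) \<le> R" "cmod (p $ 2) \<le> R" "cmod (p $ 3) \<le> R" "cmod (p $ 4) \<le> R'"
        using R R' by blast+
      ultimately show ?thesis by linarith
    qed
    then show ?thesis unfolding bounded_iff by blast
  qed
  ultimately have cC: "compact C" by (simp add: compact_eq_bounded_closed)
  have Cb: "C \<subseteq> base" using K by (auto simp: C_def base_def)
  have "compactin (top_of_set base) C" using cC Cb by (simp add: compactin_subtopology)
  then have "compactin total_top (orbit_cls ` C)" by (rule image_compactin[OF _ continuous_map_orbit_cls])
  moreover have "orbit_cls ` C = {x \<in> topspace total_top. total_proj x \<in> K}"
  proof
    show "orbit_cls ` C \<subseteq> {x \<in> topspace total_top. total_proj x \<in> K}"
      using Cb by (auto simp: topspace_total_top) (auto simp: C_def)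
    show "{x \<in> topspace total_top. total_proj x \<in> K} \<subseteq> orbit_cls ` C"
    proof
      fix x assume "x \<in> {x \<in> topspace total_top. total_proj x \<in> K}"
      then obtain p where p: "p \<in> base" "x = orbit_cls p" "p $ 4 \<in> K" by (auto simp: topspace_total_top)
      obtain b where b: "b \<in> gauss" "p $ 2 + b \<in> ?Q" using gauss_reduce by blast
      obtain a where a: "a \<in> gauss" "p $ 1 + p $ 4 * cnj b + a \<in> ?Q" using gauss_reduce by blast
      obtain c where c: "c \<in> gauss" "p $ 3 + a * p $ 2 + c \<in> ?Q" using gauss_reduce by blast
      have "deck a b c p \<in> C" using a b c p by (simp add: C_def add_ac)
      then show "x \<in> orbit_cls ` C" using orbit_cls_deck[OF a(1) b(1) c(1), of p] p by (metis image_eqI)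
    qed
  qed
  ultimately show ?thesis by simp
qed

lemma family_total: "holomorphic_family total_space total_proj (ball 0 1)"
  unfolding holomorphic_family_def
proof (intro conjI complex_manifold_total_space holomorphic_submersion_total)
  show im: "total_proj ` topspace (mtop total_space) = ball 0 1"
  proof
    show "total_proj ` topspace (mtop total_space) \<subseteq> ball 0 1"
      by (auto simp: topspace_total_top base_def)
    show "ball 0 1 \<subseteq> total_proj ` topspace (mtop total_space)"
    proof
      fix t :: complex assume "t \<in> ball 0 1"
      then have "put_last t 0 \<in> base" by (simp add: base_def)
      moreover have "total_proj (orbit_cls (put_last t 0)) = t" by simp
      ultimately show "t \<in> total_proj ` topspace (mtop total_space)"
        unfolding total_space_simps topspace_total_top by (metis image_eqI)
    qed
  qed
  show "proper_map (mtop total_space) (top_of_set (ball 0 1)) total_proj"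
  proof (rule compact_imp_proper_map)
    show "k_space (top_of_set (ball (0::complex) 1))"
      by (simp add: metrizable_imp_k_space metrizable_space_subtopology metrizable_space_euclidean)
    show "kc_space (top_of_set (ball (0::complex) 1))"
      by (simp add: Hausdorff_imp_kc_space Hausdorff_space_subtopology)
    show "total_proj \<in> topspace (mtop total_space) \<rightarrow> topspace (top_of_set (ball 0 1))"
      using im by auto
    show "continuous_map (mtop total_space) (top_of_set (ball 0 1)) total_proj \<or> kc_space (mtop total_space)"
      by (simp add: Hausdorff_imp_kc_space Hausdorff_total_top)
    fix K assume "compactin (top_of_set (ball (0::complex) 1)) K"
    then show "compactin (mtop total_space) {x \<in> topspace (mtop total_space). total_proj x \<in> K}"
      using compactin_preimage by (simp add: compactin_subtopology)
  qed
qed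

abbreviation fibre :: "complex \<Rightarrow> (point, 3) cman" where
  "fibre t \<equiv> family_fibre total_space total_proj t"

lemma complex_manifold_fibre: "complex_manifold (fibre t)"
proof (rule family_fibre_manifold[OF complex_manifold_total_space])
  fix x assume "x \<in> topspace (mtop total_space)"
  then obtain p B where B: "p \<in> B" "evenly_covering B" "x = orbit_cls p"
    unfolding total_space_simps topspace_total_top by (metis base_covered)
  then have "std_chart B \<in> max_atlas total_space" "x \<in> fst (std_chart B)"
    using atlas_sub_max_atlas[OF complex_manifold_total_space] std_chart_simps(1) by auto
  then show "\<exists>c\<in>max_atlas total_space. x \<in> fst c \<and> (\<forall>p\<in>fst c. snd c p $ 4 = total_proj p)"
    using std_chart_last[OF B(2)] by blast
qed

lemma mtop_fibre: "mtop (fibre t) = subtopology total_top {x \<in> topspace total_top. total_proj x = t}"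
  by (simp add: family_fibre_def Let_def)

lemma compact_fibre:
  assumes "cmod t < 1"
  shows "compact_complex_manifold (fibre t)"
proof -
  have "compactin total_top {x \<in> topspace total_top. total_proj x \<in> {t}}"
    by (rule compactin_preimage) (use assms in auto)
  then show ?thesis
    unfolding compact_complex_manifold_def mtop_fibre
    using complex_manifold_fibre compact_space_subtopology by simp
qed

section \<open>The invariant coframe\<close>

text \<open>
  The charts of a fibre that come from sheets of the covering. In them the invariant forms have
  explicit expressions; an arbitrary chart of the fibre is compared with them.
\<close>

definition fchart :: "complex \<Rightarrow> (complex ^ 4) set \<Rightarrow> (point, 3) chart" where
  "fchart t B = slice_chart {x \<in> topspace total_top. total_proj x = t} (std_chart B)"

lemma fchart_simps:
  assumes B: "evenly_covering B"
  shows "fchart t B \<in> atlas (fibre t)" "fst (fchart t B) = orbit_cls ` (B \<inter> {p. p $ 4 = t})"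
    "put_last t x \<in> B \<Longrightarrow> snd (fchart t B) (orbit_cls (put_last t x)) = x"
    "snd (fchart t B) ` fst (fchart t B) = {x. put_last t x \<in> B}"
    "put_last t x \<in> B \<Longrightarrow> cinv (fchart t B) x = orbit_cls (put_last t x)"
proof -
  define S where "S = {x \<in> topspace total_top. total_proj x = t}"
  interpret fibre_slice total_top total_proj t S by unfold_locales (rule S_def)
  have ad: "adapted (std_chart B)"
    unfolding adapted_def using std_chart_on[OF B] std_chart_last[OF B] by blast
  have f: "fchart t B = slice_chart S (std_chart B)" by (simp add: fchart_def S_def)
  have m: "std_chart B \<in> max_atlas total_space"
    by (rule atlas_sub_max_atlas[OF complex_manifold_total_space]) (simp add: B)
  show "fchart t B \<in> atlas (fibre t)"
    unfolding f family_fibre_def Let_def total_space_simps S_def[symmetric] slice_chart_def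
      cman.simps mem_Collect_eq
    by (intro exI[of _ "std_chart B"] conjI refl m) (use std_chart_last[OF B] in blast)
  have "B \<subseteq> base" using B by (simp add: evenly_covering_def)
  then show "fst (fchart t B) = orbit_cls ` (B \<inter> {p. p $ 4 = t})"
    by (auto simp: f slice_chart_def std_chart_simps(1)[OF B] S_def topspace_total_top)
  show "put_last t x \<in> B \<Longrightarrow> snd (fchart t B) (orbit_cls (put_last t x)) = x"
    by (simp add: f slice_chart_def std_chart_simps(2)[OF B])
  show "snd (fchart t B) ` fst (fchart t B) = {x. put_last t x \<in> B}"
    unfolding f slice_image[OF ad] std_chart_simps(3)[OF B] by simp
  show "put_last t x \<in> B \<Longrightarrow> cinv (fchart t B) x = orbit_cls (put_last t x)"
    unfolding f using slice_cinv(1)[OF ad] by (simp add: std_chart_simps(3,4)[OF B])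
qed

lemma fibre_chart_on: "c \<in> atlas (fibre t) \<Longrightarrow> chart_on (mtop (fibre t)) c"
  using complex_manifold_fibre[of t] unfolding complex_manifold_def by blast

lemma fibre_compatible: "c \<in> atlas (fibre t) \<Longrightarrow> c' \<in> atlas (fibre t) \<Longrightarrow> hol_compatible c c'"
  using complex_manifold_fibre[of t] unfolding complex_manifold_def by blast

lemma fibre_image_open: "c \<in> atlas (fibre t) \<Longrightarrow> open (snd c ` fst c)"
  using fibre_chart_on chart_on_def by blast

lemma fchart_exists:
  assumes "p \<in> topspace (mtop (fibre t))"
  obtains B where "evenly_covering B" "p \<in> fst (fchart t B)"
proof -
  have "p \<in> orbit_cls ` base" "total_proj p = t"
    using assms by (auto simp: mtop_fibre topspace_total_top)
  then obtain q B where B: "q \<in> B" "evenly_covering B" "p = orbit_cls q" using base_covered by metis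
  then have "q $ 4 = t" using \<open>total_proj p = t\<close> by simp
  then show thesis using that[OF B(2)] B fchart_simps(2)[OF B(2)] by auto
qed

text \<open>
  The differential \<open>shear a\<close> of a deck transformation does not depend on the point, so the invariance
  of a tensor field on the cover is a condition with constant matrices.
\<close>

definition deck3 :: "complex \<Rightarrow> complex \<Rightarrow> complex \<Rightarrow> complex \<Rightarrow> complex ^ 3 \<Rightarrow> complex ^ 3" where
  "deck3 t a b c x = vector [x $ 1 + a + t * cnj b, x $ 2 + b, x $ 3 + a * x $ 2 + c]"

definition shear :: "complex \<Rightarrow> complex ^ 3 \<Rightarrow> complex ^ 3" where
  "shear a v = vector [v $ 1, v $ 2, v $ 3 + a * v $ 2]"

lemma deck3_simps [simp]:
  "deck3 t a b c x $ 1 = x $ 1 + a + t * cnj b" "deck3 t a b c x $ 2 = x $ 2 + b"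
  "deck3 t a b c x $ 3 = x $ 3 + a * x $ 2 + c"
  by (simp_all add: deck3_def)

lemma shear_simps [simp]:
  "shear a v $ 1 = v $ 1" "shear a v $ 2 = v $ 2" "shear a v $ 3 = v $ 3 + a * v $ 2"
  by (simp_all add: shear_def)

lemma deck_put_last: "deck a b c (put_last t x) = put_last t (deck3 t a b c x)"
  by (simp add: vec_eq_iff forall_4)

lemma deck3_has_derivative: "(deck3 t a b c has_derivative shear a) (at x)"
proof (rule has_derivative_vec_componentwise)
  fix i :: 3
  have "i = 1 \<or> i = 2 \<or> i = 3" by (rule exhaust_3)
  then show "((\<lambda>x. deck3 t a b c x $ i) has_derivative (\<lambda>v. shear a v $ i)) (at x)"
    by (elim disjE) (auto intro!: derivative_eq_intros)
qed

lemma continuous_deck3: "continuous_on S (deck3 t a b c)"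
  using deck3_has_derivative has_derivative_continuous continuous_at_imp_continuous_on by metis

lemma fchart_transition:
  assumes B: "evenly_covering B" "put_last t x \<in> B" and B': "evenly_covering B'" "put_last t x' \<in> B'"
    and e: "orbit_cls (put_last t x) = orbit_cls (put_last t x')"
  obtains a b c where "a \<in> gauss" "b \<in> gauss" "c \<in> gauss" "x' = deck3 t a b c x"
    "jac (fchart t B) (fchart t B') (orbit_cls (put_last t x)) = shear a"
proof -
  obtain a b c where abc: "a \<in> gauss" "b \<in> gauss" "c \<in> gauss" "put_last t x' = deck a b c (put_last t x)"
    using e by (auto simp: orbit_cls_eq_iff same_orbit_def)
  then have x': "x' = deck3 t a b c x"
    unfolding deck_put_last by (metis drop_put)
  have o: "open B" "open B'" using B B' by (auto simp: evenly_covering_def)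
  let ?N = "put_last t -` B \<inter> deck3 t a b c -` (put_last t -` B')"
  have put: "continuous_on A (put_last t)" for A
    using hol_map_continuous[OF hol_map_put_last[OF open_UNIV]] continuous_on_subset by blast
  have oN: "open ?N" by (intro open_Int open_vimage o put continuous_deck3)
  have xN: "x \<in> ?N" using B B' x' by simp
  have eq: "deck3 t a b c y = trans_map (fchart t B) (fchart t B') y" if "y \<in> ?N" for y
  proof -
    have "trans_map (fchart t B) (fchart t B') y = snd (fchart t B') (orbit_cls (put_last t y))"
      using that by (simp add: trans_map_def fchart_simps(5)[OF B(1)])
    also have "orbit_cls (put_last t y) = orbit_cls (put_last t (deck3 t a b c y))"
      using orbit_cls_deck[OF abc(1,2,3), of "put_last t y"] by (simp add: deck_put_last)
    finally show ?thesis using that fchart_simps(3)[OF B'(1)] by simp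
  qed
  have "(trans_map (fchart t B) (fchart t B') has_derivative shear a) (at x)"
    by (rule has_derivative_transform_within_open[OF deck3_has_derivative oN xN eq])
  then have "jac (fchart t B) (fchart t B') (orbit_cls (put_last t x)) = shear a"
    unfolding jac_def fchart_simps(3)[OF B] by (rule fder_eq)
  with that abc x' show thesis by blast
qed

text \<open>
  The forms \<open>dw\<^sub>1\<close>, \<open>dw\<^sub>2\<close> and \<open>dw\<^sub>3 - (w\<^sub>1 - t w\<^sub>2\<^sup>*) dw\<^sub>2\<close> descend to the fibre. For \<open>t = 0\<close> they
  are the left invariant holomorphic forms of the complex Heisenberg group.
\<close>

definition coframe :: "complex \<Rightarrow> complex ^ 3 \<Rightarrow> complex ^ 3 \<Rightarrow> complex ^ 3" where
  "coframe t w v = vector [v $ 1, v $ 2, v $ 3 - (w $ 1 - t * cnj (w $ 2)) * v $ 2]"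

lemma coframe_simps [simp]:
  "coframe t w v $ 1 = v $ 1" "coframe t w v $ 2 = v $ 2"
  "coframe t w v $ 3 = v $ 3 - (w $ 1 - t * cnj (w $ 2)) * v $ 2"
  by (simp_all add: coframe_def)

lemma coframe_invariant: "coframe t (deck3 t a b c w) (shear a v) = coframe t w v"
  by (simp add: vec_eq_iff forall_3 algebra_simps)

lemma coframe_linear: "linear (coframe t w)"
  by (rule linearI) (simp_all add: vec_eq_iff forall_3 algebra_simps)

lemma coframe_smult: "coframe t w (a *s v) = a *s coframe t w v"
  by (simp add: vec_eq_iff forall_3 algebra_simps)

lemma coframe_eq_0: "coframe t w v = 0 \<Longrightarrow> v = 0"
  by (simp add: vec_eq_iff forall_3)

text \<open>
  The invariant coframe in an arbitrary chart, as one vector-valued form. It is pulled back from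
  some sheet over the point; by invariance under deck transformations all sheets give the same
  value, which is \<open>frame_eq\<close>.
\<close>

definition frame :: "complex \<Rightarrow> (point, 3) chart \<Rightarrow> complex ^ 3 \<Rightarrow> complex ^ 3 \<Rightarrow> complex ^ 3" where
  "frame t c x v =
     (let d = fchart t (SOME B. evenly_covering B \<and> cinv c x \<in> fst (fchart t B))
      in coframe t (trans_map c d x) (fder (trans_map c d) x v))"

lemma frame_eq:
  assumes c: "c \<in> atlas (fibre t)" and p: "p \<in> fst c" and B: "evenly_covering B" "p \<in> fst (fchart t B)"
  shows "frame t c (snd c p) v = coframe t (snd (fchart t B) p) (jac c (fchart t B) p v)"
proof -
  note ch = fibre_chart_on[OF c]
  define B' where "B' = (SOME B. evenly_covering B \<and> cinv c (snd c p) \<in> fst (fchart t B))"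
  have ci: "cinv c (snd c p) = p" using chart_on_simps(2)[OF ch p] .
  have B': "evenly_covering B'" "p \<in> fst (fchart t B')"
    using someI_ex[of "\<lambda>B. evenly_covering B \<and> p \<in> fst (fchart t B)"] B unfolding B'_def ci by blast+
  have ex: "\<exists>x. p = orbit_cls (put_last t x) \<and> put_last t x \<in> B" if e: "evenly_covering B" "p \<in> fst (fchart t B)" for B
  proof -
    from e(2) obtain q where "q \<in> B" "q $ 4 = t" "p = orbit_cls q"
      unfolding fchart_simps(2)[OF e(1)] by auto
    then show ?thesis using put_drop[of q t] by (intro exI[of _ "drop_last q"]) simp
  qed
  obtain x where x: "p = orbit_cls (put_last t x)" "put_last t x \<in> B" using ex[OF B] by blast
  obtain x' where x': "p = orbit_cls (put_last t x')" "put_last t x' \<in> B'" using ex[OF B'] by blast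
  obtain a b c' where abc: "x' = deck3 t a b c' x" "jac (fchart t B) (fchart t B') p = shear a"
  proof -
    have e: "orbit_cls (put_last t x) = orbit_cls (put_last t x')" using x(1) x'(1) by simp
    show thesis
      using fchart_transition[OF B(1) x(2) B'(1) x'(2) e] that unfolding x(1)[symmetric] by blast
  qed
  have f: "fchart t B \<in> atlas (fibre t)" "fchart t B' \<in> atlas (fibre t)" using B B' fchart_simps(1) by auto
  have "jac c (fchart t B') p v = shear a (jac c (fchart t B) p v)"
    using jac_comp[OF ch fibre_chart_on[OF f(2)] fibre_chart_on[OF f(1)] p B'(2) B(2)
      fibre_compatible[OF c f(1)] fibre_compatible[OF f]] abc(2) by simp
  moreover have "snd (fchart t B) p = x" "snd (fchart t B') p = x'"
    using fchart_simps(3)[OF B(1) x(2)] fchart_simps(3)[OF B'(1) x'(2)] x(1) x'(1) by metis+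
  ultimately have "coframe t (snd (fchart t B') p) (jac c (fchart t B') p v)
      = coframe t (snd (fchart t B) p) (jac c (fchart t B) p v)"
    using abc(1) coframe_invariant by simp
  then show ?thesis
    unfolding frame_def Let_def B'_def[symmetric] by (simp add: jac_def trans_map_snd[OF ch p])
qed

context
  fixes t :: complex and c :: "(point, 3) chart"
  assumes c: "c \<in> atlas (fibre t)"
begin

text \<open>
  The sheet chosen in the definition of the frame varies with the point. Near a given point it can be
  replaced by a fixed one, which makes the frame accessible to differentiation.
\<close>

lemma frame_local:
  assumes x: "x \<in> snd c ` fst c"
  obtains N \<sigma> where "open N" "x \<in> N" "N \<subseteq> snd c ` fst c" "hol_map N \<sigma>"
    "\<And>y v. y \<in> N \<Longrightarrow> frame t c y v = coframe t (\<sigma> y) (fder \<sigma> y v)"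
    "\<And>y v. y \<in> N \<Longrightarrow> fder \<sigma> y v = 0 \<Longrightarrow> v = 0"
proof -
  note ch = fibre_chart_on[OF c]
  obtain p where p: "p \<in> fst c" "x = snd c p" using x by blast
  then have "p \<in> topspace (mtop (fibre t))" using chart_on_simps(5)[OF ch] by blast
  then obtain B where B: "evenly_covering B" "p \<in> fst (fchart t B)" using fchart_exists by blast
  let ?d = "fchart t B"
  have d: "?d \<in> atlas (fibre t)" by (rule fchart_simps(1)[OF B(1)])
  note chd = fibre_chart_on[OF d]
  let ?N = "img c (fst ?d)" and ?\<sigma> = "trans_map c ?d"
  have o: "open ?N" using img_open[OF ch] chd by (auto simp: chart_on_def)
  have y: "\<exists>q. q \<in> fst c \<and> q \<in> fst ?d \<and> y = snd c q" if "y \<in> ?N" for y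
    using that by (auto simp: img_def)
  show thesis
  proof (rule that[of ?N ?\<sigma>])
    show "open ?N" by (rule o)
    show "x \<in> ?N" using p B by (auto simp: img_def)
    show "?N \<subseteq> snd c ` fst c" by (auto simp: img_def)
    show "hol_map ?N ?\<sigma>" using fibre_compatible[OF c d] by (simp add: hol_compatible_iff)
    fix y v assume "y \<in> ?N"
    then obtain q where q: "q \<in> fst c" "q \<in> fst ?d" "y = snd c q" using y by blast
    show "frame t c y v = coframe t (?\<sigma> y) (fder ?\<sigma> y v)"
      using frame_eq[OF c q(1) B(1) q(2), of v] q trans_map_snd[OF ch q(1), of ?d] by (simp add: jac_def)
    have "jac ?d c q (jac c ?d q v) = v"
      using jac_comp[OF ch ch chd q(1) q(1) q(2) fibre_compatible[OF c d] fibre_compatible[OF d c], of v]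
        jac_same[OF ch q(1)] by simp
    moreover have "linear (jac ?d c q)"
      unfolding jac_def
      by (rule hol_map_linear[of "img ?d (fst c)"])
         (use fibre_compatible[OF c d] q in \<open>auto simp: hol_compatible_iff img_def\<close>)
    moreover assume "fder ?\<sigma> y v = 0"
    ultimately show "v = 0" using q by (simp add: jac_def linear_0)
  qed
qed

lemma frame_linear: "x \<in> snd c ` fst c \<Longrightarrow> linear (frame t c x)"
proof -
  assume "x \<in> snd c ` fst c"
  then obtain N \<sigma> where N: "x \<in> N" "hol_map N \<sigma>"
    "\<And>y v. y \<in> N \<Longrightarrow> frame t c y v = coframe t (\<sigma> y) (fder \<sigma> y v)"
    using frame_local by metis
  have "frame t c x = coframe t (\<sigma> x) \<circ> fder \<sigma> x" using N by auto
  then show ?thesis using linear_compose[OF hol_map_linear[OF N(2,1)] coframe_linear] by simp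
qed

lemma frame_smult: "x \<in> snd c ` fst c \<Longrightarrow> frame t c x (a *s v) = a *s frame t c x v"
proof -
  assume "x \<in> snd c ` fst c"
  then obtain N \<sigma> where N: "x \<in> N" "hol_map N \<sigma>"
    "\<And>y v. y \<in> N \<Longrightarrow> frame t c y v = coframe t (\<sigma> y) (fder \<sigma> y v)"
    using frame_local by metis
  show ?thesis using N(3)[OF N(1)] hol_map_fder(2)[OF N(2,1)] by (simp add: coframe_smult)
qed

lemma frame_eq_0: "x \<in> snd c ` fst c \<Longrightarrow> frame t c x v = 0 \<Longrightarrow> v = 0"
  using frame_local coframe_eq_0 by metis

end

lemma frame_transition:
  assumes c: "c \<in> atlas (fibre t)" and c': "c' \<in> atlas (fibre t)" and p: "p \<in> fst c" "p \<in> fst c'"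
  shows "frame t c (snd c p) v = frame t c' (snd c' p) (jac c c' p v)"
proof -
  have "p \<in> topspace (mtop (fibre t))" using chart_on_simps(5)[OF fibre_chart_on[OF c]] p by blast
  then obtain B where B: "evenly_covering B" "p \<in> fst (fchart t B)" using fchart_exists by blast
  note d = fchart_simps(1)[OF B(1), of t]
  show ?thesis
    unfolding frame_eq[OF c p(1) B] frame_eq[OF c' p(2) B]
    using jac_comp[OF fibre_chart_on[OF c] fibre_chart_on[OF d] fibre_chart_on[OF c'] p(1) B(2) p(2)
      fibre_compatible[OF c c'] fibre_compatible[OF c' d], of v] by simp
qed

definition det3 :: "complex ^ 3 \<Rightarrow> complex ^ 3 \<Rightarrow> complex ^ 3 \<Rightarrow> complex" where
  "det3 u v w = u $ 1 * (v $ 2 * w $ 3 - v $ 3 * w $ 2) - u $ 2 * (v $ 1 * w $ 3 - v $ 3 * w $ 1)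
     + u $ 3 * (v $ 1 * w $ 2 - v $ 2 * w $ 1)"

lemma det3_coframe: "det3 (coframe t w u) (coframe t w v) (coframe t w z) = det3 u v z"
  by (simp add: det3_def algebra_simps)

lemma det3_linear [simp]:
  "det3 (u + u') v w = det3 u v w + det3 u' v w" "det3 u (v + v') w = det3 u v w + det3 u v' w"
  "det3 u v (w + w') = det3 u v w + det3 u v w'"
  "det3 (a *s u) v w = a * det3 u v w" "det3 u (a *s v) w = a * det3 u v w" "det3 u v (a *s w) = a * det3 u v w"
  "det3 (r *\<^sub>R u) v w = r *\<^sub>R det3 u v w" "det3 u (r *\<^sub>R v) w = r *\<^sub>R det3 u v w"
  "det3 u v (r *\<^sub>R w) = r *\<^sub>R det3 u v w"
  "det3 u u w = 0" "det3 u w u = 0" "det3 w u u = 0"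
  by (simp_all add: det3_def algebra_simps)

lemma det3_nonzero:
  fixes A :: "complex ^ 3 \<Rightarrow> complex ^ 3"
  assumes lin: "linear A" "\<And>a v. A (a *s v) = a *s A v" and inj: "\<And>v. A v = 0 \<Longrightarrow> v = 0"
  shows "det3 (A (axis 1 1)) (A (axis 2 1)) (A (axis 3 1)) \<noteq> 0"
proof
  assume z: "det3 (A (axis 1 1)) (A (axis 2 1)) (A (axis 3 1)) = 0"
  define M :: "complex ^ 3 ^ 3" where "M = (\<chi> i j. A (axis j 1) $ i)"
  have "det M = det3 (A (axis 1 1)) (A (axis 2 1)) (A (axis 3 1))"
    by (simp add: M_def det_3 det3_def algebra_simps)
  then have "\<not> invertible M" using z by (simp add: invertible_det_nz)
  then obtain v where v: "v \<noteq> 0" "M *v v = 0"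
    using matrix_left_invertible_ker[of M] invertible_left_inverse[of M] by blast
  have "A v = M *v v"
  proof -
    have "A v = A (\<Sum>i\<in>UNIV. v $ i *s axis i 1)" by (simp add: basis_expansion)
    also have "\<dots> = (\<Sum>i\<in>UNIV. v $ i *s A (axis i 1))" by (simp add: linear_sum[OF lin(1)] lin(2))
    also have "\<dots> = M *v v"
      by (simp add: M_def vec_eq_iff matrix_vector_mult_def mult.commute)
    finally show ?thesis .
  qed
  then show False using inj v by simp
qed

definition vol_form :: "complex \<Rightarrow> (point, 3) field_form" where
  "vol_form t c x v = det3 (frame t c x (v 0)) (frame t c x (v 1)) (frame t c x (v 2))"

text \<open>
  For \<open>t \<noteq> 0\<close> the third form is not holomorphic, but it differs from \<open>dw\<^sub>3\<close> by a multiple of \<open>dw\<^sub>2\<close>, which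
  drops out of the determinant.
\<close>

lemma vol_form_hol:
  assumes c: "c \<in> atlas (fibre t)"
  shows "hol_fun (snd c ` fst c) (\<lambda>x. vol_form t c x v)"
proof (rule hol_fun_local)
  fix x assume "x \<in> snd c ` fst c"
  then obtain N \<sigma> where N: "open N" "x \<in> N" "N \<subseteq> snd c ` fst c" "hol_map N \<sigma>"
    "\<And>y v. y \<in> N \<Longrightarrow> frame t c y v = coframe t (\<sigma> y) (fder \<sigma> y v)"
    using frame_local[OF c] by metis
  have h: "hol_fun N (\<lambda>y. fder \<sigma> y u $ i)" for u i
  proof (rule hol_fun_cong)
    show "hol_fun N (\<lambda>y. fder (\<lambda>y. \<sigma> y $ i) y u)"
      using N(4) by (intro hol_fun_fder_hol) (simp add: hol_map_def)
  qed (simp add: hol_map_fder(3)[OF N(4)])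
  have "hol_fun N (\<lambda>y. det3 (fder \<sigma> y (v 0)) (fder \<sigma> y (v 1)) (fder \<sigma> y (v 2)))"
    unfolding det3_def by (intro hol_fun_add hol_fun_diff hol_fun_mult h)
  then have "hol_fun N (\<lambda>x. vol_form t c x v)"
    by (rule hol_fun_cong) (simp add: vol_form_def N(5) det3_coframe)
  then show "\<exists>T. x \<in> T \<and> T \<subseteq> snd c ` fst c \<and> hol_fun T (\<lambda>x. vol_form t c x v)"
    using N by blast
qed

lemma less_3_cases: "i < 3 \<Longrightarrow> (i::nat) = 0 \<or> i = 1 \<or> i = 2"
  by auto

lemma hol_volume_form_vol_form: "hol_volume_form (fibre t) (vol_form t)"
  unfolding hol_volume_form_def form_on_def
proof (intro conjI ballI allI impI)
  fix c x assume c: "c \<in> atlas (fibre t)" and "x \<in> img c (topspace (mtop (fibre t)))"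
  then have x: "x \<in> snd c ` fst c" by (auto simp: img_def)
  note lin = frame_linear[OF c x]
  show "alternating_form 3 (vol_form t c x)"
    unfolding alternating_form_def
  proof (intro conjI allI impI)
    fix v w :: "nat \<Rightarrow> complex ^ 3" assume "\<forall>i<3. v i = w i"
    then show "vol_form t c x v = vol_form t c x w" by (simp add: vol_form_def)
  next
    fix v :: "nat \<Rightarrow> complex ^ 3" and i :: nat assume "i < 3"
    then show "linear (\<lambda>u. vol_form t c x (v(i := u)))"
      using less_3_cases by (intro linearI; elim less_3_cases[THEN disjE] disjE)
        (auto simp: vol_form_def linear_add[OF lin] linear_cmul[OF lin])
  next
    fix v :: "nat \<Rightarrow> complex ^ 3" and i j :: nat assume "i < 3" "j < 3" and e: "i \<noteq> j \<and> v i = v j"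
    then show "vol_form t c x v = 0"
      using less_3_cases[of i] less_3_cases[of j] by (auto simp: vol_form_def)
  qed
next
  fix c v assume c: "c \<in> atlas (fibre t)"
  have "img c (topspace (mtop (fibre t))) = snd c ` fst c"
    using chart_on_simps(5)[OF fibre_chart_on[OF c]] unfolding img_def by (simp add: inf.absorb1)
  then show "smooth_on (img c (topspace (mtop (fibre t)))) (\<lambda>x. vol_form t c x v)"
    using hol_fun_smooth[OF vol_form_hol[OF c]] by simp
next
  fix c c' p v assume "c \<in> atlas (fibre t)" "c' \<in> atlas (fibre t)"
    "p \<in> fst c \<inter> fst c' \<inter> topspace (mtop (fibre t))"
  then show "vol_form t c (snd c p) v = vol_form t c' (snd c' p) (\<lambda>i. jac c c' p (v i))"
    by (simp add: vol_form_def frame_transition[of c t c'])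
next
  fix c x v and i :: nat and a assume c: "c \<in> atlas (fibre t)" and x: "x \<in> snd c ` fst c" and i: "i < 3"
  show "vol_form t c x (v(i := a *s v i)) = a * vol_form t c x v"
    using less_3_cases[OF i] by (auto simp: vol_form_def frame_smult[OF c x])
next
  fix c v assume c: "c \<in> atlas (fibre t)"
  show "hol_fun (snd c ` fst c) (\<lambda>x. vol_form t c x v)" by (rule vol_form_hol[OF c])
next
  fix c x assume c: "c \<in> atlas (fibre t)" and x: "x \<in> snd c ` fst c"
  have "vol_form t c x (\<lambda>i. if i = 0 then axis 1 1 else if i = 1 then axis 2 1 else axis 3 1) \<noteq> 0"
    using det3_nonzero[OF frame_linear[OF c x] frame_smult[OF c x] frame_eq_0[OF c x]]
    by (simp add: vol_form_def)
  then show "\<exists>v. vol_form t c x v \<noteq> 0" by blast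
qed

lemma hol_trivial_canonical_fibre: "hol_trivial_canonical (fibre t)"
  unfolding hol_trivial_canonical_def using hol_volume_form_vol_form by blast

section \<open>Exterior algebra in low degrees\<close>

text \<open>
  The 24 permutations fall into three classes, the splittings of four arguments into two pairs. The
  eight terms of a class are equal, and the normalisation divides by four.
\<close>

lemma wedge_2_2:
  assumes \<alpha>: "\<And>v. \<alpha> v = a (v 0) (v 1)" and anti: "\<And>x y. a y x = - a x y"
  shows "wedge 2 2 \<alpha> \<alpha> v =
    2 * (a (v 0) (v 1) * a (v 2) (v 3) - a (v 0) (v 2) * a (v 1) (v 3) + a (v 0) (v 3) * a (v 1) (v 2))"
proof -
  define Q where "Q = a (v 0) (v 1) * a (v 2) (v 3) - a (v 0) (v 2) * a (v 1) (v 3) + a (v 0) (v 3) * a (v 1) (v 2)"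
  have S: "{..<2+2::nat} = {0, 1, 2, 3}" by auto
  have f: "finite {1, 2, 3::nat}" "0 \<notin> {1, 2, 3::nat}" "finite {2, 3::nat}" "1 \<notin> {2, 3::nat}" "finite {3::nat}" "2 \<notin> {3::nat}"
    by auto
  have "wedge 2 2 \<alpha> \<alpha> v = (\<Sum>\<sigma> | \<sigma> permutes {0, 1, 2, 3}.
        of_int (sign \<sigma>) * a (v (\<sigma> 0)) (v (\<sigma> 1)) * a (v (\<sigma> 2)) (v (\<sigma> 3))) / 4"
    unfolding wedge_def S \<alpha> by (simp add: numeral_2_eq_2 numeral_3_eq_3)
  also have "(\<Sum>\<sigma> | \<sigma> permutes {0, 1, 2, 3}.
        of_int (sign \<sigma>) * a (v (\<sigma> 0)) (v (\<sigma> 1)) * a (v (\<sigma> 2)) (v (\<sigma> 3))) =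
     8 * Q"
    unfolding Q_def sum_over_permutations_insert[OF f(1,2)] sum_over_permutations_insert[OF f(3,4)]
      sum_over_permutations_insert[OF f(5,6)] permutes_sing
    by (simp add: sign_swap_id permutation_swap_id sign_compose permutation_compose sign_id transpose_apply_other
        Transposition.transpose_def
        anti[of "v 1" "v 0"] anti[of "v 2" "v 0"] anti[of "v 3" "v 0"]
        anti[of "v 2" "v 1"] anti[of "v 3" "v 1"] anti[of "v 3" "v 2"] algebra_simps del: One_nat_def)
  finally have "wedge 2 2 \<alpha> \<alpha> v = 2 * Q" by simp
  then show ?thesis by (simp only: Q_def)
qed

text \<open>
  \<open>Y\<close> and \<open>B\<close> list the values of \<open>x \<and> y \<and> z\<close> and of \<open>x \<and> b\<close> on five vectors, and the sum over
  shuffles is a value of their wedge product, which repeats the factor \<open>x\<close>.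
\<close>

lemma three_one_two_form_repeated:
  fixes x y z b :: "nat \<Rightarrow> 'a::comm_ring_1"
  defines "Y \<equiv> \<lambda>i j k. x i * (y j * z k - y k * z j) - x j * (y i * z k - y k * z i) + x k * (y i * z j - y j * z i)"
  defines "B \<equiv> \<lambda>l m. x l * b m - x m * b l"
  shows "Y 0 1 2 * B 3 4 - Y 0 1 3 * B 2 4 + Y 0 1 4 * B 2 3 + Y 0 2 3 * B 1 4 - Y 0 2 4 * B 1 3
    + Y 0 3 4 * B 1 2 - Y 1 2 3 * B 0 4 + Y 1 2 4 * B 0 3 - Y 1 3 4 * B 0 2 + Y 2 3 4 * B 0 1 = 0"
  unfolding Y_def B_def by (simp only: algebra_simps add_0_left add_0_right)

section \<open>Algebra of the invariant solution\<close>

lemma inner_C3: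
  "inner (u :: complex ^ 3) v = Re (u $ 1 * cnj (v $ 1)) + Re (u $ 2 * cnj (v $ 2)) + Re (u $ 3 * cnj (v $ 3))"
  by (simp add: inner_vec_def sum_3 inner_complex_def)

text \<open>
  The components of a vector of \<open>\<complex>\<^sup>3\<close> are here the values of the three invariant forms on a tangent vector. In these
  terms \<open>mix\<close> is \<open>\<omega>\<^sub>1 \<and> \<omega>\<^sub>2\<close>, that is \<open>- d\<omega>\<^sub>3\<close> for \<open>t = 0\<close>. The functions \<open>fundV\<close>, \<open>dfundV\<close>,
  \<open>torsV\<close> and \<open>dtorsV\<close> are \<open>F\<close>, \<open>dF\<close>, \<open>T\<close> and \<open>dT\<close>: the imaginary and real part of \<open>\<omega>\<^sub>1 \<and> \<omega>\<^sub>2 \<and> \<omega>\<^sub>3\<^sup>*\<close> are \<open>dF\<close> and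
  \<open>T\<close>, and \<open>dT = - \<omega>\<^sub>1 \<and> \<omega>\<^sub>2 \<and> \<omega>\<^sub>1\<^sup>* \<and> \<omega>\<^sub>2\<^sup>*\<close>.
\<close>

definition mix :: "complex ^ 3 \<Rightarrow> complex ^ 3 \<Rightarrow> complex" where
  "mix u v = u $ 1 * v $ 2 - u $ 2 * v $ 1"

definition fundV :: "complex ^ 3 \<Rightarrow> complex ^ 3 \<Rightarrow> real" where
  "fundV u v = inner (\<i> *s u) v"

definition dfundV :: "complex ^ 3 \<Rightarrow> complex ^ 3 \<Rightarrow> complex ^ 3 \<Rightarrow> real" where
  "dfundV u v w = Im (mix u v * cnj (w $ 3) + mix v w * cnj (u $ 3) + mix w u * cnj (v $ 3))"

lemma fundV_eq: "of_real (fundV u v) =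
    (\<i> / 2) * (u $ 1 * cnj (v $ 1) - v $ 1 * cnj (u $ 1)) + (\<i> / 2) * (u $ 2 * cnj (v $ 2) - v $ 2 * cnj (u $ 2))
    + (\<i> / 2) * (u $ 3 * cnj (v $ 3) - v $ 3 * cnj (u $ 3))"
  by (simp add: fundV_def inner_C3 complex_eq_iff field_simps)

lemma Im_eq: "complex_of_real (Im z) = (- \<i> / 2) * z + (\<i> / 2) * cnj z"
  by (simp add: complex_eq_iff)

lemma fundV_anti: "fundV v u = - fundV u v"
  by (simp add: fundV_def inner_C3)

text \<open>
  Each of the products of \<open>\<omega>\<^sub>1 \<and> \<omega>\<^sub>2 \<and> \<omega>\<^sub>3\<^sup>*\<close> or its conjugate with a term \<open>\<omega>\<^sub>k \<and> \<omega>\<^sub>k\<^sup>*\<close> of \<open>F\<close> has a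
  repeated factor.
\<close>

lemma dfundV_wedge_fundV:
  fixes w :: "nat \<Rightarrow> complex ^ 3"
  defines "Z \<equiv> \<lambda>i j k. complex_of_real (dfundV (w i) (w j) (w k))"
  defines "F \<equiv> \<lambda>l m. complex_of_real (fundV (w l) (w m))"
  shows "Z 0 1 2 * F 3 4 - Z 0 1 3 * F 2 4 + Z 0 1 4 * F 2 3 + Z 0 2 3 * F 1 4 - Z 0 2 4 * F 1 3
    + Z 0 3 4 * F 1 2 - Z 1 2 3 * F 0 4 + Z 1 2 4 * F 0 3 - Z 1 3 4 * F 0 2 + Z 2 3 4 * F 0 1 = 0"
proof -
  define x1 x2 x3 y1 y2 y3 where d: "x1 = (\<lambda>i. w i $ 1)" "x2 = (\<lambda>i. w i $ 2)" "x3 = (\<lambda>i. w i $ 3)"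
    "y1 = (\<lambda>i. cnj (w i $ 1))" "y2 = (\<lambda>i. cnj (w i $ 2))" "y3 = (\<lambda>i. cnj (w i $ 3))"
  define Y where "Y = (\<lambda>(x :: nat \<Rightarrow> complex) y z i j k. x i * (y j * z k - y k * z j) - x j * (y i * z k - y k * z i) + x k * (y i * z j - y j * z i))"
  define B where "B = (\<lambda>(x :: nat \<Rightarrow> complex) b l m. x l * b m - x m * b l)"
  define S where "S = (\<lambda>(Y :: nat \<Rightarrow> nat \<Rightarrow> nat \<Rightarrow> complex) (B :: nat \<Rightarrow> nat \<Rightarrow> complex). Y 0 1 2 * B 3 4 - Y 0 1 3 * B 2 4 + Y 0 1 4 * B 2 3 + Y 0 2 3 * B 1 4 - Y 0 2 4 * B 1 3
    + Y 0 3 4 * B 1 2 - Y 1 2 3 * B 0 4 + Y 1 2 4 * B 0 3 - Y 1 3 4 * B 0 2 + Y 2 3 4 * B 0 1)"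
  have Z: "Z = (\<lambda>i j k. (- \<i> / 2) * Y x1 x2 y3 i j k + (\<i> / 2) * Y y1 y2 x3 i j k)"
    unfolding Z_def dfundV_def Im_eq mix_def Y_def d by (simp add: fun_eq_iff algebra_simps)
  have F: "F = (\<lambda>l m. (\<i> / 2) * B x1 y1 l m + (\<i> / 2) * B x2 y2 l m + (\<i> / 2) * B x3 y3 l m)"
    unfolding F_def fundV_eq B_def d by (simp add: fun_eq_iff)
  have r: "S (Y x y z) (B x b) = 0" for x y z b
    using three_one_two_form_repeated[of x y z b] unfolding S_def Y_def B_def by simp
  have c1: "S (Y x y z) (B y b) = 0" for x y z b
  proof -
    have "Y x y z = (\<lambda>i j k. - Y y x z i j k)" by (simp add: Y_def fun_eq_iff algebra_simps)
    then have "S (Y x y z) (B y b) = - S (Y y x z) (B y b)" by (simp add: S_def)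
    then show ?thesis using r by simp
  qed
  have c2: "S (Y x y z) (B b z) = 0" for x y z b
  proof -
    have "Y x y z = (\<lambda>i j k. Y z x y i j k)" by (simp add: Y_def fun_eq_iff algebra_simps)
    moreover have "B b z = (\<lambda>l m. - B z b l m)" by (simp add: B_def fun_eq_iff algebra_simps)
    ultimately have "S (Y x y z) (B b z) = - S (Y z x y) (B z b)" by (simp add: S_def)
    then show ?thesis using r by simp
  qed
  have c3: "S (Y x y z) (B b x) = 0" "S (Y x y z) (B b y) = 0" "S (Y x y z) (B z b) = 0" for x y z b
  proof -
    have e: "S Q (B b a) = - S Q (B a b)" for Q a b
    proof -
      have "B b a = (\<lambda>l m. - B a b l m)" by (simp add: B_def fun_eq_iff algebra_simps)
      then show ?thesis by (simp add: S_def)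
    qed
    show "S (Y x y z) (B b x) = 0" "S (Y x y z) (B b y) = 0" "S (Y x y z) (B z b) = 0"
      using e[of "Y x y z" b x] e[of "Y x y z" b y] e[of "Y x y z" z b] r[of x y z b] c1[of x y z b] c2[of x y z b]
      by simp_all
  qed
  have addl: "S (\<lambda>i j k. p * Q i j k + p' * Q' i j k) R = p * S Q R + p' * S Q' R" for p p' Q Q' R
    unfolding S_def by (simp add: algebra_simps)
  have addr: "S Q (\<lambda>l m. s * R l m + s * R' l m + s * R'' l m) = s * (S Q R + S Q R' + S Q R'')" for s Q R R' R''
    unfolding S_def by (simp add: algebra_simps)
  have "S Z F = 0"
    unfolding Z F addl addr using r c1 c2 c3 by simp
  then show ?thesis by (simp add: S_def)
qed

definition torsV :: "complex ^ 3 \<Rightarrow> complex ^ 3 \<Rightarrow> complex ^ 3 \<Rightarrow> real" where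
  "torsV u v w = Re (mix u v * cnj (w $ 3) + mix v w * cnj (u $ 3) + mix w u * cnj (v $ 3))"

lemma dfundV_J: "dfundV (\<i> *s u) (\<i> *s v) (\<i> *s w) = torsV u v w"
  by (simp add: dfundV_def torsV_def mix_def algebra_simps)

definition dtorsV :: "complex ^ 3 \<Rightarrow> complex ^ 3 \<Rightarrow> complex ^ 3 \<Rightarrow> complex ^ 3 \<Rightarrow> real" where
  "dtorsV u0 u1 u2 u3 = - 2 * Re (mix u0 u1 * cnj (mix u2 u3) - mix u0 u2 * cnj (mix u1 u3) + mix u0 u3 * cnj (mix u1 u2))"

text \<open>
  The connection matrix and the curvature act by the cross product with a real vector, that is, by
  the complexification of the rotation algebra of the real part of the frame.
\<close>

definition crossV :: "real \<Rightarrow> real \<Rightarrow> real \<Rightarrow> complex ^ 3 \<Rightarrow> complex ^ 3" where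
  "crossV a b c w = vector [b * w $ 3 - c * w $ 2, c * w $ 1 - a * w $ 3, a * w $ 2 - b * w $ 1]"

text \<open>
  The weights are 1, 1 and 2. The product of the weights of \<open>e\<^sup>1\<close> and \<open>e\<^sup>3\<close> is the
  coefficient of \<open>e\<^sup>1 \<and> e\<^sup>3\<close> in the quadratic part of the first curvature component; it has to exceed
  the 1 that \<open>Re d\<omega>\<^sub>3\<close> subtracts from that coefficient, for only then the square of this component is
  negative.
\<close>

definition twistV :: "complex ^ 3 \<Rightarrow> complex ^ 3 \<Rightarrow> complex ^ 3" where
  "twistV u w = crossV (Re (u $ 3)) (Re (u $ 1)) (2 * Re (u $ 2)) w"

text \<open>
  The components of the curvature vector. The first is \<open>e\<^sup>1 \<and> e\<^sup>3 + e\<^sup>2 \<and> e\<^sup>4\<close>. The other two are the products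
  \<open>2 e\<^sup>3 \<and> Re \<omega>\<^sub>3\<close> and \<open>Re \<omega>\<^sub>3 \<and> e\<^sup>1\<close>, because \<open>e\<^sup>1\<close> and \<open>e\<^sup>3\<close> are closed.
\<close>

definition kap1 :: "complex ^ 3 \<Rightarrow> complex ^ 3 \<Rightarrow> real" where
  "kap1 u v = Re (u $ 1 * cnj (v $ 2) - u $ 2 * cnj (v $ 1))"
definition kap2 :: "complex ^ 3 \<Rightarrow> complex ^ 3 \<Rightarrow> real" where
  "kap2 u v = 2 * (Re (u $ 2) * Re (v $ 3) - Re (u $ 3) * Re (v $ 2))"
definition kap3 :: "complex ^ 3 \<Rightarrow> complex ^ 3 \<Rightarrow> real" where
  "kap3 u v = Re (u $ 3) * Re (v $ 1) - Re (u $ 1) * Re (v $ 3)"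

definition curvV :: "complex ^ 3 \<Rightarrow> complex ^ 3 \<Rightarrow> complex ^ 3 \<Rightarrow> complex ^ 3" where
  "curvV u v w = crossV (kap1 u v) (kap2 u v) (kap3 u v) w"

lemma crossV_skew: "inner (crossV a b c u) v = - inner (crossV a b c v) u"
  by (simp add: crossV_def inner_C3 algebra_simps)

lemma twistV_skew: "inner (twistV x u) v + inner u (twistV x v) = 0"
  using crossV_skew[of _ _ _ u v] by (simp add: twistV_def inner_commute)

text \<open>
  The vector \<open>c\<close> stands for the exterior derivative of the frame, evaluated on the two vectors. Hence
  the first term is the derivative of the connection form and the left side is its curvature.
\<close>

lemma curvV_structure:
  assumes "c $ 1 = 0" "c $ 2 = 0" "c $ 3 = - mix u v"
  shows "twistV c w + twistV u (twistV v w) - twistV v (twistV u w) = curvV u v w"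
proof -
  have c: "Re (c $ 1) = 0" "Re (c $ 2) = 0" "Re (c $ 3) = - Re (mix u v)" using assms by simp_all
  show ?thesis
    unfolding twistV_def[of c] c
    by (simp add: vec_eq_iff forall_3 twistV_def curvV_def crossV_def kap1_def kap2_def kap3_def mix_def
        complex_eq_iff algebra_simps)
qed

lemma curvV_anti: "curvV v u w = - curvV u v w"
  by (simp add: vec_eq_iff forall_3 curvV_def crossV_def kap1_def kap2_def kap3_def algebra_simps)

text \<open>
  The squares of \<open>kap2\<close> and \<open>kap3\<close> vanish by the Pluecker relation for decomposable two-forms, so only
  \<open>kap1\<close> contributes to the trace.
\<close>

lemma dtorsV_eq_trace:
  "dtorsV u0 u1 u2 u3 = 4 * (
     (kap1 u0 u1 * kap1 u2 u3 + kap2 u0 u1 * kap2 u2 u3 + kap3 u0 u1 * kap3 u2 u3)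
   - (kap1 u0 u2 * kap1 u1 u3 + kap2 u0 u2 * kap2 u1 u3 + kap3 u0 u2 * kap3 u1 u3)
   + (kap1 u0 u3 * kap1 u1 u2 + kap2 u0 u3 * kap2 u1 u2 + kap3 u0 u3 * kap3 u1 u2))"
proof -
  have "kap2 u0 u1 * kap2 u2 u3 - kap2 u0 u2 * kap2 u1 u3 + kap2 u0 u3 * kap2 u1 u2 = 0"
    by (simp add: kap2_def algebra_simps)
  moreover have "kap3 u0 u1 * kap3 u2 u3 - kap3 u0 u2 * kap3 u1 u3 + kap3 u0 u3 * kap3 u1 u2 = 0"
    by (simp add: kap3_def algebra_simps)
  moreover have "dtorsV u0 u1 u2 u3 = 4 * (kap1 u0 u1 * kap1 u2 u3 - kap1 u0 u2 * kap1 u1 u3 + kap1 u0 u3 * kap1 u1 u2)"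
    by (simp add: dtorsV_def kap1_def mix_def algebra_simps)
  ultimately show ?thesis by (simp add: algebra_simps)
qed

definition orthonormal6 :: "(nat \<Rightarrow> complex ^ 3) \<Rightarrow> bool" where
  "orthonormal6 E \<longleftrightarrow> (\<forall>i<6. \<forall>j<6. inner (E i) (E j) = (if i = j then 1 else 0))"

lemma parseval6:
  assumes E: "orthonormal6 E"
  shows "(\<Sum>i<6. inner x (E i) * inner y (E i)) = inner x y"
proof -
  have inj: "inj_on E {..<6}"
    using E unfolding orthonormal6_def inj_on_def by (metis lessThan_iff zero_neq_one)
  let ?B = "E ` {..<6}"
  have card: "card ?B = 6" using card_image[OF inj] by simp
  have pw: "pairwise orthogonal ?B"
    using E unfolding pairwise_def orthogonal_def orthonormal6_def by auto
  have n: "norm b = 1" if "b \<in> ?B" for b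
    using that E unfolding orthonormal6_def by (auto simp: norm_eq_1)
  then have "0 \<notin> ?B" by force
  then have "independent ?B" using pw pairwise_orthogonal_independent by blast
  then have "span ?B = UNIV"
    using card_ge_dim_independent[of ?B UNIV] card by (auto simp: dim_UNIV)
  then have "(\<Sum>b\<in>?B. (x \<bullet> b) *\<^sub>R b) = x"
    using orthonormal_basis_expand[OF pw n, of x] by simp
  then have "(\<Sum>i<6. inner x (E i) *\<^sub>R E i) = x" by (simp add: sum.reindex[OF inj])
  then have "inner x y = inner (\<Sum>i<6. inner x (E i) *\<^sub>R E i) y" by simp
  also have "\<dots> = (\<Sum>i<6. inner x (E i) * inner (E i) y)"
    by (simp only: inner_sum_left inner_scaleR_left)
  finally show ?thesis by (simp only: inner_commute[of y])
qed

definition std6 :: "nat \<Rightarrow> complex ^ 3" where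
  "std6 i = (if i < 3 then axis (of_nat (Suc i)) 1 else axis (of_nat (i - 2)) \<i>)"

lemma sum_lessThan_6: "(\<Sum>i<6. f i) = f 0 + f 1 + f 2 + f 3 + f 4 + (f (5::nat) :: 'a::comm_monoid_add)"
  by (simp add: eval_nat_numeral lessThan_Suc ac_simps)

lemma std6_simps: "std6 0 = axis 1 1" "std6 1 = axis 2 1" "std6 2 = axis 3 1"
  "std6 3 = axis 1 \<i>" "std6 4 = axis 2 \<i>" "std6 5 = axis 3 \<i>"
  by (simp_all add: std6_def)

lemma all_less_6: "(\<forall>i<6. P i) \<longleftrightarrow> P 0 \<and> P 1 \<and> P 2 \<and> P 3 \<and> P 4 \<and> P (5::nat)"
proof -
  have "i < 6 \<longleftrightarrow> i = 0 \<or> i = 1 \<or> i = 2 \<or> i = 3 \<or> i = 4 \<or> i = 5" for i :: nat by arith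
  then show ?thesis by (simp only:) blast
qed

lemma orthonormal6_std6: "orthonormal6 std6"
  unfolding orthonormal6_def all_less_6 std6_simps by (simp add: inner_axis_axis inner_complex_def)

text \<open>
  On \<open>\<complex>\<^sup>3\<close> the cross product consists of two copies of the rotation algebra acting on \<open>\<real>\<^sup>3\<close>, each with
  trace \<open>a a' + b b' + c c'\<close>. Applying Parseval's identity in both indices moves the sum from the
  frame \<open>E\<close> to the standard basis.
\<close>

lemma trace_crossV:
  assumes E: "orthonormal6 E"
  shows "(\<Sum>j<6. \<Sum>i<j. inner (crossV a b c (E j)) (E i) * inner (crossV a' b' c' (E j)) (E i))
    = 2 * (a * a' + b * b' + c * c')"
proof -
  let ?K = "crossV a b c" and ?L = "crossV a' b' c'"
  define q where "q = (\<lambda>i j. inner (?K (E j)) (E i) * inner (?L (E j)) (E i))"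
  have sym: "q i j = q j i" for i j
    unfolding q_def by (subst (1 2) crossV_skew) simp
  have diag: "q i i = 0" for i
    using crossV_skew[of a b c "E i" "E i"] by (simp add: q_def)
  have "(\<Sum>j<6. \<Sum>i<6. q i j) = (\<Sum>j<6. inner (?K (E j)) (?L (E j)))"
    unfolding q_def by (intro sum.cong refl parseval6[OF E])
  also have "\<dots> = (\<Sum>j<6. \<Sum>b<6. inner (?K (E j)) (std6 b) * inner (?L (E j)) (std6 b))"
    by (intro sum.cong refl parseval6[OF orthonormal6_std6, symmetric])
  also have "\<dots> = (\<Sum>b<6. \<Sum>j<6. inner (?K (std6 b)) (E j) * inner (?L (std6 b)) (E j))"
    by (subst sum.swap) (intro sum.cong refl, subst (1 2) crossV_skew, simp)
  also have "\<dots> = (\<Sum>b<6. inner (?K (std6 b)) (?L (std6 b)))"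
    by (intro sum.cong refl parseval6[OF E])
  also have "\<dots> = 4 * (a * a' + b * b' + c * c')"
    unfolding sum_lessThan_6 std6_simps
    by (simp add: inner_C3 crossV_def axis_def algebra_simps)
  finally have "(\<Sum>j<6. \<Sum>i<6. q i j) = 4 * (a * a' + b * b' + c * c')" .
  moreover have "(\<Sum>j<6. \<Sum>i<6. q i j) = 2 * (\<Sum>j<6. \<Sum>i<j. q i j)"
    using diag sym
    by (simp add: eval_nat_numeral lessThan_Suc algebra_simps)
  ultimately show ?thesis by (simp add: q_def)
qed

section \<open>Calculus in a holomorphic Heisenberg coframe\<close>

text \<open>
  The derivative is a choice from the set of all derivatives at the point. The two functions have the same
  derivatives, so the choices agree even when this set is empty.
\<close>

lemma fder_cong:
  assumes "open U" "x \<in> U" "\<And>y. y \<in> U \<Longrightarrow> f y = g y"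
  shows "fder f x = fder g x"
proof -
  have "(f has_derivative D) (at x) \<longleftrightarrow> (g has_derivative D) (at x)" for D
    using has_derivative_transform_within_open[of f D x UNIV U g]
      has_derivative_transform_within_open[of g D x UNIV U f] assms by auto
  then show ?thesis unfolding frechet_derivative_def by simp
qed

lemma ext_deriv_cong:
  assumes "open U" "x \<in> U" "\<And>y v. y \<in> U \<Longrightarrow> \<omega> y v = \<omega>' y v"
  shows "ext_deriv k \<omega> x v = ext_deriv k \<omega>' x v"
  unfolding ext_deriv_def
  by (intro sum.cong refl arg_cong2[where f = "(*)"] fun_cong[OF fder_cong[OF assms(1,2)]] assms(3))

lemma ext_deriv_2:
  "ext_deriv 2 (\<lambda>y v. f y (v 0) (v 1)) x v =
     fder (\<lambda>y. f y (v 1) (v 2)) x (v 0) - fder (\<lambda>y. f y (v 0) (v 2)) x (v 1) + fder (\<lambda>y. f y (v 0) (v 1)) x (v 2)"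
  by (simp add: ext_deriv_def eval_nat_numeral)

lemma ext_deriv_3:
  "ext_deriv 3 (\<lambda>y v. f y (v 0) (v 1) (v 2)) x v =
     fder (\<lambda>y. f y (v 1) (v 2) (v 3)) x (v 0) - fder (\<lambda>y. f y (v 0) (v 2) (v 3)) x (v 1)
     + fder (\<lambda>y. f y (v 0) (v 1) (v 3)) x (v 2) - fder (\<lambda>y. f y (v 0) (v 1) (v 2)) x (v 3)"
  by (simp add: ext_deriv_def eval_nat_numeral)

lemma ext_deriv_4:
  "ext_deriv 4 (\<lambda>y v. f y (v 0) (v 1) (v 2) (v 3)) x v =
     fder (\<lambda>y. f y (v 1) (v 2) (v 3) (v 4)) x (v 0) - fder (\<lambda>y. f y (v 0) (v 2) (v 3) (v 4)) x (v 1)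
     + fder (\<lambda>y. f y (v 0) (v 1) (v 3) (v 4)) x (v 2) - fder (\<lambda>y. f y (v 0) (v 1) (v 2) (v 4)) x (v 3)
     + fder (\<lambda>y. f y (v 0) (v 1) (v 2) (v 3)) x (v 4)"
  by (simp add: ext_deriv_def eval_nat_numeral)

lemma smooth_on_mult:
  fixes f g :: "'a::euclidean_space \<Rightarrow> 'b::real_normed_algebra"
  shows "smooth_on S f \<Longrightarrow> smooth_on S g \<Longrightarrow> smooth_on S (\<lambda>x. f x * g x)"
  by (rule smooth_on_bilinear[OF bounded_bilinear_mult])

lemma smooth_on_diff: "smooth_on S f \<Longrightarrow> smooth_on S g \<Longrightarrow> smooth_on S (\<lambda>x. f x - g x)"
  using smooth_on_add[of S f "\<lambda>x. - g x"] smooth_on_linear[OF bounded_linear_minus[OF bounded_linear_ident], of S g]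
  by simp

lemma smooth_on_of_real_Re: "smooth_on S f \<Longrightarrow> smooth_on S (\<lambda>x. complex_of_real (Re (f x)))"
  by (intro smooth_on_linear[OF bounded_linear_of_real] smooth_on_linear[OF bounded_linear_Re])

lemma twistV_has_derivative:
  assumes "(A has_derivative A') (at x)" "(B has_derivative B') (at x)"
  shows "((\<lambda>y. twistV (A y) (B y)) has_derivative (\<lambda>u. twistV (A' u) (B x) + twistV (A x) (B' u))) (at x)"
proof (rule has_derivative_vec_componentwise)
  fix i :: 3
  have "i = 1 \<or> i = 2 \<or> i = 3" by (rule exhaust_3)
  then show "((\<lambda>y. twistV (A y) (B y) $ i) has_derivative (\<lambda>u. (twistV (A' u) (B x) + twistV (A x) (B' u)) $ i)) (at x)"
    by (elim disjE) (auto simp: twistV_def crossV_def algebra_simps intro!: derivative_eq_intros assms)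
qed

lemma twistV_linear: "linear (twistV u)" "linear (\<lambda>u. twistV u w)" "twistV u (a *s w) = a *s twistV u w"
  by (auto intro!: linearI simp: twistV_def crossV_def vec_eq_iff forall_3 complex_eq_iff algebra_simps)

lemma basis_expansion_3: "(v :: complex ^ 3) = v $ 1 *s axis 1 1 + v $ 2 *s axis 2 1 + v $ 3 *s axis 3 1"
  by (simp add: vec_eq_iff forall_3 axis_def)

text \<open>
  The left side is the exterior derivative of \<open>\<omega>\<^sub>1 \<and> \<omega>\<^sub>2 \<and> \<omega>\<^sub>3\<^sup>*\<close>. The arrays \<open>p\<close>, \<open>q\<close> and \<open>s\<close> are the
  derivatives of the three factors. The first two factors being closed, \<open>p\<close> and \<open>q\<close> are symmetric and cancel;
  what remains of \<open>s\<close> is its antisymmetric part \<open>n\<close>, minus the exterior derivative of \<open>\<omega>\<^sub>3\<^sup>*\<close>.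
\<close>

lemma torsion_algebra:
  fixes p q s n :: "nat \<Rightarrow> nat \<Rightarrow> complex" and x y z :: "nat \<Rightarrow> complex"
  assumes p: "\<And>i j. p j i = p i j" and q: "\<And>i j. q j i = q i j" and s: "\<And>i j. s j i = s i j + n i j"
  shows
   "(((p 0 1 * y 2 - q 0 1 * x 2) * z 3 + (x 2 * y 3 - y 2 * x 3) * s 0 1 + (x 3 * q 0 1 - y 3 * p 0 1) * z 2)
      + ((x 1 * q 0 2 - y 1 * p 0 2) * z 3 + (p 0 2 * y 3 - q 0 2 * x 3) * z 1 + (x 3 * y 1 - y 3 * x 1) * s 0 2)
      + ((x 1 * y 2 - y 1 * x 2) * s 0 3 + (x 2 * q 0 3 - y 2 * p 0 3) * z 1 + (p 0 3 * y 1 - q 0 3 * x 1) * z 2))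
    - (((p 1 0 * y 2 - q 1 0 * x 2) * z 3 + (x 2 * y 3 - y 2 * x 3) * s 1 0 + (x 3 * q 1 0 - y 3 * p 1 0) * z 2)
      + ((x 0 * q 1 2 - y 0 * p 1 2) * z 3 + (p 1 2 * y 3 - q 1 2 * x 3) * z 0 + (x 3 * y 0 - y 3 * x 0) * s 1 2)
      + ((x 0 * y 2 - y 0 * x 2) * s 1 3 + (x 2 * q 1 3 - y 2 * p 1 3) * z 0 + (p 1 3 * y 0 - q 1 3 * x 0) * z 2))
    + (((p 2 0 * y 1 - q 2 0 * x 1) * z 3 + (x 1 * y 3 - y 1 * x 3) * s 2 0 + (x 3 * q 2 0 - y 3 * p 2 0) * z 1)
      + ((x 0 * q 2 1 - y 0 * p 2 1) * z 3 + (p 2 1 * y 3 - q 2 1 * x 3) * z 0 + (x 3 * y 0 - y 3 * x 0) * s 2 1)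
      + ((x 0 * y 1 - y 0 * x 1) * s 2 3 + (x 1 * q 2 3 - y 1 * p 2 3) * z 0 + (p 2 3 * y 0 - q 2 3 * x 0) * z 1))
    - (((p 3 0 * y 1 - q 3 0 * x 1) * z 2 + (x 1 * y 2 - y 1 * x 2) * s 3 0 + (x 2 * q 3 0 - y 2 * p 3 0) * z 1)
      + ((x 0 * q 3 1 - y 0 * p 3 1) * z 2 + (p 3 1 * y 2 - q 3 1 * x 2) * z 0 + (x 2 * y 0 - y 2 * x 0) * s 3 1)
      + ((x 0 * y 1 - y 0 * x 1) * s 3 2 + (x 1 * q 3 2 - y 1 * p 3 2) * z 0 + (p 3 2 * y 0 - q 3 2 * x 0) * z 1))
    = - ((x 0 * y 1 - y 0 * x 1) * n 2 3 - (x 0 * y 2 - y 0 * x 2) * n 1 3 + (x 0 * y 3 - y 0 * x 3) * n 1 2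
       + (x 1 * y 2 - y 1 * x 2) * n 0 3 - (x 1 * y 3 - y 1 * x 3) * n 0 2 + (x 2 * y 3 - y 2 * x 3) * n 0 1)"
  unfolding p[of 1 0] p[of 2 0] p[of 3 0] p[of 2 1] p[of 3 1] p[of 3 2]
    q[of 1 0] q[of 2 0] q[of 3 0] q[of 2 1] q[of 3 1] q[of 3 2]
    s[of 1 0] s[of 2 0] s[of 3 0] s[of 2 1] s[of 3 1] s[of 3 2]
  by (simp add: algebra_simps del: One_nat_def)

text \<open>
  The coframe of the Iwasawa manifold in a chart, described by its structure equations \<open>d\<omega>\<^sub>1 = d\<omega>\<^sub>2 = 0\<close>
  and \<open>d\<omega>\<^sub>3 = - \<omega>\<^sub>1 \<and> \<omega>\<^sub>2\<close>. They determine every local quantity of the solution, which can thus be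
  computed without choosing coordinates adapted to the frame.
\<close>

locale heis_frame =
  fixes U :: "(complex ^ 3) set" and W :: "complex ^ 3 \<Rightarrow> complex ^ 3 \<Rightarrow> complex ^ 3"
  assumes U: "open U"
    and W_linear: "x \<in> U \<Longrightarrow> linear (W x)"
    and W_smult: "x \<in> U \<Longrightarrow> W x (a *s v) = a *s W x v"
    and W_eq_0: "x \<in> U \<Longrightarrow> W x v = 0 \<Longrightarrow> v = 0"
    and W_hol: "hol_map U (\<lambda>x. W x v)"
    and closed_1: "x \<in> U \<Longrightarrow> fder (\<lambda>y. W y v) x u $ 1 = fder (\<lambda>y. W y u) x v $ 1"
    and closed_2: "x \<in> U \<Longrightarrow> fder (\<lambda>y. W y v) x u $ 2 = fder (\<lambda>y. W y u) x v $ 2"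
    and structure_3: "x \<in> U \<Longrightarrow> fder (\<lambda>y. W y v) x u $ 3 - fder (\<lambda>y. W y u) x v $ 3 = - mix (W x u) (W x v)"
begin

definition dW :: "complex ^ 3 \<Rightarrow> complex ^ 3 \<Rightarrow> complex ^ 3 \<Rightarrow> complex ^ 3" where
  "dW x u v = fder (\<lambda>y. W y v) x u"

lemma dW: "x \<in> U \<Longrightarrow> ((\<lambda>y. W y v) has_derivative (\<lambda>u. dW x u v)) (at x)"
  using hol_map_fder(1)[OF W_hol] by (simp add: dW_def[abs_def])

lemma dW_swap:
  assumes "x \<in> U"
  shows "dW x u v $ 1 = dW x v u $ 1" "dW x u v $ 2 = dW x v u $ 2"
    "dW x u v $ 3 = dW x v u $ 3 - mix (W x u) (W x v)"
  using closed_1[OF assms] closed_2[OF assms] structure_3[OF assms, of v u]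
  by (simp_all add: dW_def algebra_simps)

lemma fundV_deriv:
  assumes x: "x \<in> U"
  shows "((\<lambda>y. complex_of_real (fundV (W y a) (W y b))) has_derivative
    (\<lambda>u. of_real (fundV (dW x u a) (W x b) + fundV (W x a) (dW x u b)))) (at x)"
  unfolding fundV_def
  by (rule has_derivative_of_real) (auto intro!: derivative_eq_intros dW[OF x])

text \<open>
  In the alternating sum the symmetric parts of the derivatives of the frame cancel, and the
  structure equations give the remaining terms.
\<close>

lemma fundV_closed_formula:
  assumes x: "x \<in> U"
  shows "fundV (dW x a b) (W x c) + fundV (W x b) (dW x a c) - (fundV (dW x b a) (W x c) + fundV (W x a) (dW x b c))
    + (fundV (dW x c a) (W x b) + fundV (W x a) (dW x c b)) = dfundV (W x a) (W x b) (W x c)"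
  unfolding fundV_def inner_C3 dfundV_def
    dW_swap(1)[OF x, of b a] dW_swap(2)[OF x, of b a] dW_swap(3)[OF x, of b a]
    dW_swap(1)[OF x, of c a] dW_swap(2)[OF x, of c a] dW_swap(3)[OF x, of c a]
    dW_swap(1)[OF x, of c b] dW_swap(2)[OF x, of c b] dW_swap(3)[OF x, of c b] vector_smult_component
  by (simp add: mix_def algebra_simps)

lemma ext_deriv_fund:
  assumes x: "x \<in> U"
  shows "ext_deriv 2 (\<lambda>y v. of_real (fundV (W y (v 0)) (W y (v 1)))) x v =
    of_real (dfundV (W x (v 0)) (W x (v 1)) (W x (v 2)))"
  unfolding ext_deriv_2[of "\<lambda>y a b. of_real (fundV (W y a) (W y b))"] fder_eq[OF fundV_deriv[OF x]]
    fundV_closed_formula[OF x, symmetric] by simp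

lemma torsV_deriv:
  assumes x: "x \<in> U"
  shows "((\<lambda>y. complex_of_real (torsV (W y a) (W y b) (W y c))) has_derivative
    (\<lambda>u. of_real (torsV (dW x u a) (W x b) (W x c) + torsV (W x a) (dW x u b) (W x c) + torsV (W x a) (W x b) (dW x u c)))) (at x)"
  unfolding torsV_def mix_def
  by (rule has_derivative_of_real, (rule derivative_eq_intros dW[OF x] refl)+)
     (simp add: algebra_simps fun_eq_iff)

lemma torsV_closed_formula:
  assumes x: "x \<in> U"
  defines "D \<equiv> \<lambda>u a b c. torsV (dW x u a) (W x b) (W x c) + torsV (W x a) (dW x u b) (W x c) + torsV (W x a) (W x b) (dW x u c)"
  shows "D a b c d - D b a c d + D c a b d - D d a b c = dtorsV (W x a) (W x b) (W x c) (W x d)"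
proof -
  define v where "v = (\<lambda>i::nat. if i = 0 then a else if i = 1 then b else if i = 2 then c else d)"
  have v: "v 0 = a" "v 1 = b" "v 2 = c" "v 3 = d" by (simp_all add: v_def)
  have sw: "dW x (v j) (v i) $ 1 = dW x (v i) (v j) $ 1" "dW x (v j) (v i) $ 2 = dW x (v i) (v j) $ 2"
    "cnj (dW x (v j) (v i) $ 3) = cnj (dW x (v i) (v j) $ 3) + cnj (mix (W x (v i)) (W x (v j)))" for i j
    using dW_swap[OF x, of "v i" "v j"] by simp_all
  note alg = torsion_algebra[where p = "\<lambda>i j. dW x (v i) (v j) $ 1" and q = "\<lambda>i j. dW x (v i) (v j) $ 2"
      and s = "\<lambda>i j. cnj (dW x (v i) (v j) $ 3)" and n = "\<lambda>i j. cnj (mix (W x (v i)) (W x (v j)))"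
      and x = "\<lambda>i. W x (v i) $ 1" and y = "\<lambda>i. W x (v i) $ 2" and z = "\<lambda>i. cnj (W x (v i) $ 3)",
      OF sw, unfolded v]
  have Re6: "Re (- (m01 * cnj m23 - m02 * cnj m13 + m03 * cnj m12 + m12 * cnj m03 - m13 * cnj m02 + m23 * cnj m01))
    = - 2 * Re (m01 * cnj m23 - m02 * cnj m13 + m03 * cnj m12)" for m01 m23 m02 m13 m03 m12
    by (simp add: algebra_simps)
  show ?thesis
    unfolding D_def torsV_def dtorsV_def Re6[symmetric] minus_complex.sel[symmetric] plus_complex.sel[symmetric]
    using alg by (intro arg_cong[where f = Re]) (simp only: mix_def)
qed

lemma ext_deriv_tors:
  assumes x: "x \<in> U"
  shows "ext_deriv 3 (\<lambda>y v. of_real (torsV (W y (v 0)) (W y (v 1)) (W y (v 2)))) x v =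
    of_real (dtorsV (W x (v 0)) (W x (v 1)) (W x (v 2)) (W x (v 3)))"
  unfolding ext_deriv_3[of "\<lambda>y a b c. of_real (torsV (W y a) (W y b) (W y c))"] fder_eq[OF torsV_deriv[OF x]]
    torsV_closed_formula[OF x, symmetric] by simp

text \<open>
  The product rule gives \<open>2 dF \<and> F\<close>, which vanishes by \<open>dfundV_wedge_fundV\<close>.
\<close>

lemma fund_square_closed:
  assumes x: "x \<in> U"
  defines "F \<equiv> \<lambda>y a b. complex_of_real (fundV (W y a) (W y b))"
  shows "ext_deriv 4 (\<lambda>y v. 2 * (F y (v 0) (v 1) * F y (v 2) (v 3) - F y (v 0) (v 2) * F y (v 1) (v 3)
    + F y (v 0) (v 3) * F y (v 1) (v 2))) x v = 0"
proof -
  define D where "D = (\<lambda>u a b. complex_of_real (fundV (dW x u a) (W x b) + fundV (W x a) (dW x u b)))"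
  define f where "f = F x"
  define Q where "Q = (\<lambda>y a b c d. 2 * (F y a b * F y c d - F y a c * F y b d + F y a d * F y b c))"
  have dF: "((\<lambda>y. F y a b) has_derivative (\<lambda>u. D u a b)) (at x)" for a b
    unfolding F_def D_def by (rule fundV_deriv[OF x])
  have dQ: "((\<lambda>y. Q y a b c d) has_derivative (\<lambda>u. 2 * (D u a b * f c d + f a b * D u c d
      - (D u a c * f b d + f a c * D u b d) + (D u a d * f b c + f a d * D u b c)))) (at x)" for a b c d
    unfolding Q_def f_def
    by ((rule derivative_eq_intros dF refl)+) (simp add: algebra_simps fun_eq_iff)
  define w where "w = (\<lambda>i. W x (v i))"
  define Z where "Z = (\<lambda>i j k. complex_of_real (dfundV (w i) (w j) (w k)))"
  have Z: "Z i j k = D (v i) (v j) (v k) - D (v j) (v i) (v k) + D (v k) (v i) (v j)" for i j k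
    unfolding Z_def w_def fundV_closed_formula[OF x, symmetric] D_def by simp
  define G where "G = (\<lambda>i j. complex_of_real (fundV (w i) (w j)))"
  have G: "G i j = f (v i) (v j)" for i j by (simp add: G_def w_def f_def F_def)
  have "ext_deriv 4 (\<lambda>y v. Q y (v 0) (v 1) (v 2) (v 3)) x v =
     2 * (Z 0 1 2 * G 3 4 - Z 0 1 3 * G 2 4 + Z 0 1 4 * G 2 3 + Z 0 2 3 * G 1 4 - Z 0 2 4 * G 1 3
    + Z 0 3 4 * G 1 2 - Z 1 2 3 * G 0 4 + Z 1 2 4 * G 0 3 - Z 1 3 4 * G 0 2 + Z 2 3 4 * G 0 1)"
    unfolding ext_deriv_4 fder_eq[OF dQ] Z G by (simp add: algebra_simps del: One_nat_def)
  also have "\<dots> = 0"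
    using dfundV_wedge_fundV[of w] by (simp add: Z_def G_def)
  finally show ?thesis by (simp add: Q_def)
qed

lemma W_inj: "x \<in> U \<Longrightarrow> inj (W x)"
  by (subst linear_injective_0[OF W_linear]) (simp, intro allI impI, rule W_eq_0)

lemma W_inv [simp]: "x \<in> U \<Longrightarrow> W x (inv (W x) \<xi>) = \<xi>" "x \<in> U \<Longrightarrow> inv (W x) (W x v) = v"
  by (simp_all add: surj_f_inv_f linear_injective_imp_surjective W_linear W_inj)

lemma inv_linear: "x \<in> U \<Longrightarrow> linear (inv (W x))"
  by (rule linearI) (metis W_inv linear_add[OF W_linear], metis W_inv linear_cmul[OF W_linear])

lemma inv_smult: "x \<in> U \<Longrightarrow> inv (W x) (a *s \<xi>) = a *s inv (W x) \<xi>"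
  by (metis W_inv W_smult)

lemma W_det_nonzero: "x \<in> U \<Longrightarrow> det3 (W x (axis 1 1)) (W x (axis 2 1)) (W x (axis 3 1)) \<noteq> 0"
  using det3_nonzero W_linear W_smult W_eq_0 by blast

lemma W_expand: "x \<in> U \<Longrightarrow> W x v = v $ 1 *s W x (axis 1 1) + v $ 2 *s W x (axis 2 1) + v $ 3 *s W x (axis 3 1)"
  by (subst basis_expansion_3) (simp add: linear_add[OF W_linear] W_smult)

text \<open>
  Cramer's rule expresses the inverse of the frame by determinants of holomorphic functions.
\<close>

lemma inv_hol: "hol_map U (\<lambda>x. inv (W x) \<xi>)"
proof -
  let ?b = "\<lambda>x i. W x (axis i 1)"
  let ?d = "\<lambda>x. det3 (?b x 1) (?b x 2) (?b x 3)"
  have h: "hol_fun U (\<lambda>x. W x v $ i)" for v i using W_hol by (simp add: hol_map_def)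
  have hd: "hol_fun U (\<lambda>x. det3 (A x) (B x) (C x))"
    if "\<And>i. hol_fun U (\<lambda>x. A x $ i)" "\<And>i. hol_fun U (\<lambda>x. B x $ i)" "\<And>i. hol_fun U (\<lambda>x. C x $ i)" for A B C
    unfolding det3_def by (intro hol_fun_add hol_fun_diff hol_fun_mult that)
  have \<xi>: "hol_fun U (\<lambda>x. \<xi> $ i)" for i using U by (rule hol_fun_const)
  have e: "\<xi> = inv (W x) \<xi> $ 1 *s ?b x 1 + inv (W x) \<xi> $ 2 *s ?b x 2 + inv (W x) \<xi> $ 3 *s ?b x 3" if "x \<in> U" for x
    using W_expand[OF that, of "inv (W x) \<xi>"] that by simp
  have quot: "hol_fun U (\<lambda>x. inv (W x) \<xi> $ i)"
    if n: "hol_fun U n" "\<And>x. x \<in> U \<Longrightarrow> n x = inv (W x) \<xi> $ i * ?d x" for n i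
  proof (rule hol_fun_cong)
    show "hol_fun U (\<lambda>x. n x / ?d x)" by (intro hol_fun_divide n hd h W_det_nonzero)
  qed (use n(2) W_det_nonzero in simp)
  have "hol_fun U (\<lambda>x. inv (W x) \<xi> $ 1)"
  proof (rule quot)
    show "hol_fun U (\<lambda>x. det3 \<xi> (?b x 2) (?b x 3))" by (intro hd h \<xi>)
    show "det3 \<xi> (?b x 2) (?b x 3) = inv (W x) \<xi> $ 1 * ?d x" if "x \<in> U" for x
      by (subst e[OF that]) simp
  qed
  moreover have "hol_fun U (\<lambda>x. inv (W x) \<xi> $ 2)"
  proof (rule quot)
    show "hol_fun U (\<lambda>x. det3 (?b x 1) \<xi> (?b x 3))" by (intro hd h \<xi>)
    show "det3 (?b x 1) \<xi> (?b x 3) = inv (W x) \<xi> $ 2 * ?d x" if "x \<in> U" for x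
      by (subst e[OF that]) simp
  qed
  moreover have "hol_fun U (\<lambda>x. inv (W x) \<xi> $ 3)"
  proof (rule quot)
    show "hol_fun U (\<lambda>x. det3 (?b x 1) (?b x 2) \<xi>)" by (intro hd h \<xi>)
    show "det3 (?b x 1) (?b x 2) \<xi> = inv (W x) \<xi> $ 3 * ?d x" if "x \<in> U" for x
      by (subst e[OF that]) simp
  qed
  ultimately show ?thesis unfolding hol_map_def forall_3 by blast
qed

text \<open>
  The coordinate expression of the connection whose form in the frame is \<open>twistV\<close>: the covariant
  derivative of a constant vector field \<open>w\<close>, which the frame maps to the function \<open>W x w\<close>.
\<close>

definition gam :: "complex ^ 3 \<Rightarrow> complex ^ 3 \<Rightarrow> complex ^ 3 \<Rightarrow> complex ^ 3" where
  "gam x u w = inv (W x) (dW x u w + twistV (W x u) (W x w))"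

lemma W_gam: "x \<in> U \<Longrightarrow> W x (gam x u w) = dW x u w + twistV (W x u) (W x w)"
  by (simp add: gam_def)

lemma dW_linear_right:
  assumes x: "x \<in> U"
  shows "linear (dW x u)" "dW x u (a *s v) = a *s dW x u v" "linear (\<lambda>u. dW x u v)"
proof -
  have "dW x u (v + v') = dW x u v + dW x u v'" for v v'
  proof -
    have "((\<lambda>y. W y (v + v')) has_derivative (\<lambda>u. dW x u v + dW x u v')) (at x)"
      by (rule has_derivative_transform_within_open[OF has_derivative_add[OF dW[OF x] dW[OF x]] U x])
         (simp add: linear_add[OF W_linear])
    from fun_cong[OF fder_eq[OF this], of u] show ?thesis by (simp add: dW_def)
  qed
  moreover have "dW x u (r *\<^sub>R v) = r *\<^sub>R dW x u v" for r v
  proof -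
    have "((\<lambda>y. W y (r *\<^sub>R v)) has_derivative (\<lambda>u. r *\<^sub>R dW x u v)) (at x)"
      by (rule has_derivative_transform_within_open[OF has_derivative_scaleR_right[OF dW[OF x]] U x])
         (simp add: linear_cmul[OF W_linear])
    from fun_cong[OF fder_eq[OF this], of u] show ?thesis by (simp add: dW_def)
  qed
  ultimately show "linear (dW x u)" by (rule linearI)
  have "((\<lambda>y. W y (a *s v)) has_derivative (\<lambda>u. a *s dW x u v)) (at x)"
    by (rule has_derivative_transform_within_open[OF
          bounded_linear.has_derivative[OF bounded_bilinear.bounded_linear_right[OF bounded_bilinear_smult] dW[OF x]] U x])
       (simp add: W_smult)
  from fun_cong[OF fder_eq[OF this], of u] show "dW x u (a *s v) = a *s dW x u v" by (simp add: dW_def)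
  show "linear (\<lambda>u. dW x u v)" using dW[OF x] has_derivative_linear by blast
qed

text \<open>
  The map \<open>\<phi>\<close> is the identity in the computation of the curvature and a change of charts in the
  transformation law of the connection.
\<close>

lemma W_apply_has_derivative:
  assumes I: "open I" "x \<in> I" and \<phi>: "(\<phi> has_derivative \<phi>') (at x)" "\<And>y. y \<in> I \<Longrightarrow> \<phi> y \<in> U"
    and h: "(h has_derivative h') (at x)"
  shows "((\<lambda>y. W (\<phi> y) (h y)) has_derivative (\<lambda>u. dW (\<phi> x) (\<phi>' u) (h x) + W (\<phi> x) (h' u))) (at x)"
proof -
  let ?b = "\<lambda>i. axis i 1 :: complex ^ 3"
  have x: "\<phi> x \<in> U" using I \<phi>(2) by blast
  have W\<phi>: "((\<lambda>y. W (\<phi> y) v) has_derivative (\<lambda>u. dW (\<phi> x) (\<phi>' u) v)) (at x)" for v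
    using has_derivative_compose[OF \<phi>(1) dW[OF x]] .
  have "((\<lambda>y. h y $ 1 *s W (\<phi> y) (?b 1) + h y $ 2 *s W (\<phi> y) (?b 2) + h y $ 3 *s W (\<phi> y) (?b 3)) has_derivative
     (\<lambda>u. (h x $ 1 *s dW (\<phi> x) (\<phi>' u) (?b 1) + h' u $ 1 *s W (\<phi> x) (?b 1))
        + (h x $ 2 *s dW (\<phi> x) (\<phi>' u) (?b 2) + h' u $ 2 *s W (\<phi> x) (?b 2))
        + (h x $ 3 *s dW (\<phi> x) (\<phi>' u) (?b 3) + h' u $ 3 *s W (\<phi> x) (?b 3)))) (at x)"
    by (intro has_derivative_add has_derivative_smult has_derivative_vec_nth h W\<phi>)
  then have "((\<lambda>y. W (\<phi> y) (h y)) has_derivative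
     (\<lambda>u. (h x $ 1 *s dW (\<phi> x) (\<phi>' u) (?b 1) + h' u $ 1 *s W (\<phi> x) (?b 1))
        + (h x $ 2 *s dW (\<phi> x) (\<phi>' u) (?b 2) + h' u $ 2 *s W (\<phi> x) (?b 2))
        + (h x $ 3 *s dW (\<phi> x) (\<phi>' u) (?b 3) + h' u $ 3 *s W (\<phi> x) (?b 3)))) (at x)"
    by (rule has_derivative_transform_within_open[OF _ I]) (simp add: W_expand[OF \<phi>(2), symmetric])
  moreover have "dW (\<phi> x) u (h x) = h x $ 1 *s dW (\<phi> x) u (?b 1) + h x $ 2 *s dW (\<phi> x) u (?b 2) + h x $ 3 *s dW (\<phi> x) u (?b 3)" for u
    by (subst basis_expansion_3[of "h x"]) (simp only: linear_add[OF dW_linear_right(1)[OF x]] dW_linear_right(2)[OF x])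
  ultimately show ?thesis
    by (simp only: W_expand[OF x, of "h' u" for u] add_ac)
qed

lemma gam_bilinear: "x \<in> U \<Longrightarrow> bilinear (gam x)"
  unfolding bilinear_def
proof (intro conjI allI)
  fix u assume x: "x \<in> U"
  note l = linear_compose[OF _ inv_linear[OF x], unfolded o_def]
  show "linear (\<lambda>w. gam x u w)"
    unfolding gam_def
    by (intro l linear_compose_add dW_linear_right[OF x] linear_compose[OF W_linear[OF x] twistV_linear(1), unfolded o_def])
  show "linear (\<lambda>w. gam x w u)"
    unfolding gam_def
    by (intro l linear_compose_add dW_linear_right[OF x] linear_compose[OF W_linear[OF x] twistV_linear(2), unfolded o_def])
qed

lemma W_smooth: "smooth_on U (\<lambda>x. W x v $ i)" and dW_smooth: "smooth_on U (\<lambda>x. dW x u v $ i)"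
proof -
  have h: "hol_fun U (\<lambda>x. W x v $ i)" for v i using W_hol by (simp add: hol_map_def)
  show "smooth_on U (\<lambda>x. W x v $ i)" by (rule hol_fun_smooth[OF h])
  show "smooth_on U (\<lambda>x. dW x u v $ i)"
    by (rule smooth_on_cong[OF hol_fun_smooth[OF hol_fun_fder_hol[OF h[of v i], of u]]])
       (simp add: dW_def hol_map_fder(3)[OF W_hol])
qed

lemma gam_smooth: "smooth_on U (\<lambda>x. gam x u w)"
proof -
  define s where "s = (\<lambda>x. dW x u w + twistV (W x u) (W x w))"
  have s: "smooth_on U (\<lambda>x. s x $ i)" for i
  proof -
    have "i = 1 \<or> i = 2 \<or> i = 3" by (rule exhaust_3)
    then have "smooth_on U (\<lambda>x. twistV (W x u) (W x w) $ i)"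
      by (elim disjE)
         (auto simp: twistV_def crossV_def mult.assoc intro!: smooth_on_diff smooth_on_mult smooth_on_of_real_Re smooth_on_const U W_smooth)
    then show ?thesis unfolding s_def vector_add_component by (intro smooth_on_add dW_smooth)
  qed
  have i: "smooth_on U (\<lambda>x. inv (W x) \<xi>)" for \<xi>
    using inv_hol unfolding hol_map_def by (intro smooth_on_vec U hol_fun_smooth) blast
  have "smooth_on U (\<lambda>x. s x $ 1 *s inv (W x) (axis 1 1) + s x $ 2 *s inv (W x) (axis 2 1) + s x $ 3 *s inv (W x) (axis 3 1))"
    by (intro smooth_on_add smooth_on_bilinear[OF bounded_bilinear_smult] s i)
  then show ?thesis
  proof (rule smooth_on_cong)
    fix x assume x: "x \<in> U"
    have "inv (W x) (s x) = inv (W x) (s x $ 1 *s axis 1 1 + s x $ 2 *s axis 2 1 + s x $ 3 *s axis 3 1)"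
      by (subst basis_expansion_3[of "s x"]) simp
    moreover have "gam x u w = inv (W x) (s x)" by (simp only: gam_def s_def)
    ultimately show "s x $ 1 *s inv (W x) (axis 1 1) + s x $ 2 *s inv (W x) (axis 2 1) + s x $ 3 *s inv (W x) (axis 3 1) = gam x u w"
      by (simp only: linear_add[OF inv_linear[OF x]] inv_smult[OF x])
  qed
qed

lemma gam_metric:
  assumes x: "x \<in> U"
  shows "fder (\<lambda>y. inner (W y v) (W y w)) x u = inner (W x (gam x u v)) (W x w) + inner (W x v) (W x (gam x u w))"
proof -
  have "((\<lambda>y. inner (W y v) (W y w)) has_derivative (\<lambda>u. inner (W x v) (dW x u w) + inner (dW x u v) (W x w))) (at x)"
    by (auto intro!: derivative_eq_intros dW[OF x])
  from fder_eq[OF this] show ?thesis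
    using twistV_skew[of "W x u" "W x v" "W x w"] by (simp add: W_gam[OF x] inner_add_left inner_add_right)
qed

lemma ddW_sym:
  assumes x: "x \<in> U"
  shows "fder (\<lambda>y. dW y v w) x u = fder (\<lambda>y. dW y u w) x v"
    "((\<lambda>y. dW y v w) has_derivative fder (\<lambda>y. dW y v w) x) (at x)"
proof -
  have h: "hol_fun U (\<lambda>x. W x w $ i)" for i using W_hol by (simp add: hol_map_def)
  have c: "dW y v w $ i = fder (\<lambda>x. W x w $ i) y v" if "y \<in> U" for y v i
    using hol_map_fder(3)[OF W_hol that] by (simp add: dW_def)
  have m: "hol_map U (\<lambda>y. dW y v w)" for v
    unfolding hol_map_def using hol_fun_cong[OF hol_fun_fder_hol[OF h]] c by simp
  show "((\<lambda>y. dW y v w) has_derivative fder (\<lambda>y. dW y v w) x) (at x)"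
    by (rule hol_map_fder(1)[OF m x])
  have e: "fder (\<lambda>y. dW y v w) x u $ i = fder (\<lambda>y. fder (\<lambda>x. W x w $ i) y v) x u" for v u i
    unfolding hol_map_fder(3)[OF m x] by (rule fun_cong[OF fder_cong[OF U x c]])
  show "fder (\<lambda>y. dW y v w) x u = fder (\<lambda>y. dW y u w) x v"
    unfolding vec_eq_iff e using hol_fun_fder_sym[OF h x] by blast
qed

text \<open>
  In the frame the connection form has constant coefficients, so its curvature is an
  algebraic expression. Differentiating the identity for \<open>W (gam (v, w))\<close> avoids differentiating
  the inverse of the frame.
\<close>

lemma gam_curvature:
  assumes x: "x \<in> U"
  shows "W x (fder (\<lambda>y. gam y v w) x u - fder (\<lambda>y. gam y u w) x v + gam x u (gam x v w) - gam x v (gam x u w))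
    = curvV (W x u) (W x v) (W x w)"
proof -
  have key: "W x (fder (\<lambda>y. gam y v w) x u) = fder (\<lambda>y. dW y v w) x u
     + twistV (dW x u v) (W x w) + twistV (W x v) (dW x u w) - dW x u (gam x v w)" for u v
  proof -
    define h where "h = (\<lambda>y. gam y v w)"
    have dh: "(h has_derivative fder h x) (at x)"
      using smooth_on_differentiable[OF gam_smooth x] by (simp add: h_def)
    have 1: "((\<lambda>y. W y (h y)) has_derivative (\<lambda>u. dW x u (h x) + W x (fder h x u))) (at x)"
      by (rule W_apply_has_derivative[OF U x has_derivative_ident _ dh])
    have "((\<lambda>y. dW y v w + twistV (W y v) (W y w)) has_derivative
       (\<lambda>u. fder (\<lambda>y. dW y v w) x u + (twistV (dW x u v) (W x w) + twistV (W x v) (dW x u w)))) (at x)"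
      by (intro has_derivative_add ddW_sym(2)[OF x] twistV_has_derivative dW[OF x])
    then have 2: "((\<lambda>y. W y (h y)) has_derivative
       (\<lambda>u. fder (\<lambda>y. dW y v w) x u + (twistV (dW x u v) (W x w) + twistV (W x v) (dW x u w)))) (at x)"
      by (rule has_derivative_transform_within_open[OF _ U x]) (simp add: h_def W_gam)
    have "dW x u (h x) + W x (fder h x u)
        = fder (\<lambda>y. dW y v w) x u + (twistV (dW x u v) (W x w) + twistV (W x v) (dW x u w))"
      using fun_cong[OF has_derivative_unique[OF 1 2], of u] .
    then show ?thesis by (simp add: h_def algebra_simps)
  qed
  have d: "(dW x u v - dW x v u) $ 1 = 0" "(dW x u v - dW x v u) $ 2 = 0"
    "(dW x u v - dW x v u) $ 3 = - mix (W x u) (W x v)"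
    using dW_swap[OF x, of u v] by simp_all
  have str: "twistV (dW x u v) (W x w) - twistV (dW x v u) (W x w)
      + twistV (W x u) (twistV (W x v) (W x w)) - twistV (W x v) (twistV (W x u) (W x w)) = curvV (W x u) (W x v) (W x w)"
    using curvV_structure[OF d, of "W x w"] by (simp only: linear_diff[OF twistV_linear(2)])
  show ?thesis
    unfolding linear_add[OF W_linear[OF x]] linear_diff[OF W_linear[OF x]] key W_gam[OF x] linear_add[OF twistV_linear(1)]
      ddW_sym(1)[OF x, of v w u] str[symmetric]
    by (simp add: algebra_simps)
qed

text \<open>
  The Gram matrix is the product of the matrix of the frame with its conjugate transpose.
\<close>

lemma gram_det:
  assumes x: "x \<in> U"
  defines "b \<equiv> \<lambda>k::3. axis k 1 :: complex ^ 3"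
  shows "Re (det (\<chi> j k. Complex (inner (W x (b j)) (W x (b k))) (inner (W x (b j)) (W x (\<i> *s b k))) :: complex ^ 3 ^ 3))
    = (cmod (det3 (W x (b 1)) (W x (b 2)) (W x (b 3))))\<^sup>2"
proof -
  have entry: "Complex (inner u v) (inner u (\<i> *s v)) = u $ 1 * cnj (v $ 1) + u $ 2 * cnj (v $ 2) + u $ 3 * cnj (v $ 3)"
    for u v :: "complex ^ 3"
    by (simp add: inner_C3 complex_eq_iff)
  define p where "p = (\<lambda>j. W x (b j))"
  define P P' :: "complex ^ 3 ^ 3" where "P = (\<chi> j l. p j $ l)" and "P' = (\<chi> l k. cnj (p k $ l))"
  have "(\<chi> j k. Complex (inner (W x (b j)) (W x (b k))) (inner (W x (b j)) (W x (\<i> *s b k))) :: complex ^ 3 ^ 3) = P ** P'"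
    unfolding W_smult[OF x] entry
    by (simp add: P_def P'_def p_def matrix_matrix_mult_def sum_3)
  moreover have "det P = det3 (p 1) (p 2) (p 3)" "det P' = cnj (det3 (p 1) (p 2) (p 3))"
    by (simp_all add: P_def P'_def det_3 det3_def algebra_simps)
  ultimately have "det (\<chi> j k. Complex (inner (W x (b j)) (W x (b k))) (inner (W x (b j)) (W x (\<i> *s b k))) :: complex ^ 3 ^ 3)
     = det3 (p 1) (p 2) (p 3) * cnj (det3 (p 1) (p 2) (p 3))"
    by (simp add: det_mul)
  then show ?thesis by (simp add: p_def complex_norm_square[symmetric] flip: of_real_power)
qed

end

section \<open>A solution of the Strominger system on the Iwasawa manifold\<close>

lemma hol_map_fder_hol:
  assumes "hol_map N F"
  shows "hol_map N (\<lambda>y. fder F y v)"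
  unfolding hol_map_def
proof
  fix i
  have "hol_fun N (\<lambda>y. F y $ i)" using assms by (simp add: hol_map_def)
  from hol_fun_fder_hol[OF this, of v] show "hol_fun N (\<lambda>y. fder F y v $ i)"
    by (rule hol_fun_cong) (simp add: hol_map_fder(3)[OF assms])
qed

text \<open>
  Locally the frame is \<open>(ds\<^sub>1, ds\<^sub>2, ds\<^sub>3 - s\<^sub>1 ds\<^sub>2)\<close> for the holomorphic components \<open>s\<^sub>i\<close> of a change of
  charts, so the structure equations come from the symmetry of second derivatives.
\<close>

lemma frame_is_heis:
  assumes c: "c \<in> atlas (fibre 0)"
  shows "heis_frame (snd c ` fst c) (frame 0 c)"
proof (rule heis_frame.intro)
  show "open (snd c ` fst c)" by (rule fibre_image_open[OF c])
  show "linear (frame 0 c x)" if "x \<in> snd c ` fst c" for x using that by (rule frame_linear[OF c])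
  show "frame 0 c x (a *s v) = a *s frame 0 c x v" if "x \<in> snd c ` fst c" for x a v
    using that by (rule frame_smult[OF c])
  show "v = 0" if "x \<in> snd c ` fst c" "frame 0 c x v = 0" for x v using that by (rule frame_eq_0[OF c])
  have loc: "\<exists>N \<sigma>. open N \<and> x \<in> N \<and> N \<subseteq> snd c ` fst c \<and> hol_map N \<sigma> \<and>
    (\<forall>y\<in>N. \<forall>v. frame 0 c y v = coframe 0 (\<sigma> y) (fder \<sigma> y v))" if "x \<in> snd c ` fst c" for x
    using frame_local[OF c that] by metis
  have N_hol: "hol_map N (\<lambda>x. frame 0 c x v)"
    if "open N" "hol_map N \<sigma>" "\<forall>y\<in>N. \<forall>v. frame 0 c y v = coframe 0 (\<sigma> y) (fder \<sigma> y v)" for N \<sigma> v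
  proof -
    have s: "hol_fun N (\<lambda>y. \<sigma> y $ i)" "hol_fun N (\<lambda>y. fder \<sigma> y v $ i)" for i
      using that(2) hol_map_fder_hol[OF that(2)] by (simp_all add: hol_map_def)
    have "hol_map N (\<lambda>y. coframe 0 (\<sigma> y) (fder \<sigma> y v))"
      unfolding hol_map_def forall_3 coframe_simps
      by (simp, intro conjI hol_fun_diff hol_fun_mult s)
    then show ?thesis by (rule hol_map_cong) (use that(3) in simp)
  qed
  show hol: "hol_map (snd c ` fst c) (\<lambda>x. frame 0 c x v)" for v
  proof (rule hol_map_local)
    fix x assume "x \<in> snd c ` fst c"
    then obtain N \<sigma> where N: "open N" "x \<in> N" "N \<subseteq> snd c ` fst c" "hol_map N \<sigma>"
      "\<forall>y\<in>N. \<forall>v. frame 0 c y v = coframe 0 (\<sigma> y) (fder \<sigma> y v)" using loc by metis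
    show "\<exists>T. x \<in> T \<and> T \<subseteq> snd c ` fst c \<and> hol_map T (\<lambda>x. frame 0 c x v)"
      using N(2,3) N_hol[OF N(1,4,5), of v] by (intro exI[of _ N] conjI)
  qed
  fix x v u assume x: "x \<in> snd c ` fst c"
  then obtain N \<sigma> where N: "open N" "x \<in> N" "N \<subseteq> snd c ` fst c" "hol_map N \<sigma>"
    "\<forall>y\<in>N. \<forall>v. frame 0 c y v = coframe 0 (\<sigma> y) (fder \<sigma> y v)" using loc by metis
  define s where "s = (\<lambda>i y. \<sigma> y $ i)"
  have s: "hol_fun N (s i)" for i using N(4) by (simp add: hol_map_def s_def)
  have \<sigma>: "fder \<sigma> y v $ i = fder (s i) y v" if "y \<in> N" for y v i
    using hol_map_fder(3)[OF N(4) that] by (simp add: s_def[abs_def])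
  have f: "frame 0 c y v $ 1 = fder (s 1) y v" "frame 0 c y v $ 2 = fder (s 2) y v"
    "frame 0 c y v $ 3 = fder (s 3) y v - s 1 y * fder (s 2) y v" if "y \<in> N" for y v
    using N(5) that by (simp_all add: \<sigma>[OF that]) (simp add: s_def)
  have c12: "fder (\<lambda>y. frame 0 c y v) x u $ i = fder (\<lambda>y. fder (s i) y v) x u" if "i = 1 \<or> i = 2" for v u i
    unfolding hol_map_fder(3)[OF hol x] using that by (auto intro!: fun_cong[OF fder_cong[OF N(1,2)]] f)
  show "fder (\<lambda>y. frame 0 c y v) x u $ 1 = fder (\<lambda>y. frame 0 c y u) x v $ 1"
    using hol_fun_fder_sym[OF s N(2)] by (simp add: c12)
  show "fder (\<lambda>y. frame 0 c y v) x u $ 2 = fder (\<lambda>y. frame 0 c y u) x v $ 2"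
    using hol_fun_fder_sym[OF s N(2)] by (simp add: c12)
  have c3: "fder (\<lambda>y. frame 0 c y v) x u $ 3 =
      fder (\<lambda>y. fder (s 3) y v) x u - (s 1 x * fder (\<lambda>y. fder (s 2) y v) x u + fder (s 1) x u * fder (s 2) x v)" for v u
  proof -
    have "((\<lambda>y. fder (s 3) y v - s 1 y * fder (s 2) y v) has_derivative
       (\<lambda>u. fder (\<lambda>y. fder (s 3) y v) x u - (s 1 x * fder (\<lambda>y. fder (s 2) y v) x u + fder (s 1) x u * fder (s 2) x v))) (at x)"
      by (intro has_derivative_diff has_derivative_mult hol_fun_fder(1)[OF hol_fun_fder_hol[OF s] N(2)] hol_fun_fder(1)[OF s N(2)])
    then have "((\<lambda>y. frame 0 c y v $ 3) has_derivative
       (\<lambda>u. fder (\<lambda>y. fder (s 3) y v) x u - (s 1 x * fder (\<lambda>y. fder (s 2) y v) x u + fder (s 1) x u * fder (s 2) x v))) (at x)"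
      by (rule has_derivative_transform_within_open[OF _ N(1,2)]) (simp add: f)
    from fun_cong[OF fder_eq[OF this], of u] show ?thesis by (simp add: hol_map_fder(3)[OF hol x])
  qed
  show "fder (\<lambda>y. frame 0 c y v) x u $ 3 - fder (\<lambda>y. frame 0 c y u) x v $ 3 = - mix (frame 0 c x u) (frame 0 c x v)"
    unfolding c3 mix_def f[OF N(2)]
    using hol_fun_fder_sym[OF s N(2), of 3 v u] hol_fun_fder_sym[OF s N(2), of 2 v u] by (simp add: algebra_simps)
qed

definition iwa_metric :: "(point, 3) metric" where
  "iwa_metric c x v w = inner (frame 0 c x v) (frame 0 c x w)"

definition iwa_conn :: "(point, 3) tconn" where
  "iwa_conn c = heis_frame.gam (frame 0 c)"

lemma whole_img: "c \<in> atlas (fibre t) \<Longrightarrow> img c (topspace (mtop (fibre t))) = snd c ` fst c"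
  using chart_on_simps(5)[OF fibre_chart_on[of c t]] unfolding img_def by (simp add: inf.absorb1)

lemma smooth_on_inner_C3:
  assumes "open U" "\<And>i. smooth_on U (\<lambda>x. A x $ i)" "\<And>i. smooth_on U (\<lambda>x. B x $ i)"
  shows "smooth_on U (\<lambda>x. inner (A x :: complex ^ 3) (B x))"
proof -
  have "smooth_on U (\<lambda>x. Re (A x $ i * cnj (B x $ i)))" for i
    by (intro smooth_on_linear[OF bounded_linear_Re] smooth_on_mult assms smooth_on_linear[OF bounded_linear_cnj])
  then show ?thesis unfolding inner_C3 by (intro smooth_on_add)
qed

lemma hermitian_iwa: "hermitian_metric (fibre 0) iwa_metric"
  unfolding hermitian_metric_def
proof (intro conjI ballI allI impI)
  fix c x assume c: "c \<in> atlas (fibre 0)" and x: "x \<in> snd c ` fst c"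
  interpret heis_frame "snd c ` fst c" "frame 0 c" by (rule frame_is_heis[OF c])
  note lin = W_linear[OF x]
  show "bilinear (iwa_metric c x)"
    unfolding bilinear_def iwa_metric_def
    by (auto intro!: linearI simp: linear_add[OF lin] linear_cmul[OF lin] inner_add_left inner_add_right)
  show "iwa_metric c x v w = iwa_metric c x w v" for v w
    by (simp add: iwa_metric_def inner_commute)
  show "0 < iwa_metric c x v v" if "v \<noteq> 0" for v
    using W_eq_0[OF x, of v] that by (auto simp: iwa_metric_def)
  show "iwa_metric c x (J v) (J w) = iwa_metric c x v w" for v w
    by (simp add: iwa_metric_def W_smult[OF x] inner_C3)
next
  fix c v w assume c: "c \<in> atlas (fibre 0)"
  interpret heis_frame "snd c ` fst c" "frame 0 c" by (rule frame_is_heis[OF c])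
  show "smooth_on (snd c ` fst c) (\<lambda>x. iwa_metric c x v w)"
    unfolding iwa_metric_def by (intro smooth_on_inner_C3 U W_smooth)
next
  fix c c' p v w assume "c \<in> atlas (fibre 0)" "c' \<in> atlas (fibre 0)" "p \<in> fst c \<inter> fst c'"
  then show "iwa_metric c (snd c p) v w = iwa_metric c' (snd c' p) (jac c c' p v) (jac c c' p w)"
    by (simp add: iwa_metric_def frame_transition[of c 0 c'])
qed

text \<open>
  Differentiating the transformation rule of the frame produces the second derivative of the change
  of charts, the inhomogeneous term in the transformation law of a connection.
\<close>

lemma frame_second_derivative:
  assumes c: "c \<in> atlas (fibre 0)" and c': "c' \<in> atlas (fibre 0)" and p: "p \<in> fst c" "p \<in> fst c'"
  shows "heis_frame.dW (frame 0 c) (snd c p) u w =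
    frame 0 c' (snd c' p) (fder (\<lambda>y. fder (trans_map c c') y w) (snd c p) u)
    + heis_frame.dW (frame 0 c') (snd c' p) (jac c c' p u) (jac c c' p w)"
proof -
  interpret A: heis_frame "snd c ` fst c" "frame 0 c" by (rule frame_is_heis[OF c])
  interpret B: heis_frame "snd c' ` fst c'" "frame 0 c'" by (rule frame_is_heis[OF c'])
  note ch = fibre_chart_on[OF c] and ch' = fibre_chart_on[OF c']
  define I \<psi> x where "I = img c (fst c')" and "\<psi> = trans_map c c'" and "x = snd c p"
  have I: "open I" unfolding I_def using img_open[OF ch] ch' by (auto simp: chart_on_def)
  have xI: "x \<in> I" and xc: "x \<in> snd c ` fst c" using p by (auto simp: I_def x_def img_def)
  have \<psi>: "hol_map I \<psi>" using fibre_compatible[OF c c'] by (simp add: hol_compatible_iff I_def \<psi>_def)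
  have \<psi>x: "\<psi> x = snd c' p" using trans_map_snd[OF ch p(1)] by (simp add: \<psi>_def x_def)
  have in': "\<psi> y \<in> snd c' ` fst c'" if "y \<in> I" for y
  proof -
    from that obtain q where "q \<in> fst c" "q \<in> fst c'" "y = snd c q" by (auto simp: I_def img_def)
    then show ?thesis using trans_map_snd[OF ch, of q c'] by (simp add: \<psi>_def)
  qed
  have j: "jac c c' p v = fder \<psi> x v" for v by (simp add: jac_def \<psi>_def x_def)
  define h where "h = (\<lambda>y. fder \<psi> y w)"
  have h: "hol_map I h" unfolding h_def by (rule hol_map_fder_hol[OF \<psi>])
  have "((\<lambda>y. frame 0 c' (\<psi> y) (h y)) has_derivative
      (\<lambda>u. B.dW (\<psi> x) (fder \<psi> x u) (h x) + frame 0 c' (\<psi> x) (fder h x u))) (at x)"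
    by (rule B.W_apply_has_derivative[OF I xI hol_map_fder(1)[OF \<psi> xI] in' hol_map_fder(1)[OF h xI]])
  then have 1: "((\<lambda>y. frame 0 c y w) has_derivative
      (\<lambda>u. B.dW (\<psi> x) (fder \<psi> x u) (h x) + frame 0 c' (\<psi> x) (fder h x u))) (at x)"
  proof (rule has_derivative_transform_within_open[OF _ I xI])
    fix y assume "y \<in> I"
    then obtain q where q: "q \<in> fst c" "q \<in> fst c'" "y = snd c q" by (auto simp: I_def img_def)
    show "frame 0 c' (\<psi> y) (h y) = frame 0 c y w"
      using frame_transition[OF c c' q(1,2), of w] q trans_map_snd[OF ch q(1)]
      by (simp add: jac_def h_def \<psi>_def)
  qed
  have "A.dW x u w = frame 0 c' (\<psi> x) (fder h x u) + B.dW (\<psi> x) (fder \<psi> x u) (h x)"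
    using fun_cong[OF fder_eq[OF 1], of u] by (simp only: A.dW_def add.commute)
  then show ?thesis unfolding j h_def \<psi>x x_def[symmetric] \<psi>_def[symmetric] .
qed

lemma metric_connection_iwa: "metric_connection (fibre 0) iwa_metric iwa_conn"
  unfolding metric_connection_def tangent_connection_def
proof (intro conjI ballI allI impI)
  fix c x assume c: "c \<in> atlas (fibre 0)" and x: "x \<in> snd c ` fst c"
  interpret heis_frame "snd c ` fst c" "frame 0 c" by (rule frame_is_heis[OF c])
  show "bilinear (iwa_conn c x)" unfolding iwa_conn_def by (rule gam_bilinear[OF x])
  show "fder (\<lambda>y. iwa_metric c y v w) x u =
      iwa_metric c x (iwa_conn c x u v) w + iwa_metric c x v (iwa_conn c x u w)" for u v w
    unfolding iwa_metric_def iwa_conn_def by (rule gam_metric[OF x])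
next
  fix c u w assume c: "c \<in> atlas (fibre 0)"
  interpret heis_frame "snd c ` fst c" "frame 0 c" by (rule frame_is_heis[OF c])
  show "smooth_on (snd c ` fst c) (\<lambda>x. iwa_conn c x u w)" unfolding iwa_conn_def by (rule gam_smooth)
next
  fix c c' p u w assume c: "c \<in> atlas (fibre 0)" and c': "c' \<in> atlas (fibre 0)" and p': "p \<in> fst c \<inter> fst c'"
  then have p: "p \<in> fst c" "p \<in> fst c'" by auto
  interpret A: heis_frame "snd c ` fst c" "frame 0 c" by (rule frame_is_heis[OF c])
  interpret B: heis_frame "snd c' ` fst c'" "frame 0 c'" by (rule frame_is_heis[OF c'])
  have x: "snd c p \<in> snd c ` fst c" and x': "snd c' p \<in> snd c' ` fst c'" using p by auto
  note tr = frame_transition[OF c c' p]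
  have "frame 0 c' (snd c' p) (jac c c' p (A.gam (snd c p) u w))
      = A.dW (snd c p) u w + twistV (frame 0 c (snd c p) u) (frame 0 c (snd c p) w)"
    using tr[symmetric] A.W_gam[OF x] by simp
  also have "\<dots> = frame 0 c' (snd c' p) (fder (\<lambda>y. fder (trans_map c c') y w) (snd c p) u
      + B.gam (snd c' p) (jac c c' p u) (jac c c' p w))"
    unfolding linear_add[OF B.W_linear[OF x']] B.W_gam[OF x'] frame_second_derivative[OF c c' p] tr by simp
  finally show "jac c c' p (iwa_conn c (snd c p) u w) = fder (\<lambda>y. fder (trans_map c c') y w) (snd c p) u
      + iwa_conn c' (snd c' p) (jac c c' p u) (jac c c' p w)"
    unfolding iwa_conn_def using B.W_inj[OF x'] by (rule injD[rotated])
qed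

context
  fixes c :: "(point, 3) chart"
  assumes c: "c \<in> atlas (fibre 0)"
begin

interpretation heis_frame "snd c ` fst c" "frame 0 c" by (rule frame_is_heis[OF c])

lemma iwa_norm:
  assumes x: "x \<in> snd c ` fst c"
  shows "form_norm iwa_metric (vol_form 0) c x = 1"
proof -
  have "of_nat (Suc 0) = (1::3)" "of_nat (Suc 1) = (2::3)" "of_nat (Suc 2) = (3::3)" by simp_all
  then have v: "vol_form 0 c x (\<lambda>i. axis (of_nat (Suc i)) 1) = det3 (frame 0 c x (axis 1 1)) (frame 0 c x (axis 2 1)) (frame 0 c x (axis 3 1))"
    unfolding vol_form_def by metis
  show ?thesis
    unfolding form_norm_def Let_def iwa_metric_def gram_det[OF x] v
    using W_det_nonzero[OF x] by simp
qed

lemma iwa_fund: "x \<in> snd c ` fst c \<Longrightarrow> fund_form iwa_metric c x v = of_real (fundV (frame 0 c x (v 0)) (frame 0 c x (v 1)))"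
  by (simp add: fund_form_def iwa_metric_def fundV_def W_smult)

lemma iwa_fund_sq:
  assumes x: "x \<in> snd c ` fst c"
  defines "F \<equiv> \<lambda>a b. complex_of_real (fundV (frame 0 c x a) (frame 0 c x b))"
  shows "fund_sq iwa_metric c x v = 2 * (F (v 0) (v 1) * F (v 2) (v 3) - F (v 0) (v 2) * F (v 1) (v 3) + F (v 0) (v 3) * F (v 1) (v 2))"
  unfolding fund_sq_def
proof (rule wedge_2_2)
  show "fund_form iwa_metric c x u = F (u 0) (u 1)" for u by (simp add: iwa_fund[OF x] F_def)
  show "F b a = - F a b" for a b unfolding F_def fundV_anti[of "frame 0 c x b"] by simp
qed

lemma iwa_balanced:
  assumes x: "x \<in> snd c ` fst c"
  shows "ext_deriv 4 (\<lambda>y w. of_real (form_norm iwa_metric (vol_form 0) c y) * fund_sq iwa_metric c y w) x v = 0"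
  using fund_square_closed[OF x, of v]
  by (subst ext_deriv_cong[OF U x]) (simp_all add: iwa_norm iwa_fund_sq)

lemma iwa_torsion: "x \<in> snd c ` fst c \<Longrightarrow>
  torsion_form iwa_metric c x v = of_real (torsV (frame 0 c x (v 0)) (frame 0 c x (v 1)) (frame 0 c x (v 2)))"
  unfolding torsion_form_def
  by (subst ext_deriv_cong[OF U _ iwa_fund]) (simp_all add: ext_deriv_fund W_smult dfundV_J del: One_nat_def)

lemma iwa_anomaly:
  assumes x: "x \<in> snd c ` fst c" and e: "tangent_frame iwa_metric c x e"
  shows "ext_deriv 3 (torsion_form iwa_metric c) x v = trace_sq 6 (tcurv_entry iwa_metric iwa_conn c x e) v"
proof -
  define w where "w = (\<lambda>i. frame 0 c x (v i))"
  define E where "E = (\<lambda>i. frame 0 c x (e i))"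
  define q where "q = (\<lambda>i j a b. complex_of_real (inner (curvV (frame 0 c x a) (frame 0 c x b) (E j)) (E i)))"
  have E: "orthonormal6 E"
    using e by (simp add: orthonormal6_def tangent_frame_def iwa_metric_def E_def)
  have ent: "tcurv_entry iwa_metric iwa_conn c x e i j u = q i j (u 0) (u 1)" for i j u
    unfolding tcurv_entry_def tcurv_def iwa_metric_def iwa_conn_def gam_curvature[OF x] q_def E_def ..
  have anti: "q i j b a = - q i j a b" for i j a b
    by (simp add: q_def curvV_anti[of "frame 0 c x b"])
  have tr: "(\<Sum>j<6. \<Sum>i<j. q i j a b * q i j a' b') =
      of_real (2 * (kap1 (frame 0 c x a) (frame 0 c x b) * kap1 (frame 0 c x a') (frame 0 c x b')
        + kap2 (frame 0 c x a) (frame 0 c x b) * kap2 (frame 0 c x a') (frame 0 c x b')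
        + kap3 (frame 0 c x a) (frame 0 c x b) * kap3 (frame 0 c x a') (frame 0 c x b')))" for a b a' b'
    unfolding trace_crossV[OF E, symmetric] q_def curvV_def by simp
  have "trace_sq 6 (tcurv_entry iwa_metric iwa_conn c x e) v =
     (\<Sum>j<6. \<Sum>i<j. 2 * (q i j (v 0) (v 1) * q i j (v 2) (v 3) - q i j (v 0) (v 2) * q i j (v 1) (v 3)
        + q i j (v 0) (v 3) * q i j (v 1) (v 2)))"
    unfolding trace_sq_def by (intro sum.cong refl wedge_2_2 ent anti)
  also have "\<dots> = 2 * ((\<Sum>j<6. \<Sum>i<j. q i j (v 0) (v 1) * q i j (v 2) (v 3)) - (\<Sum>j<6. \<Sum>i<j. q i j (v 0) (v 2) * q i j (v 1) (v 3))
        + (\<Sum>j<6. \<Sum>i<j. q i j (v 0) (v 3) * q i j (v 1) (v 2)))"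
    by (simp add: sum_distrib_left sum.distrib sum_subtractf algebra_simps)
  also have "\<dots> = of_real (dtorsV (w 0) (w 1) (w 2) (w 3))"
    unfolding tr w_def dtorsV_eq_trace by simp
  also have "\<dots> = ext_deriv 3 (torsion_form iwa_metric c) x v"
    by (subst ext_deriv_cong[OF U x iwa_torsion]) (simp_all add: ext_deriv_tors[OF x] w_def del: One_nat_def)
  finally show ?thesis by simp
qed

end

lemma wedge_zero: "wedge k l (\<lambda>v. 0) \<beta> v = 0"
  by (simp add: wedge_def)

text \<open>
  The bundle is the trivial line bundle with the trivial connection. Its curvature vanishes, so the
  conditions on it hold and the anomaly equation involves the tangent connection alone.
\<close>

lemma strominger_iwa:
  "strominger_solution (fibre 0) (vol_form 0) 4 iwa_metric iwa_conn 1 {topspace (mtop (fibre 0))}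
     (\<lambda>U V p i j. 1) (\<lambda>U p i j. 1) (\<lambda>U i j c x v. 0)"
proof -
  let ?M = "fibre 0" and ?T = "topspace (mtop (fibre 0))"
  have op: "open (snd c ` fst c)" if "c \<in> atlas ?M" for c by (rule fibre_image_open[OF that])
  have curv: "bcurv 1 (\<lambda>U i j c x v. 0) U i j c x = (\<lambda>v. 0)" for U i j and c :: "(point, 3) chart" and x
    by (simp add: bcurv_def ext_deriv_def wedge_zero fun_eq_iff)
  have ent: "bcurv_entry 1 H (\<lambda>i j v. 0) f = (\<lambda>a b v. 0)" for H f
    by (simp add: bcurv_entry_def sesq_def fun_eq_iff)
  have tr0: "trace_sq m (\<lambda>a b v. 0) v = 0" for m and v :: "nat \<Rightarrow> complex ^ 3"
    by (simp add: trace_sq_def wedge_zero)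
  have hb: "hol_bundle ?M 1 {?T} (\<lambda>U V p i j. 1)"
    unfolding hol_bundle_def by (simp add: whole_img hol_fun_const op)
  have bm: "bundle_metric ?M 1 {?T} (\<lambda>U V p i j. 1) (\<lambda>U p i j. 1)"
    unfolding bundle_metric_def
    by (simp add: whole_img smooth_on_const op sesq_def complex_mult_cnj flip: of_real_power of_real_add)
       (auto simp: complex_eq_iff sum_power2_gt_zero_iff)
  have bc: "bundle_connection ?M 1 {?T} (\<lambda>U V p i j. 1) (\<lambda>U i j c x v. 0)"
    unfolding bundle_connection_def form_on_def alternating_form_def
    by (auto simp: whole_img smooth_on_const op intro: linearI)
  have uc: "unitary_connection ?M 1 {?T} (\<lambda>U p i j. 1) (\<lambda>U i j c x v. 0)"
    unfolding unitary_connection_def by simp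
  show ?thesis
    unfolding strominger_solution_def
  proof (intro conjI hermitian_iwa metric_connection_iwa hb bm bc uc ballI allI impI)
    fix c x v assume "c \<in> atlas ?M" "x \<in> snd c ` fst c"
    then show "ext_deriv 4 (\<lambda>y w. of_real (form_norm iwa_metric (vol_form 0) c y) * fund_sq iwa_metric c y w) x v = 0"
      by (rule iwa_balanced)
  next
    fix U c x e f v assume U: "U \<in> {?T}" and c: "c \<in> atlas ?M" and x: "x \<in> img c U"
      and ef: "tangent_frame iwa_metric c x e \<and> bundle_frame 1 ((\<lambda>U p i j. 1) U (cinv c x)) f"
    have "x \<in> snd c ` fst c" using x by (auto simp: img_def)
    from iwa_anomaly[OF c this, of e v] ef
    show "ext_deriv 3 (torsion_form iwa_metric c) x v = complex_of_real (4 / 4) *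
         (trace_sq 6 (tcurv_entry iwa_metric iwa_conn c x e) v -
          trace_sq (2 * 1) (bcurv_entry 1 ((\<lambda>U p i j. 1) U (cinv c x)) (\<lambda>i j. bcurv 1 (\<lambda>U i j c x v. 0) U i j c x) f) v)"
      unfolding curv ent tr0 by simp
  qed (simp_all add: curv wedge_zero part_02_def part_20_def del: One_nat_def)
qed

section \<open>Averaging over a lattice\<close>

text \<open>
  Averaging along the six lattice directions in turn replaces integration over the compact quotient.
  Two properties of the integral carry over: the average of a derivative is a
  difference, as in Stokes' theorem, and averages in different directions commute, as in Fubini's.
\<close>

definition avg :: "'a::euclidean_space \<Rightarrow> ('a \<Rightarrow> real) \<Rightarrow> 'a \<Rightarrow> real" where
  "avg L f x = integral {0..1} (\<lambda>s. f (x + s *\<^sub>R L))"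

lemma avg_integrable:
  fixes f :: "'a::euclidean_space \<Rightarrow> real"
  assumes "continuous_on UNIV f"
  shows "(\<lambda>s. f (x + s *\<^sub>R L)) integrable_on {a..b::real}"
  by (rule integrable_continuous_real)
     (rule continuous_on_compose2[OF assms], auto intro!: continuous_intros)

lemma avg_continuous:
  assumes "continuous_on UNIV f"
  shows "continuous_on UNIV (avg L f)"
proof -
  have "continuous_on (UNIV \<times> cbox 0 1) (\<lambda>(x, s). f (x + s *\<^sub>R L))"
    unfolding split_beta by (rule continuous_on_compose2[OF assms]) (auto intro!: continuous_intros)
  from integral_continuous_on_param[OF this] show ?thesis
    by (simp add: avg_def[abs_def])
qed

lemma avg_commute:
  assumes f: "continuous_on UNIV f"
  shows "avg L (avg L' f) = avg L' (avg L f)"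
proof
  fix x
  have c: "continuous_on (cbox (0, 0) (1, 1)) (\<lambda>(s, r). f (x + s *\<^sub>R L + r *\<^sub>R L'))"
    unfolding split_beta by (rule continuous_on_compose2[OF f]) (auto intro!: continuous_intros)
  show "avg L (avg L' f) x = avg L' (avg L f) x"
    using integral_swap_continuous[OF c] by (simp add: avg_def add_ac)
qed

lemma avg_add: "continuous_on UNIV f \<Longrightarrow> continuous_on UNIV g \<Longrightarrow> avg L (\<lambda>x. f x + g x) x = avg L f x + avg L g x"
  unfolding avg_def by (rule integral_add) (rule avg_integrable, assumption)+

lemma avg_cmult: "avg L (\<lambda>x. k * f x) x = k * avg L f x"
  by (simp add: avg_def)

lemma avg_translate: "avg L (\<lambda>x. f (x + a)) x = avg L f (x + a)"
  by (simp add: avg_def add_ac)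

lemma avg_pos:
  assumes f: "continuous_on UNIV f" and pos: "\<And>x. 0 < f x"
  shows "0 < avg L f x"
proof -
  have c: "continuous_on {0..1::real} (\<lambda>s. f (x + s *\<^sub>R L))"
    by (rule continuous_on_compose2[OF f]) (auto intro!: continuous_intros)
  have "0 \<le> avg L f x"
    unfolding avg_def by (rule integral_nonneg[OF avg_integrable[OF f]]) (simp add: pos less_imp_le)
  moreover have "avg L f x \<noteq> 0"
    unfolding avg_def using integral_eq_0_iff[OF c] pos less_imp_le by (metis atLeastAtMost_iff less_irrefl order_refl zero_le_one zero_less_one)
  ultimately show ?thesis by simp
qed

lemma avg_deriv:
  assumes d: "\<And>x. (f has_derivative D x) (at x)"
  shows "avg L (\<lambda>x. D x L) x = f (x + L) - f x"
proof -
  have "((\<lambda>s. f (x + s *\<^sub>R L)) has_vector_derivative D (x + s *\<^sub>R L) L) (at s within {0..1})" for s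
  proof -
    have "((\<lambda>s. x + s *\<^sub>R L) has_derivative (\<lambda>h. h *\<^sub>R L)) (at s within {0..1})"
      by (auto intro!: derivative_eq_intros)
    from has_derivative_compose[OF this d[of "x + s *\<^sub>R L"]]
    show ?thesis
      unfolding has_vector_derivative_def
      using linear_cmul[OF has_derivative_linear[OF d[of "x + s *\<^sub>R L"]]] by simp
  qed
  then have "((\<lambda>s. D (x + s *\<^sub>R L) L) has_integral (f (x + 1 *\<^sub>R L) - f (x + 0 *\<^sub>R L))) {0..1}"
    by (intro fundamental_theorem_of_calculus) auto
  then show ?thesis unfolding avg_def by (simp add: integral_unique)
qed

lemma avg_periodic:
  assumes f: "continuous_on UNIV f" and per: "\<And>x. f (x + L) = f x"
  shows "avg L f (x + r *\<^sub>R L) = avg L f x"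
proof -
  define h where "h = (\<lambda>s. f (x + s *\<^sub>R L))"
  have hc: "continuous_on S h" for S
    unfolding h_def by (rule continuous_on_compose2[OF f]) (auto intro!: continuous_intros)
  have hp: "h (s + 1) = h s" for s
    using per[of "x + s *\<^sub>R L"] by (simp add: h_def scaleR_add_left add_ac)
  define R where "R = \<bar>r\<bar> + 2"
  obtain H where H: "\<And>s. s \<in> {-R..R} \<Longrightarrow> (H has_vector_derivative h s) (at s within {-R..R})"
    using antiderivative_continuous[OF hc] by blast
  have Hd: "(H has_real_derivative h s) (at s)" if "-R < s" "s < R" for s
    using H[of s] that by (simp add: has_real_derivative_iff_has_vector_derivative at_within_Icc_at)
  have av: "avg L f (x + u *\<^sub>R L) = H (u + 1) - H u" if "\<bar>u\<bar> \<le> \<bar>r\<bar>" for u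
  proof -
    have "((\<lambda>s. H (u + s)) has_vector_derivative h (u + s)) (at s within {0..1})" if "s \<in> {0..1}" for s
    proof -
      have "-R < u + s" "u + s < R" using that \<open>\<bar>u\<bar> \<le> \<bar>r\<bar>\<close> by (auto simp: R_def)
      from Hd[OF this] have "((\<lambda>s. H (u + s)) has_real_derivative h (u + s)) (at s)"
        by (simp add: DERIV_shift add.commute)
      then show ?thesis
        by (simp add: has_real_derivative_iff_has_vector_derivative has_vector_derivative_at_within)
    qed
    then have "((\<lambda>s. h (u + s)) has_integral (H (u + 1) - H (u + 0))) {0..1}"
      by (intro fundamental_theorem_of_calculus) auto
    then show ?thesis
      unfolding avg_def h_def by (simp add: integral_unique scaleR_add_left add_ac)
  qed
  define \<phi> where "\<phi> = (\<lambda>u. H (u + 1) - H u)"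
  have "\<phi> r = \<phi> 0"
  proof (rule has_derivative_zero_unique[where f = \<phi> and s = "{-\<bar>r\<bar>..\<bar>r\<bar>}"])
    fix u assume u: "u \<in> {-\<bar>r\<bar>..\<bar>r\<bar>}"
    have 1: "(H has_real_derivative h (u + 1)) (at (u + 1))" "(H has_real_derivative h u) (at u)"
      using u by (intro Hd; simp add: R_def)+
    have "(\<phi> has_real_derivative h (u + 1) - h u) (at u)"
      unfolding \<phi>_def using 1 DERIV_shift[of H "h (u + 1)" u 1] by (intro DERIV_diff) blast+
    then have "(\<phi> has_derivative (\<lambda>x. 0)) (at u)" by (simp add: hp has_field_derivative_def lambda_zero)
    then show "(\<phi> has_derivative (\<lambda>x. 0)) (at u within {-\<bar>r\<bar>..\<bar>r\<bar>})"
      by (rule has_derivative_at_withinI)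
  qed auto
  then show ?thesis using av[of r] av[of 0] by (simp add: \<phi>_def)
qed

lemma avg_idem:
  assumes f: "continuous_on UNIV f" and per: "\<And>x. f (x + L) = f x"
  shows "avg L (avg L f) = avg L f"
  unfolding avg_def[of L "avg L f"] by (simp add: avg_periodic[OF assms] fun_eq_iff)

section \<open>The obstruction to balanced metrics\<close>

text \<open>
  This is \<open>\<rho>/2\<close> times the wedge square of the two-form \<open>f\<close>.
\<close>

definition four_form :: "real \<Rightarrow> (complex ^ 3 \<Rightarrow> complex ^ 3 \<Rightarrow> real) \<Rightarrow> complex ^ 3 \<Rightarrow> complex ^ 3 \<Rightarrow> complex ^ 3 \<Rightarrow> complex ^ 3 \<Rightarrow> real" where
  "four_form \<rho> f a b c d = \<rho> * (f a b * f c d - f a c * f b d + f a d * f b c)"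

lemma Ck_1_iff: "Ck_on (Suc 0) S h \<longleftrightarrow> (\<forall>x\<in>S. h differentiable (at x)) \<and> (\<forall>v. continuous_on S (\<lambda>x. fder h x v))"
  by simp

lemma four_form_C1:
  fixes S :: "'a::euclidean_space set"
  assumes "open S" "\<And>a b. Ck_on (Suc 0) S (\<lambda>x. f x a b)" "Ck_on (Suc 0) S \<rho>"
  shows "Ck_on (Suc 0) S (\<lambda>x. four_form (\<rho> x) (f x) a b c d)"
proof -
  have m: "Ck_on (Suc 0) S (\<lambda>x. p x * q x)" if "Ck_on (Suc 0) S p" "Ck_on (Suc 0) S q" for p q :: "'a \<Rightarrow> real"
    using Ck_on_bilinear[OF bounded_bilinear_mult assms(1) that] .
  have n: "Ck_on (Suc 0) S (\<lambda>x. - p x)" if "Ck_on (Suc 0) S p" for p :: "'a \<Rightarrow> real"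
    using Ck_on_linear[OF bounded_linear_minus[OF bounded_linear_ident] assms(1) that] .
  show ?thesis
    unfolding four_form_def diff_conv_add_uminus
    by (intro m n Ck_on_add assms)
qed

text \<open>
  Stokes' theorem on the quotient for the form \<open>\<eta> \<and> Re \<omega>\<^sub>3\<close>, where \<open>\<eta> = \<rho>/2 f \<and> f\<close> is closed. The
  vectors \<open>L\<^sub>1, \<dots>, L\<^sub>6\<close> are the translation parts of the deck transformations with one
  parameter equal to \<open>1\<close> or \<open>\<i>\<close>. Evaluating \<open>d\<eta> = 0\<close> on all of them except \<open>L\<^sub>5\<close>, the
  direction dual to \<open>Re \<omega>\<^sub>3\<close>, and averaging over the lattice leaves only the increments of
  coefficients of \<open>\<eta>\<close> across a period. These vanish in the directions \<open>L\<^sub>3\<close>, \<open>L\<^sub>4\<close> and \<open>L\<^sub>6\<close>, in which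
  \<open>\<eta>\<close> is periodic. In the directions \<open>L\<^sub>1\<close> and \<open>L\<^sub>2\<close> the shear of the deck transformation leaves the
  defects \<open>S1\<close> and \<open>S2\<close>, whose sum is \<open>\<eta> \<and> Re d\<omega>\<^sub>3\<close> up to sign, that is \<open>2 Im t\<close> times a positive coefficient \<open>Q\<close>.
\<close>

lemma no_invariant_closed_form:
  fixes f :: "complex ^ 3 \<Rightarrow> complex ^ 3 \<Rightarrow> complex ^ 3 \<Rightarrow> real" and \<rho> :: "complex ^ 3 \<Rightarrow> real"
  assumes t: "Im t \<noteq> 0"
    and C1: "\<And>a b. Ck_on (Suc 0) UNIV (\<lambda>x. f x a b)" "Ck_on (Suc 0) UNIV \<rho>"
    and bil: "\<And>x. bilinear (f x)" and anti: "\<And>x a b. f x b a = - f x a b"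
    and J: "\<And>x a b. f x (J a) (J b) = f x a b"
    and inv: "\<And>a b c x u v. a \<in> gauss \<Longrightarrow> b \<in> gauss \<Longrightarrow> c \<in> gauss \<Longrightarrow>
        f (deck3 t a b c x) (shear a u) (shear a v) = f x u v"
      "\<And>a b c x. a \<in> gauss \<Longrightarrow> b \<in> gauss \<Longrightarrow> c \<in> gauss \<Longrightarrow> \<rho> (deck3 t a b c x) = \<rho> x"
    and pos: "\<And>x. 0 < four_form (\<rho> x) (f x) (axis 1 1) (J (axis 1 1)) (axis 3 1) (J (axis 3 1))"
    and closed: "\<And>x v0 v1 v2 v3 v4.
        fder (\<lambda>y. four_form (\<rho> y) (f y) v1 v2 v3 v4) x v0 - fder (\<lambda>y. four_form (\<rho> y) (f y) v0 v2 v3 v4) x v1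
        + fder (\<lambda>y. four_form (\<rho> y) (f y) v0 v1 v3 v4) x v2 - fder (\<lambda>y. four_form (\<rho> y) (f y) v0 v1 v2 v4) x v3
        + fder (\<lambda>y. four_form (\<rho> y) (f y) v0 v1 v2 v3) x v4 = 0"
  shows False
proof -
  define \<eta> where "\<eta> = (\<lambda>a b c d x. four_form (\<rho> x) (f x) a b c d)"
  have \<eta>1: "Ck_on (Suc 0) UNIV (\<eta> a b c d)" for a b c d
    unfolding \<eta>_def by (rule four_form_C1[where f = f, OF open_UNIV C1])
  have \<eta>d: "(\<eta> a b c d has_derivative fder (\<eta> a b c d) x) (at x)" for a b c d x
    using \<eta>1[of a b c d] by (simp add: Ck_1_iff flip: frechet_derivative_works)
  have \<eta>Dc: "continuous_on UNIV (\<lambda>x. fder (\<eta> a b c d) x v)" for a b c d v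
    using \<eta>1[of a b c d] by (simp add: Ck_1_iff)
  have \<eta>c: "continuous_on UNIV (\<eta> a b c d)" for a b c d
    by (intro continuous_at_imp_continuous_on ballI has_derivative_continuous[OF \<eta>d])
  have \<eta>inv: "\<eta> (shear a u) (shear a v) (shear a w) (shear a z) (deck3 t a b c x) = \<eta> u v w z x"
    if "a \<in> gauss" "b \<in> gauss" "c \<in> gauss" for a b c x u v w z
    by (simp add: \<eta>_def four_form_def inv[OF that])
  have lin: "linear (\<lambda>u. f x u v)" "linear (f x v)" for x v using bil by (simp_all add: bilinear_def)
  note lins = linear_add[OF lin(1)] linear_add[OF lin(2)] linear_cmul[OF lin(1)] linear_cmul[OF lin(2)]
    linear_diff[OF lin(1)] linear_diff[OF lin(2)] linear_neg[OF lin(1)] linear_neg[OF lin(2)]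
  have f0: "f x a a = 0" for x a using anti[of x a a] by simp
  have JJ: "J (J a) = - a" for a :: "complex ^ 3" by (simp add: vec_eq_iff)
  have Jl: "f x (J a) b = - f x a (J b)" for x a b
    using J[of x a "J b"] by (simp add: JJ lins)
  \<comment> \<open>The directions belong to \<open>a = 1\<close>, \<open>a = \<i>\<close>, \<open>b = 1\<close>, \<open>b = \<i>\<close>, \<open>c = 1\<close> and \<open>c = \<i>\<close>, in this order.\<close>
  define L1 L2 L3 L4 L5 L6 :: "complex ^ 3" where
    L: "L1 = axis 1 1" "L2 = J (axis 1 1)" "L3 = vector [t, 1, 0]" "L4 = vector [- \<i> * t, \<i>, 0]"
       "L5 = axis 3 1" "L6 = J (axis 3 1)"
  have shear_L: "shear a L1 = L1" "shear a L2 = L2" "shear a L5 = L5" "shear a L6 = L6"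
    "shear 1 L3 = L3 + L5" "shear 1 L4 = L4 + L6" "shear \<i> L3 = L3 + L6" "shear \<i> L4 = L4 - L5" for a
    by (simp_all add: L vec_eq_iff forall_3 axis_def)
  have shear_0: "shear 0 v = v" for v by (simp add: vec_eq_iff forall_3)
  have deck_L: "deck3 t 0 1 0 x = x + L3" "deck3 t 0 \<i> 0 x = x + L4" "deck3 t 0 0 1 x = x + L5" "deck3 t 0 0 \<i> x = x + L6"
    "deck3 t 1 0 0 x = x + L1 + (Re (x $ 2) *\<^sub>R L5 + Im (x $ 2) *\<^sub>R L6)"
    "deck3 t \<i> 0 0 x = x + L2 + (- Im (x $ 2) *\<^sub>R L5 + Re (x $ 2) *\<^sub>R L6)" for x
    by (simp_all add: L vec_eq_iff forall_3 axis_def complex_eq_iff)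
  have per: "\<eta> u v w z (x + K) = \<eta> u v w z x" if "K \<in> {L3, L4, L5, L6}" for u v w z x K
    using that \<eta>inv[of 0 1 0 u v w z x] \<eta>inv[of 0 \<i> 0 u v w z x] \<eta>inv[of 0 0 1 u v w z x] \<eta>inv[of 0 0 \<i> u v w z x]
    by (auto simp: shear_0 deck_L)
  \<comment> \<open>The transformations with \<open>a \<noteq> 0\<close> are not translations: they add \<open>a x\<^sub>2\<close> in the central direction.
    Averages over the central torus do not see this term.\<close>
  define fib where "fib = (\<lambda>h. avg L5 (avg L6 h))"
  have fibc: "continuous_on UNIV (fib h)" if "continuous_on UNIV h" for h
    unfolding fib_def by (intro avg_continuous that)
  have fib_shift: "fib h (x + (p *\<^sub>R L5 + q *\<^sub>R L6)) = fib h x"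
    if h: "continuous_on UNIV h" and pr: "\<And>x. h (x + L5) = h x" "\<And>x. h (x + L6) = h x" for h p q x
  proof -
    have p5: "avg L6 h (x + L5) = avg L6 h x" for x
      using avg_translate[of L6 h L5 x] by (simp add: pr)
    have "avg L5 (avg L6 h) (x + q *\<^sub>R L6 + p *\<^sub>R L5) = avg L5 (avg L6 h) (x + q *\<^sub>R L6)"
      by (rule avg_periodic[OF avg_continuous[OF h] p5])
    also have "\<dots> = avg L6 (avg L5 h) (x + q *\<^sub>R L6)" by (simp add: avg_commute[OF h])
    also have "\<dots> = avg L6 (avg L5 h) x"
    proof (rule avg_periodic[OF avg_continuous[OF h]])
      show "avg L5 h (x + L6) = avg L5 h x" for x
        using avg_translate[of L5 h L6 x] by (simp add: pr)
    qed
    also have "\<dots> = fib h x" by (simp add: fib_def avg_commute[OF h])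
    finally show ?thesis by (simp add: fib_def add_ac)
  qed
  have fib_deck: "fib h (deck3 t a 0 0 x) = fib (\<lambda>x. h (deck3 t a 0 0 x)) x" for h a x
  proof -
    have "deck3 t a 0 0 x + s *\<^sub>R L5 + r *\<^sub>R L6 = deck3 t a 0 0 (x + s *\<^sub>R L5 + r *\<^sub>R L6)" for s r
      by (simp add: L vec_eq_iff forall_3 axis_def algebra_simps)
    then show ?thesis by (simp add: fib_def avg_def)
  qed
  define S1 where "S1 = \<eta> L2 L5 L4 L6"
  define S2 where "S2 = \<eta> L1 L3 L5 L6"
  define Q where "Q = \<eta> L1 L2 L5 L6"
  \<comment> \<open>The \<open>J\<close>-invariance of \<open>f\<close> enters here; it makes the contribution of \<open>\<omega>\<^sub>1 \<and> \<omega>\<^sub>2\<close> vanish.\<close>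
  have S12: "S1 x + S2 x = 2 * Im t * Q x" for x
  proof -
    let ?e2 = "axis 2 1 :: complex ^ 3"
    have L34: "L3 = Re t *\<^sub>R L1 + Im t *\<^sub>R J L1 + ?e2" "L4 = Im t *\<^sub>R L1 - Re t *\<^sub>R J L1 + J ?e2"
      by (simp_all add: L vec_eq_iff forall_3 axis_def complex_eq_iff)
    have L26: "L2 = J L1" "L6 = J L5" by (simp_all add: L)
    have sym: "f x ?e2 (J L5) = f x L5 (J ?e2)" "f x L5 (J L1) = f x L1 (J L5)" "f x ?e2 (J L1) = f x L1 (J ?e2)"
      using anti[of x "J ?e2" L5] Jl[of x ?e2 L5] anti[of x "J L5" L1] Jl[of x L5 L1] anti[of x "J ?e2" L1] Jl[of x ?e2 L1]
      by simp_all
    show ?thesis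
      unfolding S1_def S2_def Q_def \<eta>_def four_form_def L34 L26
      by (simp add: lins Jl JJ f0 anti[of x L1 L5] anti[of x ?e2 L5] anti[of x L1 ?e2]
          sym algebra_simps)
  qed
  have \<eta>lin: "\<eta> u (v + v') w z x = \<eta> u v w z x + \<eta> u v' w z x" "\<eta> u v (w + w') z x = \<eta> u v w z x + \<eta> u v w' z x"
    "\<eta> u v (w - w') z x = \<eta> u v w z x - \<eta> u v w' z x" "\<eta> u v w w x = 0" "\<eta> u v w v x = 0" "\<eta> u v v w x = 0" for u v v' w w' z x
    by (simp_all add: \<eta>_def four_form_def lins f0 algebra_simps anti[of x v w])
  \<comment> \<open>The coefficients of \<open>\<eta>\<close> that are differentiated along \<open>L\<^sub>1\<close> and along \<open>L\<^sub>2\<close>.\<close>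
  define f1 where "f1 = \<eta> L2 L3 L4 L6"
  define f2 where "f2 = \<eta> L1 L3 L4 L6"
  have Sc: "continuous_on UNIV S1" "continuous_on UNIV S2" "continuous_on UNIV Q"
    "continuous_on UNIV f1" "continuous_on UNIV f2"
    by (simp_all add: S1_def S2_def Q_def f1_def f2_def \<eta>c)
  have S_deck: "S1 (deck3 t 1 0 0 x) = S1 x" "S1 (deck3 t \<i> 0 0 x) = S1 x"
    "S2 (deck3 t 1 0 0 x) = S2 x" "S2 (deck3 t \<i> 0 0 x) = S2 x" for x
    using \<eta>inv[of 1 0 0 L2 L5 L4 L6 x] \<eta>inv[of \<i> 0 0 L2 L5 L4 L6 x] \<eta>inv[of 1 0 0 L1 L3 L5 L6 x] \<eta>inv[of \<i> 0 0 L1 L3 L5 L6 x]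
    by (simp_all add: S1_def S2_def shear_L \<eta>lin)
  have f1_deck: "f1 (deck3 t 1 0 0 x) = f1 x - S1 x" for x
    using \<eta>inv[of 1 0 0 L2 L3 L4 L6 x] S_deck(1)[of x]
    by (simp add: f1_def S1_def shear_L \<eta>lin)
  have f2_deck: "f2 (deck3 t \<i> 0 0 x) = f2 x + S2 x" for x
    using \<eta>inv[of \<i> 0 0 L1 L3 L4 L6 x] S_deck(4)[of x]
    by (simp add: f2_def S2_def shear_L \<eta>lin)
  have fib_add: "fib (\<lambda>x. p x + q x) x = fib p x + fib q x"
    if "continuous_on UNIV p" "continuous_on UNIV q" for p q x
  proof -
    have "avg L6 (\<lambda>x. p x + q x) = (\<lambda>x. avg L6 p x + avg L6 q x)" using avg_add[OF that] by (simp add: fun_eq_iff)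
    then show ?thesis unfolding fib_def by (simp add: avg_add avg_continuous that)
  qed
  have fib_cm: "fib (\<lambda>x. k * p x) x = k * fib p x" for k p x
  proof -
    have "avg L6 (\<lambda>x. k * p x) = (\<lambda>x. k * avg L6 p x)" by (simp add: fun_eq_iff avg_cmult)
    then show ?thesis unfolding fib_def by (simp add: avg_cmult)
  qed
  have fib_L: "fib h (x + L1) = fib (\<lambda>x. h (deck3 t 1 0 0 x)) x" "fib h (x + L2) = fib (\<lambda>x. h (deck3 t \<i> 0 0 x)) x"
    if h: "continuous_on UNIV h" and pr: "\<And>x. h (x + L5) = h x" "\<And>x. h (x + L6) = h x" for h x
    unfolding fib_deck[of h 1 x, symmetric] fib_deck[of h \<i> x, symmetric] deck_L(5)[of x] deck_L(6)[of x]
    by (rule fib_shift[OF h pr, symmetric])+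
  have perS: "S1 (x + L5) = S1 x" "S1 (x + L6) = S1 x" "S2 (x + L5) = S2 x" "S2 (x + L6) = S2 x"
    "f1 (x + L5) = f1 x" "f1 (x + L6) = f1 x" "f2 (x + L5) = f2 x" "f2 (x + L6) = f2 x" for x
    unfolding S1_def S2_def f1_def f2_def by (simp_all add: per)
  have fibS: "fib S1 (x + L2) = fib S1 x" "fib S2 (x + L1) = fib S2 x" for x
    using fib_L(2)[OF Sc(1) perS(1,2)] fib_L(1)[OF Sc(2) perS(3,4)] by (simp_all add: S_deck)
  have fib1: "fib f1 (x + L1) - fib f1 x = - fib S1 x" for x
    using fib_L(1)[OF Sc(4) perS(5,6), of x] fib_add[of f1 "\<lambda>x. -1 * S1 x" x] fib_cm[of "-1" S1 x] Sc
    by (simp add: f1_deck continuous_on_minus)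
  have fib2: "fib f2 (x + L2) - fib f2 x = fib S2 x" for x
    using fib_L(2)[OF Sc(5) perS(7,8), of x] fib_add[of f2 S2 x] Sc
    by (simp add: f2_deck)
  \<comment> \<open>The full average is split, because \<open>S1\<close> and \<open>S2\<close> are periodic in \<open>L\<^sub>2\<close> and \<open>L\<^sub>1\<close>, respectively, only
    after averaging over the central torus.\<close>
  define T where "T = (\<lambda>h. avg L3 (avg L4 (fib h)))"
  define A where "A = (\<lambda>h. avg L1 (avg L2 (T h)))"
  have Tc: "continuous_on UNIV (T h)" if "continuous_on UNIV h" for h
    unfolding T_def by (intro avg_continuous fibc that)
  have fib_comm: "avg K (fib h) = fib (avg K h)" if "continuous_on UNIV h" for K h
    unfolding fib_def using that by (simp add: avg_commute[of _ K] avg_continuous)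
  have T_comm: "avg K (T h) = T (avg K h)" if "continuous_on UNIV h" for K h
    unfolding T_def using that by (simp add: avg_commute[of _ K] avg_continuous fibc fib_comm)
  have A_add: "A (\<lambda>x. p x + q x) x = A p x + A q x"
    if c: "continuous_on UNIV p" "continuous_on UNIV q" for p q x
  proof -
    have "fib (\<lambda>x. p x + q x) = (\<lambda>x. fib p x + fib q x)" using fib_add[OF c] by (simp add: fun_eq_iff)
    then have "avg L4 (fib (\<lambda>x. p x + q x)) = (\<lambda>x. avg L4 (fib p) x + avg L4 (fib q) x)"
      using avg_add[OF fibc[OF c(1)] fibc[OF c(2)]] by (intro ext) simp
    then have "T (\<lambda>x. p x + q x) = (\<lambda>x. T p x + T q x)"
      unfolding T_def using avg_add[OF avg_continuous[OF fibc[OF c(1)]] avg_continuous[OF fibc[OF c(2)]]] by (intro ext) simp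
    then have "avg L2 (T (\<lambda>x. p x + q x)) = (\<lambda>x. avg L2 (T p) x + avg L2 (T q) x)"
      using avg_add[OF Tc[OF c(1)] Tc[OF c(2)]] by (intro ext) simp
    then show ?thesis
      unfolding A_def using avg_add[OF avg_continuous[OF Tc[OF c(1)]] avg_continuous[OF Tc[OF c(2)]]] by simp
  qed
  have avg_cm: "avg K (\<lambda>x. k * p x) = (\<lambda>x. k * avg K p x)" for K k and p :: "complex ^ 3 \<Rightarrow> real"
    by (simp add: fun_eq_iff avg_cmult)
  have T_cm: "T (\<lambda>x. k * p x) = (\<lambda>x. k * T p x)" for k p
    unfolding T_def fib_def by (simp add: avg_cm)
  have A_cm: "A (\<lambda>x. k * p x) = (\<lambda>x. k * A p x)" for k p
    unfolding A_def by (simp add: T_cm avg_cm)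
  have avg0: "avg K (\<lambda>x. 0) = (\<lambda>x. 0 :: real)" for K :: "complex ^ 3" by (simp add: avg_def fun_eq_iff)
  have fib_diff: "fib (\<lambda>x. h (x + K) - h x) x = fib h (x + K) - fib h x" if h: "continuous_on UNIV h" for h K x
  proof -
    have c: "continuous_on UNIV (\<lambda>x. h (x + K))"
      by (rule continuous_on_compose2[OF h]) (auto intro!: continuous_intros)
    have "fib (\<lambda>x. h (x + K)) x = fib h (x + K)"
      by (simp add: fib_def avg_def add_ac)
    then show ?thesis
      using fib_add[OF c, of "\<lambda>x. -1 * h x" x] fib_cm[of "-1" h x] h by (simp add: continuous_on_minus)
  qed
  define D where "D = (\<lambda>u v w z K x. fder (\<eta> u v w z) x K)"
  have Dc: "continuous_on UNIV (D u v w z K)" for u v w z K unfolding D_def by (rule \<eta>Dc)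
  have avgD: "avg K (D u v w z K) = (\<lambda>x. \<eta> u v w z (x + K) - \<eta> u v w z x)" for u v w z K
    unfolding D_def using avg_deriv[OF \<eta>d] by (simp add: fun_eq_iff)
  have A1: "A (D L2 L3 L4 L6 L1) x = - avg L2 (T S1) x" for x
  proof -
    have "fib (avg L1 (D L2 L3 L4 L6 L1)) = (\<lambda>x. - 1 * fib S1 x)"
      unfolding avgD f1_def[symmetric] by (simp add: fun_eq_iff fib_diff[OF Sc(4)] fib1)
    then have "T (avg L1 (D L2 L3 L4 L6 L1)) = (\<lambda>x. - 1 * T S1 x)" unfolding T_def by (simp only: avg_cm)
    then have "avg L2 (T (avg L1 (D L2 L3 L4 L6 L1))) x = - avg L2 (T S1) x" using avg_cm[of L2 "-1" "T S1"] by simp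
    moreover have "A (D L2 L3 L4 L6 L1) = avg L2 (T (avg L1 (D L2 L3 L4 L6 L1)))"
      unfolding A_def T_comm[OF Dc, of L1, symmetric] by (rule avg_commute[OF Tc[OF Dc]])
    ultimately show ?thesis by simp
  qed
  have A2: "A (D L1 L3 L4 L6 L2) x = avg L1 (T S2) x" for x
  proof -
    have "fib (avg L2 (D L1 L3 L4 L6 L2)) = fib S2"
      unfolding avgD f2_def[symmetric] by (simp add: fun_eq_iff fib_diff[OF Sc(5)] fib2)
    then have "T (avg L2 (D L1 L3 L4 L6 L2)) = T S2" unfolding T_def by simp
    then show ?thesis unfolding A_def by (simp add: T_comm Dc)
  qed
  have A3: "A (D u v w z L3) x = 0" for u v w z x
  proof -
    have "avg L3 (D u v w z L3) = (\<lambda>x. 0)" unfolding avgD by (simp add: per)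
    then have "T (D u v w z L3) = (\<lambda>x. 0)"
      unfolding T_def avg_commute[OF fibc[OF Dc], of L3 L4] fib_comm[OF Dc, of L3] by (simp add: fib_def avg0)
    then show ?thesis unfolding A_def by (simp add: avg0)
  qed
  have A4: "A (D u v w z L4) x = 0" for u v w z x
  proof -
    have "avg L4 (D u v w z L4) = (\<lambda>x. 0)" unfolding avgD by (simp add: per)
    then have "T (D u v w z L4) = (\<lambda>x. 0)"
      unfolding T_def fib_comm[OF Dc] by (simp add: fib_def avg0)
    then show ?thesis unfolding A_def by (simp add: avg0)
  qed
  have A6: "A (D u v w z L6) x = 0" for u v w z x
  proof -
    have "avg L6 (D u v w z L6) = (\<lambda>x. 0)" unfolding avgD by (simp add: per)
    then have "T (D u v w z L6) = (\<lambda>x. 0)" unfolding T_def fib_def by (simp add: avg0)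
    then show ?thesis unfolding A_def by (simp add: avg0)
  qed
  define N where "N = (\<lambda>u v w z K x. - 1 * D u v w z K x)"
  have Nc: "continuous_on UNIV (N u v w z K)" for u v w z K
    unfolding N_def by (intro continuous_intros Dc)
  have AN: "A (N u v w z K) x = - A (D u v w z K) x" for u v w z K x
    using A_cm[of "- 1" "D u v w z K"] by (simp add: N_def)
  \<comment> \<open>The equation \<open>d\<eta> = 0\<close> on \<open>L\<^sub>1, L\<^sub>2, L\<^sub>3, L\<^sub>4, L\<^sub>6\<close>.\<close>
  have "(\<lambda>x. D L2 L3 L4 L6 L1 x + (N L1 L3 L4 L6 L2 x + (D L1 L2 L4 L6 L3 x + (N L1 L2 L3 L6 L4 x + D L1 L2 L3 L4 L6 x)))) = (\<lambda>x. 0)"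
    using closed[of L2 L3 L4 L6 _ L1] unfolding N_def D_def \<eta>_def by (simp add: fun_eq_iff algebra_simps)
  then have "A (\<lambda>x. D L2 L3 L4 L6 L1 x + (N L1 L3 L4 L6 L2 x + (D L1 L2 L4 L6 L3 x + (N L1 L2 L3 L6 L4 x + D L1 L2 L3 L4 L6 x)))) x = 0" for x
    by (simp only:) (simp add: A_def T_def fib_def avg0)
  then have "A (D L2 L3 L4 L6 L1) x + (A (N L1 L3 L4 L6 L2) x + (A (D L1 L2 L4 L6 L3) x
      + (A (N L1 L2 L3 L6 L4) x + A (D L1 L2 L3 L4 L6) x))) = 0" for x
    by (simp add: A_add Dc Nc continuous_on_add)
  then have sum0: "avg L2 (T S1) x + avg L1 (T S2) x = 0" for x
    unfolding AN A1 A2 A3 A4 A6 by (simp add: add_eq_0_iff)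
  have TS: "T S1 (x + L2) = T S1 x" "T S2 (x + L1) = T S2 x" for x
    using fibS by (simp_all add: T_def flip: avg_translate)
  \<comment> \<open>In \<open>sum0\<close> each defect lacks the average in one direction. Averaging again in both directions
    supplies it, and changes nothing in the other direction.\<close>
  have "A S1 x + A S2 x = 0" for x
  proof -
    have "avg L1 (avg L2 (\<lambda>x. avg L2 (T S1) x + avg L1 (T S2) x)) x = 0"
      unfolding sum0 by (simp add: avg0)
    moreover have "avg L2 (\<lambda>x. avg L2 (T S1) x + avg L1 (T S2) x) = (\<lambda>x. avg L2 (T S1) x + avg L2 (avg L1 (T S2)) x)"
      using avg_add[OF avg_continuous[OF Tc[OF Sc(1)]] avg_continuous[OF Tc[OF Sc(2)]]] avg_idem[OF Tc[OF Sc(1)] TS(1)] by (intro ext) simp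
    moreover have "avg L1 (avg L2 (avg L1 (T S2))) = A S2"
      using avg_commute[OF avg_continuous[OF Tc[OF Sc(2)]], of L1 L2 L1] avg_commute[OF Tc[OF Sc(2)], of L1 L2]
        avg_idem[OF Tc[OF Sc(2)] TS(2)] by (simp add: A_def)
    ultimately show ?thesis
      using avg_add[OF avg_continuous[OF Tc[OF Sc(1)]] avg_continuous[OF avg_continuous[OF Tc[OF Sc(2)]]], of L1 L2 L2 L1 x]
      by (simp add: A_def)
  qed
  then have "A (\<lambda>x. S1 x + S2 x) 0 = 0" using A_add[OF Sc(1,2)] by simp
  then have "2 * Im t * A Q 0 = 0" unfolding S12 A_cm .
  moreover have "0 < A Q 0"
    unfolding A_def T_def fib_def
    by (intro avg_pos avg_continuous Sc) (use pos in \<open>simp add: Q_def \<eta>_def L\<close>)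
  ultimately show False using t by simp
qed

section \<open>Conformally balanced metrics on the fibres\<close>

lemma Ck_on_local:
  assumes "\<And>x. x \<in> S \<Longrightarrow> \<exists>T. open T \<and> x \<in> T \<and> Ck_on k T f"
  shows "Ck_on k S f"
  using assms
proof (induction k arbitrary: f)
  case 0
  have "isCont f x" if "x \<in> S" for x
    using 0[OF that] continuous_on_eq_continuous_at by auto
  then show ?case by (auto intro: continuous_at_imp_continuous_on)
next
  case (Suc k)
  have "f differentiable (at x)" if "x \<in> S" for x
    using Suc.prems[OF that] by auto
  moreover have "Ck_on k S (\<lambda>x. fder f x v)" for v
  proof (rule Suc.IH)
    fix x assume "x \<in> S"
    from Suc.prems[OF this] show "\<exists>T. open T \<and> x \<in> T \<and> Ck_on k T (\<lambda>x. fder f x v)" by auto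
  qed
  ultimately show ?case by simp
qed

text \<open>
  The norm of a volume form involves square roots and a quotient of positive functions; one continuous
  derivative is all that the averaging argument needs of it.
\<close>

lemma Ck_1_compose:
  fixes h :: "'a::euclidean_space \<Rightarrow> real"
  assumes S: "open S" and h: "Ck_on (Suc 0) S h" and pos: "\<And>x. x \<in> S \<Longrightarrow> 0 < h x"
    and \<phi>: "\<And>y. 0 < y \<Longrightarrow> (\<phi> has_real_derivative \<phi>' y) (at y)" and c: "continuous_on {0<..} \<phi>'"
  shows "Ck_on (Suc 0) S (\<lambda>x. \<phi> (h x))"
proof -
  have hd: "(h has_derivative fder h x) (at x)" if "x \<in> S" for x
    using h that by (auto simp flip: frechet_derivative_works)
  have hc: "continuous_on S h"
    using Ck_on_Suc_imp[OF h] by simp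
  have d: "((\<lambda>x. \<phi> (h x)) has_derivative (\<lambda>v. \<phi>' (h x) * fder h x v)) (at x)" if "x \<in> S" for x
    using has_derivative_compose[OF hd[OF that] \<phi>[OF pos[OF that], unfolded has_field_derivative_def]] .
  have "continuous_on S (\<lambda>x. fder (\<lambda>x. \<phi> (h x)) x v)" for v
  proof -
    have "continuous_on S (\<lambda>x. \<phi>' (h x) * fder h x v)"
      by (intro continuous_on_mult continuous_on_compose2[OF c hc]) (use pos h in auto)
    then show ?thesis by (rule continuous_on_eq) (simp add: fder_eq[OF d])
  qed
  then show ?thesis using d by (auto simp: differentiable_def)
qed

lemma smooth_imp_C1: "smooth_on S f \<Longrightarrow> Ck_on (Suc 0) S f"
  unfolding smooth_on_def by blast

text \<open>
  The linear algebra of a Hermitian metric at a point. Positivity of the four-form on a complex plane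
  is what Stokes' theorem contradicts; positivity and invariance of the Gram determinant make the norm of a volume
  form an admissible conformal factor.
\<close>

locale hermitian_product =
  fixes h :: "complex ^ 3 \<Rightarrow> complex ^ 3 \<Rightarrow> real"
  assumes bil: "bilinear h" and sym: "h v w = h w v" and pos: "v \<noteq> 0 \<Longrightarrow> 0 < h v v"
    and J: "h (J v) (J w) = h v w"
begin

lemma lin: "linear (\<lambda>u. h u v)" "linear (h v)"
  using bil by (simp_all add: bilinear_def)

lemmas lins = linear_add[OF lin(1)] linear_add[OF lin(2)] linear_cmul[OF lin(1)] linear_cmul[OF lin(2)]
  linear_diff[OF lin(1)] linear_diff[OF lin(2)] linear_neg[OF lin(1)] linear_neg[OF lin(2)]

lemma J_left: "h (J v) w = - h v (J w)"
proof -
  have "J (J v) = - v" by (simp add: vec_eq_iff)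
  then show ?thesis using J[of "J v" w] by (simp add: lins)
qed

lemma J_self: "h v (J v) = 0"
  using J_left[of v v] sym[of v "J v"] by simp

text \<open>
  On a complex plane with basis \<open>e\<close>, \<open>k\<close> this is the strict Cauchy-Schwarz inequality for the
  sesquilinear extension of \<open>h\<close>.
\<close>

lemma four_form_pos:
  assumes "0 < \<rho>"
  shows "0 < four_form \<rho> (\<lambda>a b. h (J a) b) (axis 1 1) (J (axis 1 1)) (axis 3 1) (J (axis 3 1))"
proof -
  let ?e = "axis 1 1 :: complex ^ 3" and ?k = "axis 3 1 :: complex ^ 3"
  define A B p q where "A = h ?e ?e" and "B = h ?k ?k" and "p = h ?e ?k" and "q = h ?e (J ?k)"
  have JJ: "J (J v) = - v" for v :: "complex ^ 3" by (simp add: vec_eq_iff)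
  have ne: "?e \<noteq> 0" by (simp add: axis_eq_0_iff)
  have A: "0 < A" unfolding A_def by (rule pos[OF ne])
  \<comment> \<open>A multiple of the component of \<open>k\<close> orthogonal to the complex line of \<open>e\<close>.\<close>
  define v where "v = A *\<^sub>R ?k - p *\<^sub>R ?e + q *\<^sub>R J ?e"
  have "v $ 3 = complex_of_real A" by (simp add: v_def axis_def scaleR_conv_of_real[of A 1])
  then have "v \<noteq> 0" using A by (metis of_real_eq_0_iff order_less_irrefl zero_index)
  then have "0 < h v v" by (rule pos)
  also have "h v v = A * (A * B - p * p - q * q)"
    unfolding v_def
    by (simp add: lins J J_left J_self sym[of ?k ?e] sym[of ?k "J ?e"] algebra_simps flip: A_def B_def p_def q_def)
  finally have "0 < A * B - p * p - q * q" using A by (simp add: zero_less_mult_iff)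
  moreover have "four_form \<rho> (\<lambda>a b. h (J a) b) ?e (J ?e) ?k (J ?k) = \<rho> * (A * B - p * p - q * q)"
    unfolding four_form_def JJ by (simp add: lins J J_left flip: A_def B_def p_def q_def)
  ultimately show ?thesis using assms by simp
qed

definition H :: "complex ^ 3 \<Rightarrow> complex ^ 3 \<Rightarrow> complex" where
  "H v w = Complex (h v w) (h v (J w))"

lemma H_add: "H (u + v) w = H u w + H v w" "H w (u + v) = H w u + H w v"
  by (simp_all add: H_def lins complex_eq_iff vector_add_ldistrib)

lemma smult_split: "a *s v = Re a *\<^sub>R v + Im a *\<^sub>R J (v :: complex ^ 3)"
  by (simp add: vec_eq_iff complex_eq_iff)

lemma H_smult: "H (a *s v) w = a * H v w" "H v (a *s w) = cnj a * H v w"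
proof -
  have JJ: "J (J v) = - v" for v :: "complex ^ 3" by (simp add: vec_eq_iff)
  have JR: "J (r *\<^sub>R v) = r *\<^sub>R J v" for r and v :: "complex ^ 3" by (simp add: vec_eq_iff)
  show "H (a *s v) w = a * H v w" "H v (a *s w) = cnj a * H v w"
    unfolding smult_split[of a]
    by (simp_all add: H_def complex_eq_iff lins J J_left vector_add_ldistrib JJ JR algebra_simps)
qed

lemma H_cnj: "cnj (H v w) = H w v"
  using sym[of v w] J_left[of w v] sym[of "J w" v] by (simp add: H_def complex_eq_iff)

lemma H_pos: "v \<noteq> 0 \<Longrightarrow> 0 < Re (H v v)"
  using pos by (simp add: H_def)

text \<open>
  The vector of cofactors of the last row is orthogonal to the first two basis vectors, and its
  squared length is a minor times the determinant; the same argument applies to the minor.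
\<close>

lemma gram_pos:
  defines "b \<equiv> \<lambda>k::3. axis k 1 :: complex ^ 3"
  shows "0 < Re (det (\<chi> j k. Complex (h (b j) (b k)) (h (b j) (J (b k))) :: complex ^ 3 ^ 3))"
proof -
  define K where "K = (\<lambda>j k. H (b j) (b k))"
  have cK: "cnj (K j k) = K k j" for j k by (simp add: K_def H_cnj)
  have HK: "H (b j) (b k) = K j k" for j k by (simp add: K_def)
  have b0: "b k \<noteq> 0" for k by (simp add: b_def axis_eq_0_iff)
  define d where "d = det (\<chi> j k. K j k :: complex ^ 3 ^ 3)"
  have k11: "0 < Re (K 1 1)" "Im (K 1 1) = 0"
    using H_pos[OF b0] J_self by (simp_all add: K_def) (simp add: H_def J_self)
  define M where "M = K 1 1 * K 2 2 - K 1 2 * K 2 1"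
  have cM: "cnj M = M" by (simp add: M_def cK algebra_simps)
  then have iM: "Im M = 0" by (simp add: complex_eq_iff)
  define v where "v = K 1 1 *s b 2 + (- K 2 1) *s b 1"
  have "v $ 2 = K 1 1" by (simp add: v_def b_def axis_def)
  then have "v \<noteq> 0" using k11 by (metis zero_complex.simps(1) zero_index order_less_irrefl)
  then have "0 < Re (H v v)" by (rule H_pos)
  also have "H v v = K 1 1 * M"
    unfolding v_def M_def H_add H_smult by (simp add: cK HK algebra_simps)
  finally have rM: "0 < Re M" using k11 by (simp add: iM zero_less_mult_iff)
  define u where "u = (K 2 1 * K 3 2 - K 2 2 * K 3 1) *s b 1 + (K 3 1 * K 1 2 - K 1 1 * K 3 2) *s b 2 + M *s b 3"
  have "u $ 3 = M" by (simp add: u_def b_def axis_def)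
  then have "u \<noteq> 0" using rM by (metis zero_complex.simps(1) zero_index order_less_irrefl)
  then have "0 < Re (H u u)" by (rule H_pos)
  also have "H u u = M * d"
    unfolding u_def d_def det_3 H_add H_smult cM M_def
    by (simp add: cK HK algebra_simps)
  finally have "0 < Re d" using rM by (simp add: iM zero_less_mult_iff)
  then show ?thesis by (simp add: d_def K_def H_def)
qed

text \<open>
  A shear is a unipotent change of basis.
\<close>

lemma gram_shear:
  defines "b \<equiv> \<lambda>k::3. axis k 1 :: complex ^ 3"
  shows "det (\<chi> j k. Complex (h (shear a (b j)) (shear a (b k))) (h (shear a (b j)) (shear a (J (b k)))) :: complex ^ 3 ^ 3)
     = det (\<chi> j k. Complex (h (b j) (b k)) (h (b j) (J (b k))) :: complex ^ 3 ^ 3)"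
proof -
  have s: "shear a (J v) = J (shear a v)" for v by (simp add: vec_eq_iff forall_3 algebra_simps)
  have sb: "shear a (b 1) = b 1" "shear a (b 2) = b 2 + a *s b 3" "shear a (b 3) = b 3"
    by (simp_all add: b_def vec_eq_iff forall_3 axis_def)
  have "det (\<chi> j k. H (shear a (b j)) (shear a (b k)) :: complex ^ 3 ^ 3) = det (\<chi> j k. H (b j) (b k) :: complex ^ 3 ^ 3)"
    by (simp add: det_3 sb H_add H_smult algebra_simps)
  then show ?thesis unfolding s H_def .
qed

end

text \<open>
  Expansion in the standard basis leaves only the six terms with distinct basis vectors. So a volume form is
  a single function in a chart, and that function is unchanged by shears, which have determinant one.
\<close>

lemma alternating_3_det:
  assumes alt: "alternating_form 3 \<omega>" and hom: "\<And>v i a. i < 3 \<Longrightarrow> \<omega> (v(i := a *s v i)) = a * \<omega> v"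
  shows "\<omega> v = det3 (v 0) (v 1) (v 2) * \<omega> (\<lambda>i. axis (of_nat (Suc i)) 1 :: complex ^ 3)"
proof -
  define s where "s = (\<lambda>(x :: complex ^ 3) y z i. if i = 0 then x else if i = (1::nat) then y else z)"
  define \<psi> where "\<psi> = (\<lambda>x y z. \<omega> (s x y z))"
  have s: "s x y z 0 = x" "s x y z (Suc 0) = y" "s x y z 2 = z" for x y z by (simp_all add: s_def)
  have "\<forall>v w. (\<forall>i<3. v i = w i) \<longrightarrow> \<omega> v = \<omega> w"
    using alt unfolding alternating_form_def by (rule conjunct1)
  moreover have "\<forall>i<3. v i = w i" if "v 0 = w 0" "v (Suc 0) = w (Suc 0)" "v 2 = w 2" for v w :: "nat \<Rightarrow> complex ^ 3"
    using that less_3_cases by (metis One_nat_def)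
  ultimately have dep: "\<omega> v = \<omega> w" if "v 0 = w 0" "v (Suc 0) = w (Suc 0)" "v 2 = w 2" for v w
    using that by presburger
  have upd0: "\<psi> x y z = \<omega> ((s x' y z)(0 := x))" for x y z x'
    unfolding \<psi>_def by (rule dep) (simp_all add: s)
  have upd1: "\<psi> x y z = \<omega> ((s x y' z)(Suc 0 := y))" for x y y' z
    unfolding \<psi>_def by (rule dep) (simp_all add: s)
  have upd2: "\<psi> x y z = \<omega> ((s x y z')(2 := z))" for x y z z'
    unfolding \<psi>_def by (rule dep) (simp_all add: s)
  have linu: "linear (\<lambda>u. \<omega> (v(i := u)))" if "i < 3" for v i
  proof -
    have "\<forall>v. \<forall>i<3. linear (\<lambda>u. \<omega> (v(i := u)))"
      using alt unfolding alternating_form_def by (elim conjE)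
    then show ?thesis using that by blast
  qed
  have add0: "\<psi> (x + x') y z = \<psi> x y z + \<psi> x' y z" for x x' y z
    unfolding upd0[of _ y z 0] by (rule linear_add[OF linu]) simp
  have add1: "\<psi> x (y + y') z = \<psi> x y z + \<psi> x y' z" for x y y' z
    unfolding upd1[of x _ z 0] by (rule linear_add[OF linu]) simp
  have add2: "\<psi> x y (z + z') = \<psi> x y z + \<psi> x y z'" for x y z z'
    unfolding upd2[of x y _ 0] by (rule linear_add[OF linu]) simp
  note add = add0 add1 add2
  have sm: "\<psi> (a *s x) y z = a * \<psi> x y z" "\<psi> x (a *s y) z = a * \<psi> x y z" "\<psi> x y (a *s z) = a * \<psi> x y z" for a x y z
  proof -
    have \<psi>s: "\<omega> (s x y z) = \<psi> x y z" by (simp add: \<psi>_def)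
    show "\<psi> (a *s x) y z = a * \<psi> x y z" using hom[of 0 "s x y z" a] by (simp add: s \<psi>s upd0[of "a *s x" y z x])
    show "\<psi> x (a *s y) z = a * \<psi> x y z" using hom[of "Suc 0" "s x y z" a] by (simp add: s \<psi>s upd1[of x "a *s y" z y])
    show "\<psi> x y (a *s z) = a * \<psi> x y z" using hom[of 2 "s x y z" a] by (simp add: s \<psi>s upd2[of x y "a *s z" z])
  qed
  have rep: "\<psi> x x z = 0" "\<psi> x y x = 0" "\<psi> x y y = 0" for x y z
  proof -
    have r: "\<omega> v = 0" if "i < 3" "j < 3" "i \<noteq> j" "v i = v j" for v i j
    proof -
      have "\<forall>v. \<forall>i<3. \<forall>j<3. i \<noteq> j \<and> v i = v j \<longrightarrow> \<omega> v = 0"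
        using alt unfolding alternating_form_def by (elim conjE)
      then show ?thesis using that by blast
    qed
    show "\<psi> x x z = 0" unfolding \<psi>_def by (rule r[of 0 "Suc 0"]) (simp_all add: s)
    show "\<psi> x y x = 0" unfolding \<psi>_def by (rule r[of 0 2]) (simp_all add: s)
    show "\<psi> x y y = 0" unfolding \<psi>_def by (rule r[of "Suc 0" 2]) (simp_all add: s)
  qed
  have sw: "\<psi> y x z = - \<psi> x y z" "\<psi> x z y = - \<psi> x y z" for x y z
    using rep(1)[of "x + y" z, unfolded add] rep(3)[of x "y + z", unfolded add]
    by (simp_all add: rep eq_neg_iff_add_eq_0 add.commute)
  let ?b = "\<lambda>k::3. axis k 1 :: complex ^ 3"
  have ord: "\<psi> (?b 1) (?b 3) (?b 2) = - \<psi> (?b 1) (?b 2) (?b 3)" "\<psi> (?b 2) (?b 1) (?b 3) = - \<psi> (?b 1) (?b 2) (?b 3)"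
    "\<psi> (?b 2) (?b 3) (?b 1) = \<psi> (?b 1) (?b 2) (?b 3)" "\<psi> (?b 3) (?b 1) (?b 2) = \<psi> (?b 1) (?b 2) (?b 3)"
    "\<psi> (?b 3) (?b 2) (?b 1) = - \<psi> (?b 1) (?b 2) (?b 3)"
    using sw(1)[of "?b 1" "?b 2" "?b 3"] sw(2)[of "?b 1" "?b 2" "?b 3"] sw(2)[of "?b 2" "?b 1" "?b 3"]
      sw(1)[of "?b 1" "?b 3" "?b 2"] sw(1)[of "?b 2" "?b 3" "?b 1"] by simp_all
  have main: "\<psi> x y z = det3 x y z * \<psi> (?b 1) (?b 2) (?b 3)" for x y z
  proof -
    have "\<psi> x y z = \<psi> (x $ 1 *s ?b 1 + x $ 2 *s ?b 2 + x $ 3 *s ?b 3) (y $ 1 *s ?b 1 + y $ 2 *s ?b 2 + y $ 3 *s ?b 3)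
        (z $ 1 *s ?b 1 + z $ 2 *s ?b 2 + z $ 3 *s ?b 3)"
      by (simp only: basis_expansion_3[symmetric])
    also have "\<dots> = det3 x y z * \<psi> (?b 1) (?b 2) (?b 3)"
      unfolding add sm rep ord det3_def mult_zero_right add_0_left add_0_right mult_minus_right
      by (simp only: left_diff_distrib distrib_right right_diff_distrib distrib_left mult.assoc) simp
    finally show ?thesis .
  qed
  have v: "\<omega> v = \<psi> (v 0) (v 1) (v 2)" unfolding \<psi>_def by (rule dep) (simp_all add: s)
  have b: "\<omega> (\<lambda>i. ?b (of_nat (Suc i))) = \<psi> (?b 1) (?b 2) (?b 3)"
    unfolding \<psi>_def by (rule dep) (simp_all add: s)
  show ?thesis unfolding v b by (rule main)
qed

lemma hermitian_productI:
  assumes "hermitian_metric (fibre t) g" "c \<in> atlas (fibre t)" "x \<in> snd c ` fst c"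
  shows "hermitian_product (g c x)"
  using assms unfolding hermitian_metric_def hermitian_product_def by blast

lemma hermitian_metric_transition:
  assumes "hermitian_metric M g" "c \<in> atlas M" "c' \<in> atlas M" "p \<in> fst c \<inter> fst c'"
  shows "g c (snd c p) v w = g c' (snd c' p) (jac c c' p v) (jac c c' p w)"
proof -
  have "\<forall>c\<in>atlas M. \<forall>c'\<in>atlas M. \<forall>p \<in> fst c \<inter> fst c'. \<forall>v w.
        g c (snd c p) v w = g c' (snd c' p) (jac c c' p v) (jac c c' p w)"
    using assms(1) unfolding hermitian_metric_def by (rule conjunct2)
  from bspec[OF bspec[OF bspec[OF this assms(2)] assms(3)] assms(4)] show ?thesis by (elim allE)
qed

lemma hermitian_metric_smooth:
  assumes "hermitian_metric M g" "c \<in> atlas M"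
  shows "smooth_on (snd c ` fst c) (\<lambda>x. g c x v w)"
  using assms by (simp add: hermitian_metric_def)

text \<open>
  Two points of one orbit determine the deck transformation between them, so the one that
  \<open>fchart_transition\<close> provides is the given one.
\<close>

lemma fchart_transition_deck:
  assumes B: "evenly_covering B" "put_last t x \<in> B" and B': "evenly_covering B'" "put_last t (deck3 t a b c x) \<in> B'"
    and abc: "a \<in> gauss" "b \<in> gauss" "c \<in> gauss"
  shows "jac (fchart t B) (fchart t B') (orbit_cls (put_last t x)) = shear a"
    "orbit_cls (put_last t x) \<in> fst (fchart t B) \<inter> fst (fchart t B')"
    "snd (fchart t B) (orbit_cls (put_last t x)) = x"
    "snd (fchart t B') (orbit_cls (put_last t x)) = deck3 t a b c x"
proof -
  have e: "orbit_cls (put_last t x) = orbit_cls (put_last t (deck3 t a b c x))"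
    using orbit_cls_deck[OF abc, of "put_last t x"] by (simp add: deck_put_last)
  obtain a' b' c' where abc': "deck3 t a b c x = deck3 t a' b' c' x"
    "jac (fchart t B) (fchart t B') (orbit_cls (put_last t x)) = shear a'"
    by (rule fchart_transition[OF B B' e]) (rule that, assumption+)
  have "b = b'" using arg_cong[OF abc'(1), of "\<lambda>v. v $ 2"] by simp
  then have "a = a'" using arg_cong[OF abc'(1), of "\<lambda>v. v $ 1"] by simp
  then show "jac (fchart t B) (fchart t B') (orbit_cls (put_last t x)) = shear a" using abc' by simp
  show "orbit_cls (put_last t x) \<in> fst (fchart t B) \<inter> fst (fchart t B')"
    unfolding fchart_simps(2)[OF B(1)] fchart_simps(2)[OF B'(1)] using B B' e by auto
  show "snd (fchart t B) (orbit_cls (put_last t x)) = x" by (rule fchart_simps(3)[OF B])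
  show "snd (fchart t B') (orbit_cls (put_last t x)) = deck3 t a b c x" unfolding e by (rule fchart_simps(3)[OF B'])
qed

text \<open>
  The metric and the conformal factor are pulled back to the cover, where they are invariant under the deck group. At each
  point the sheet of radius one half around it serves as chart. The factor is assumed invariant
  only under changes of charts with differential a shear, since these are the ones that occur.
\<close>

lemma no_conformally_balanced:
  fixes \<rho> :: "(point, 3) chart \<Rightarrow> complex ^ 3 \<Rightarrow> real"
  assumes t: "cmod t < 1" "Im t \<noteq> 0" and g: "hermitian_metric (fibre t) g"
    and \<rho>1: "\<And>c. c \<in> atlas (fibre t) \<Longrightarrow> Ck_on (Suc 0) (snd c ` fst c) (\<rho> c)"
    and \<rho>_pos: "\<And>c x. c \<in> atlas (fibre t) \<Longrightarrow> x \<in> snd c ` fst c \<Longrightarrow> 0 < \<rho> c x"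
    and \<rho>_inv: "\<And>c c' p a. c \<in> atlas (fibre t) \<Longrightarrow> c' \<in> atlas (fibre t) \<Longrightarrow> p \<in> fst c \<inter> fst c' \<Longrightarrow>
        jac c c' p = shear a \<Longrightarrow> \<rho> c (snd c p) = \<rho> c' (snd c' p)"
    and closed: "\<And>c x v. c \<in> atlas (fibre t) \<Longrightarrow> x \<in> snd c ` fst c \<Longrightarrow>
        ext_deriv 4 (\<lambda>y w. of_real (\<rho> c y) * fund_sq g c y w) x v = 0"
  shows False
proof -
  define B where "B = (\<lambda>w. ball (put_last t w) (1/2) \<inter> base)"
  define C where "C = (\<lambda>w. fchart t (B w))"
  define N where "N = (\<lambda>w. {y. put_last t y \<in> B w})"
  have pb: "put_last t w \<in> base" for w using t by (simp add: base_def)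
  have B: "evenly_covering (B w)" for w unfolding B_def by (rule evenly_covering_ball[OF pb])
  have wB: "put_last t w \<in> B w" for w using pb by (simp add: B_def)
  have C: "C w \<in> atlas (fibre t)" for w unfolding C_def by (rule fchart_simps(1)[OF B])
  have fC: "fchart t (B w) = C w" for w by (simp add: C_def)
  have N: "snd (C w) ` fst (C w) = N w" for w unfolding C_def N_def by (rule fchart_simps(4)[OF B])
  have oN: "open (N w)" for w using fibre_image_open[OF C] N by metis
  have wN: "w \<in> N w" for w using wB by (simp add: N_def)
  define f where "f = (\<lambda>x a b. g (C x) x (J a) b)"
  define R where "R = (\<lambda>x. \<rho> (C x) x)"
  have deck: "g (C y) (deck3 t a b c x) (shear a u) (shear a v) = g (C z) x u v" "\<rho> (C y) (deck3 t a b c x) = \<rho> (C z) x"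
    if "a \<in> gauss" "b \<in> gauss" "c \<in> gauss" "x \<in> N z" "deck3 t a b c x \<in> N y" for a b c x y z u v
  proof -
    have xB: "put_last t x \<in> B z" "put_last t (deck3 t a b c x) \<in> B y" using that by (simp_all add: N_def)
    note d = fchart_transition_deck[OF B xB(1) B xB(2) that(1-3), unfolded fC]
    have "g (C z) (snd (C z) (orbit_cls (put_last t x))) u v =
       g (C y) (snd (C y) (orbit_cls (put_last t x))) (jac (C z) (C y) (orbit_cls (put_last t x)) u) (jac (C z) (C y) (orbit_cls (put_last t x)) v)"
      by (rule hermitian_metric_transition[OF g C C d(2)])
    then show "g (C y) (deck3 t a b c x) (shear a u) (shear a v) = g (C z) x u v" unfolding d(1,3,4) by simp
    show "\<rho> (C y) (deck3 t a b c x) = \<rho> (C z) x"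
      using \<rho>_inv[OF C C d(2) d(1)] unfolding d(3,4) by simp
  qed
  have deck0: "deck3 t 0 0 0 x = x" "shear 0 v = v" for x v by (simp_all add: vec_eq_iff forall_3)
  have loc: "g (C y) y u v = g (C w) y u v" "\<rho> (C y) y = \<rho> (C w) y" if "y \<in> N w" for y w u v
    using deck(1)[of 0 0 0 y w y u v] deck(2)[of 0 0 0 y w y] that wN[of y] by (simp_all add: deck0)
  have hp: "hermitian_product (g (C w) x)" if "x \<in> N w" for w x
    by (rule hermitian_productI[OF g C]) (simp add: N that)
  have f1: "Ck_on (Suc 0) UNIV (\<lambda>x. f x a b)" for a b
  proof (rule Ck_on_local)
    fix w
    have "smooth_on (N w) (\<lambda>x. g (C w) x (J a) b)"
      unfolding N[symmetric] by (rule hermitian_metric_smooth[OF g C])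
    then have "Ck_on (Suc 0) (N w) (\<lambda>x. f x a b)"
      by (intro Ck_on_cong[OF oN smooth_imp_C1]) (auto simp: f_def loc(1)[of _ w])
    then show "\<exists>T. open T \<and> w \<in> T \<and> Ck_on (Suc 0) T (\<lambda>x. f x a b)" using oN wN by blast
  qed
  have R1: "Ck_on (Suc 0) UNIV R"
  proof (rule Ck_on_local)
    fix w
    have "Ck_on (Suc 0) (N w) (\<rho> (C w))" using \<rho>1[OF C[of w]] by (simp only: N)
    then have "Ck_on (Suc 0) (N w) R"
      by (rule Ck_on_cong[OF oN]) (simp add: R_def loc(2)[of _ w])
    then show "\<exists>T. open T \<and> w \<in> T \<and> Ck_on (Suc 0) T R" using oN wN by blast
  qed
  show False
  proof (rule no_invariant_closed_form[OF t(2) f1 R1])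
    fix x
    interpret hermitian_product "g (C x) x" by (rule hp[OF wN])
    have JR: "J (r *\<^sub>R v) = r *\<^sub>R J v" for r and v :: "complex ^ 3" by (simp add: vec_eq_iff)
    show "bilinear (f x)"
      unfolding bilinear_def f_def
      by (auto intro!: linearI simp: lins vector_add_ldistrib JR)
    show "f x b a = - f x a b" for a b
      using J_left[of b a] sym[of b "J a"] by (simp add: f_def)
    show "f x (J a) (J b) = f x a b" for a b
      by (simp only: f_def J)
    have "0 < R x" unfolding R_def by (rule \<rho>_pos[OF C]) (simp add: N wN)
    then show "0 < four_form (R x) (f x) (axis 1 1) (J (axis 1 1)) (axis 3 1) (J (axis 3 1))"
      unfolding f_def by (rule four_form_pos)
  next
    fix a b c x u v assume abc: "a \<in> gauss" "b \<in> gauss" "c \<in> gauss"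
    have s: "shear a (J u) = J (shear a u)" for u by (simp add: vec_eq_iff forall_3 algebra_simps)
    show "f (deck3 t a b c x) (shear a u) (shear a v) = f x u v"
      unfolding f_def s[symmetric] by (rule deck(1)[OF abc wN wN])
    show "R (deck3 t a b c x) = R x" unfolding R_def by (rule deck(2)[OF abc wN wN])
  next
    fix x v0 v1 v2 v3 v4 :: "complex ^ 3"
    let ?q = "\<lambda>a b c d y. four_form (R y) (f y) a b c d"
    define v where "v = (\<lambda>i::nat. if i = 0 then v0 else if i = 1 then v1 else if i = 2 then v2 else if i = 3 then v3 else v4)"
    have v: "v 0 = v0" "v 1 = v1" "v 2 = v2" "v 3 = v3" "v 4 = v4" by (simp_all add: v_def)
    have qd: "((\<lambda>y. complex_of_real (2 * ?q a b c d y)) has_derivative (\<lambda>u. of_real (2 * fder (?q a b c d) x u))) (at x)" for a b c d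
    proof -
      have "(?q a b c d has_derivative fder (?q a b c d) x) (at x)"
        using four_form_C1[where f = f and a = a and b = b and c = c and d = d, OF open_UNIV f1 R1] by (simp flip: frechet_derivative_works)
      then show ?thesis by (intro has_derivative_of_real has_derivative_mult_right)
    qed
    have eq: "of_real (\<rho> (C x) y) * fund_sq g (C x) y w = of_real (2 * ?q (w 0) (w 1) (w 2) (w 3) y)" if y: "y \<in> N x" for y w
    proof -
      interpret hermitian_product "g (C x) y" by (rule hp[OF y])
      have fs: "fund_sq g (C x) y w = 2 * (of_real (f y (w 0) (w 1)) * of_real (f y (w 2) (w 3))
          - of_real (f y (w 0) (w 2)) * of_real (f y (w 1) (w 3)) + of_real (f y (w 0) (w 3)) * of_real (f y (w 1) (w 2)))"
        unfolding fund_sq_def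
      proof (rule wedge_2_2)
        show "fund_form g (C x) y v = complex_of_real (f y (v 0) (v 1))" for v
          by (simp add: fund_form_def f_def loc(1)[OF y])
        show "complex_of_real (f y b a) = - complex_of_real (f y a b)" for a b
          using J_left[of b a] sym[of b "J a"] by (simp add: f_def loc(1)[OF y])
      qed
      show ?thesis unfolding fs by (simp add: four_form_def R_def loc(2)[OF y] algebra_simps)
    qed
    have "ext_deriv 4 (\<lambda>y w. of_real (2 * ?q (w 0) (w 1) (w 2) (w 3) y)) x v = 0"
      using closed[OF C, of x x v] ext_deriv_cong[OF oN wN eq, where k = 4 and v = v] wN by (simp add: N)
    then have "complex_of_real (2 * (fder (?q v1 v2 v3 v4) x v0 - fder (?q v0 v2 v3 v4) x v1 + fder (?q v0 v1 v3 v4) x v2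
        - fder (?q v0 v1 v2 v4) x v3 + fder (?q v0 v1 v2 v3) x v4)) = 0"
      unfolding ext_deriv_4[of "\<lambda>y a b c d. complex_of_real (2 * ?q a b c d y)"] fder_eq[OF qd] v
      by (simp add: algebra_simps)
    then show "fder (\<lambda>y. four_form (R y) (f y) v1 v2 v3 v4) x v0 - fder (\<lambda>y. four_form (R y) (f y) v0 v2 v3 v4) x v1
        + fder (\<lambda>y. four_form (R y) (f y) v0 v1 v3 v4) x v2 - fder (\<lambda>y. four_form (R y) (f y) v0 v1 v2 v4) x v3
        + fder (\<lambda>y. four_form (R y) (f y) v0 v1 v2 v3) x v4 = 0"
      by (simp only: of_real_eq_0_iff mult_eq_0_iff) simp
  qed
qed

lemma no_balanced_metric:
  assumes t: "cmod t < 1" "Im t \<noteq> 0"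
  shows "\<not> balanced_metric (fibre t) g"
proof
  assume b: "balanced_metric (fibre t) g"
  show False
    by (rule no_conformally_balanced[OF t, of g "\<lambda>c x. 1"])
       (use b in \<open>auto simp: balanced_metric_def Ck_on_const simp del: Ck_on.simps\<close>)
qed

text \<open>
  The norm of a holomorphic volume form is an admissible conformal factor: numerator and Gram determinant are
  positive and smooth, and shears preserve both, having determinant one.
\<close>

lemma no_strominger:
  assumes t: "cmod t < 1" "Im t \<noteq> 0" and \<Psi>: "hol_volume_form (fibre t) \<Psi>" and g: "hermitian_metric (fibre t) g"
    and closed: "\<And>c x v. c \<in> atlas (fibre t) \<Longrightarrow> x \<in> snd c ` fst c \<Longrightarrow>
        ext_deriv 4 (\<lambda>y w. of_real (form_norm g \<Psi> c y) * fund_sq g c y w) x v = 0"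
  shows False
proof (rule no_conformally_balanced[OF t g _ _ _ closed])
  let ?b = "\<lambda>k::3. axis k 1 :: complex ^ 3"
  let ?\<beta> = "\<lambda>i. ?b (of_nat (Suc i))"
  define d where "d = (\<lambda>c x. Re (det (\<chi> j k. Complex (g c x (?b j) (?b k)) (g c x (?b j) (J (?b k))) :: complex ^ 3 ^ 3)))"
  have fn: "form_norm g \<Psi> c x = cmod (\<Psi> c x ?\<beta>) / sqrt (d c x)" for c x
    by (simp add: form_norm_def d_def Let_def)
  have \<Psi>det: "\<Psi> c x v = det3 (v 0) (v 1) (v 2) * \<Psi> c x ?\<beta>" if c: "c \<in> atlas (fibre t)" and x: "x \<in> snd c ` fst c" for c x v
  proof (rule alternating_3_det)
    show "alternating_form 3 (\<Psi> c x)"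
      using \<Psi> c x whole_img[OF c] unfolding hol_volume_form_def form_on_def by blast
    show "\<Psi> c x (v(i := a *s v i)) = a * \<Psi> c x v" if "i < 3" for v i a
      using \<Psi> c x that unfolding hol_volume_form_def by blast
  qed
  have \<Psi>0: "\<Psi> c x ?\<beta> \<noteq> 0" if c: "c \<in> atlas (fibre t)" and x: "x \<in> snd c ` fst c" for c x
  proof -
    obtain v where "\<Psi> c x v \<noteq> 0" using \<Psi> c x unfolding hol_volume_form_def by blast
    then show ?thesis using \<Psi>det[OF c x, of v] by auto
  qed
  have dpos: "0 < d c x" if "c \<in> atlas (fibre t)" "x \<in> snd c ` fst c" for c x
    unfolding d_def by (rule hermitian_product.gram_pos[OF hermitian_productI[OF g that]])
  fix c assume c: "c \<in> atlas (fibre t)"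
  show "0 < form_norm g \<Psi> c x" if "x \<in> snd c ` fst c" for x
    unfolding fn using \<Psi>0[OF c that] dpos[OF c that] by simp
  show "Ck_on (Suc 0) (snd c ` fst c) (form_norm g \<Psi> c)"
  proof -
    let ?S = "snd c ` fst c"
    have o: "open ?S" by (rule fibre_image_open[OF c])
    have h: "smooth_on ?S (\<lambda>x. \<Psi> c x ?\<beta>)"
      using \<Psi> c unfolding hol_volume_form_def by (intro hol_fun_smooth) blast
    have n: "smooth_on ?S (\<lambda>x. Re (\<Psi> c x ?\<beta> * cnj (\<Psi> c x ?\<beta>)))"
      by (intro smooth_on_linear[OF bounded_linear_Re] smooth_on_mult h smooth_on_linear[OF bounded_linear_cnj])
    have gs: "smooth_on ?S (\<lambda>x. Complex (g c x u v) (g c x u w))" for u v w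
    proof -
      have s: "smooth_on ?S (\<lambda>x. g c x u v)" for u v by (rule hermitian_metric_smooth[OF g c])
      have "smooth_on ?S (\<lambda>x. complex_of_real (g c x u v) + \<i> * complex_of_real (g c x u w))"
        by (intro smooth_on_add smooth_on_mult smooth_on_const o smooth_on_linear[OF bounded_linear_of_real] s)
      then show ?thesis by (rule smooth_on_cong) (simp add: complex_eq_iff)
    qed
    have ds: "smooth_on ?S (d c)"
      unfolding d_def det_3 vec_lambda_beta
      by (intro smooth_on_linear[OF bounded_linear_Re] smooth_on_add smooth_on_diff smooth_on_mult gs)
    have sq: "(sqrt has_real_derivative inverse (sqrt y) / 2) (at y)" if "0 < y" for y
      using DERIV_real_sqrt[OF that] .
    have 1: "Ck_on (Suc 0) ?S (\<lambda>x. sqrt (Re (\<Psi> c x ?\<beta> * cnj (\<Psi> c x ?\<beta>))))"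
      by (rule Ck_1_compose[OF o smooth_imp_C1[OF n] _ sq])
         (use \<Psi>0[OF c] in \<open>auto simp: complex_mult_cnj sum_power2_gt_zero_iff complex_eq_iff intro!: continuous_intros\<close>)
    have 2: "Ck_on (Suc 0) ?S (\<lambda>x. sqrt (d c x))"
      by (rule Ck_1_compose[OF o smooth_imp_C1[OF ds] _ sq]) (use dpos[OF c] in \<open>auto intro!: continuous_intros\<close>)
    have iv: "(inverse has_real_derivative - (inverse y * inverse y)) (at y)" if "0 < y" for y :: real
      using DERIV_inverse[of y UNIV] that by (simp add: power2_eq_square numeral_2_eq_2)
    have 3: "Ck_on (Suc 0) ?S (\<lambda>x. inverse (sqrt (d c x)))"
      by (rule Ck_1_compose[OF o 2 _ iv]) (use dpos[OF c] in \<open>auto intro!: continuous_intros\<close>)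
    have "Ck_on (Suc 0) ?S (\<lambda>x. sqrt (Re (\<Psi> c x ?\<beta> * cnj (\<Psi> c x ?\<beta>))) * inverse (sqrt (d c x)))"
      by (rule Ck_on_bilinear[OF bounded_bilinear_mult o 1 3])
    moreover have "sqrt (Re (z * cnj z)) * inverse (sqrt r) = cmod z / sqrt r" for z r
      by (simp add: complex_mult_cnj cmod_def divide_inverse)
    ultimately show ?thesis unfolding fn[abs_def] by simp
  qed
  fix c' p a assume c': "c' \<in> atlas (fibre t)" and p: "p \<in> fst c \<inter> fst c'" and j: "jac c c' p = shear a"
  have x: "snd c p \<in> snd c ` fst c" and x': "snd c' p \<in> snd c' ` fst c'" using p by auto
  have pt: "p \<in> topspace (mtop (fibre t))" using p chart_on_simps(5)[OF fibre_chart_on[OF c]] by blast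
  have "\<Psi> c (snd c p) ?\<beta> = \<Psi> c' (snd c' p) (\<lambda>i. jac c c' p (?\<beta> i))"
  proof -
    have "form_on (fibre t) (topspace (mtop (fibre t))) 3 \<Psi>"
      using \<Psi> unfolding hol_volume_form_def by (rule conjunct1)
    then have "\<forall>c\<in>atlas (fibre t). \<forall>c'\<in>atlas (fibre t). \<forall>p \<in> fst c \<inter> fst c' \<inter> topspace (mtop (fibre t)). \<forall>v.
        \<Psi> c (snd c p) v = \<Psi> c' (snd c' p) (\<lambda>i. jac c c' p (v i))"
      unfolding form_on_def by (rule conjunct2)
    moreover have "p \<in> fst c \<inter> fst c' \<inter> topspace (mtop (fibre t))" using p pt by blast
    ultimately have "\<forall>v. \<Psi> c (snd c p) v = \<Psi> c' (snd c' p) (\<lambda>i. jac c c' p (v i))" by (rule bspec[OF bspec[OF bspec[OF _ c] c']])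
    then show ?thesis by (rule spec)
  qed
  also have "\<dots> = \<Psi> c' (snd c' p) ?\<beta>"
    unfolding j by (subst \<Psi>det[OF c' x']) (simp add: det3_def axis_def)
  finally have P: "\<Psi> c (snd c p) ?\<beta> = \<Psi> c' (snd c' p) ?\<beta>" .
  have "g c (snd c p) u v = g c' (snd c' p) (shear a u) (shear a v)" for u v
    unfolding j[symmetric] by (rule hermitian_metric_transition[OF g c c' p])
  then have D: "d c (snd c p) = d c' (snd c' p)"
    unfolding d_def by (simp only: hermitian_product.gram_shear[OF hermitian_productI[OF g c' x']])
  show "form_norm g \<Psi> c (snd c p) = form_norm g \<Psi> c' (snd c' p)"
    unfolding fn P D ..
qed

section \<open>Failure of stability\<close>

theorem theorem3p2:
  shows "(\<exists>(\<epsilon>::real) (Y :: (point, 4) cman) (f :: point \<Rightarrow> complex).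
            0 < \<epsilon> \<and>
            holomorphic_family Y f (ball 0 \<epsilon>) \<and>
            (\<forall>t\<in>ball 0 \<epsilon>. compact_complex_manifold (family_fibre Y f t) \<and>
                            hol_trivial_canonical (family_fibre Y f t)) \<and>
            (\<exists>\<alpha>>0. admits_strominger (family_fibre Y f 0) \<alpha>) \<and>
            (\<forall>t\<in>ball 0 \<epsilon>. Im t \<noteq> 0 \<longrightarrow> \<not> (\<exists>g. balanced_metric (family_fibre Y f t) g)))
         \<and> \<not> stable_under_deformations (strominger_property :: (point, 3) cman \<Rightarrow> bool)"
proof
  have adm: "admits_strominger (fibre 0) 4"
    unfolding admits_strominger_def using hol_volume_form_vol_form strominger_iwa by blast
  show "\<exists>(\<epsilon>::real) (Y :: (point, 4) cman) (f :: point \<Rightarrow> complex).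
            0 < \<epsilon> \<and>
            holomorphic_family Y f (ball 0 \<epsilon>) \<and>
            (\<forall>t\<in>ball 0 \<epsilon>. compact_complex_manifold (family_fibre Y f t) \<and>
                            hol_trivial_canonical (family_fibre Y f t)) \<and>
            (\<exists>\<alpha>>0. admits_strominger (family_fibre Y f 0) \<alpha>) \<and>
            (\<forall>t\<in>ball 0 \<epsilon>. Im t \<noteq> 0 \<longrightarrow> \<not> (\<exists>g. balanced_metric (family_fibre Y f t) g))"
  proof (rule exI[of _ "1::real"], rule exI[of _ total_space], rule exI[of _ total_proj], intro conjI ballI impI)
    show "\<exists>\<alpha>>0. admits_strominger (fibre 0) \<alpha>" using adm by (intro exI[of _ 4]) simp
  qed (use family_total compact_fibre hol_trivial_canonical_fibre no_balanced_metric in auto)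
  show "\<not> stable_under_deformations (strominger_property :: (point, 3) cman \<Rightarrow> bool)"
  proof
    assume "stable_under_deformations (strominger_property :: (point, 3) cman \<Rightarrow> bool)"
    moreover have "strominger_property (fibre 0)"
      unfolding strominger_property_def
      using compact_fibre[of 0] hol_trivial_canonical_fibre adm by (auto intro!: exI[of _ 4])
    ultimately obtain \<delta> where \<delta>: "0 < \<delta>" "\<forall>t\<in>ball 0 1. dist t 0 < \<delta> \<longrightarrow> strominger_property (fibre t)"
      unfolding stable_under_deformations_def using family_total by (metis centre_in_ball zero_less_one)
    define t where "t = \<i> * of_real (min (\<delta> / 2) (1 / 2))"
    have n: "cmod t = min (\<delta> / 2) (1 / 2)" using \<delta>(1) by (simp add: t_def norm_mult)
    have t: "cmod t < 1" "Im t \<noteq> 0" using \<delta>(1) n by (auto simp: t_def)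
    have "cmod t < \<delta>" using \<delta>(1) n by auto
    then have "strominger_property (fibre t)" using \<delta>(2) t by simp
    then obtain \<Psi> \<alpha> g \<Gamma> r \<U> \<tau> h A where "hol_volume_form (fibre t) \<Psi>"
      "strominger_solution (fibre t) \<Psi> \<alpha> g \<Gamma> r \<U> \<tau> h A"
      unfolding strominger_property_def admits_strominger_def by blast
    then show False
      unfolding strominger_solution_def by (intro no_strominger[OF t]) blast+
  qed
qed

end
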